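(* Let $\overline{B}_0\in V\cap C(\mathbb{T}^3;\mathbb{R}^3)$ be not identically zero, and let $t>0$. Then for every $R>0$ there exist a ball $B(x_0,r)\subset\mathbb{T}^3$ (with $r>0$) and $\lambda>0$ such that $$\mu_{t,x}\left(B(0,R)^c\right)\ge\lambda\qquad\text{for all }x\in B(x_0,r),$$ where $\mu_{t,x}=\mu(t,x,db)$ is the solution of the limit equation $\partial_t\mu=\operatorname{div}_b(\mathcal{L}(b)\nabla_b\mu)$, $\mu(0,x,db)=\delta_{\overline{B}_0(x)}(db)$, with $\mathcal{L}(b)=\frac{8\pi\log2}{15}(2|b|^2I-b\otimes b)$, given by the representation recalled in the context.
   Context: $\mathbb{T}^3=\mathbb{R}^3/(2\pi\mathbb{Z})^3$; $V$ is the space of zero-mean, divergence-free vector fields in $H^1(\mathbb{T}^3;\mathbb{R}^3)$; balls $B(0,R)$ are in $\mathbb{R}^3$. $\mathcal{L}(b)=\mathcal{A}(b)\mathcal{A}(b)$, where $$\mathcal{A}(b)=\frac{\sqrt{8\pi\log2}\,|b|}{\sqrt{15}}\frac{b\otimes b}{|b|^2}+\frac{4\sqrt{\pi\log2}\,|b|}{\sqrt{15}}\left(I-\frac{b\otimes b}{|b|^2}\right)\ (b\ne0),\qquad \mathcal{A}(0)=0,$$ is Lipschitz. For $\nu\in\mathbb{R}^3$ let $b^\nu$ be the solution of $db_t=\mathcal{A}(b_t)d\hat W_t$, $b_0=\nu$, with $\hat W$ a 3-dimensional Brownian motion. The measure $\mu_{t,x}$ is represented as the law of $b_t^{\overline{B}_0(x)}$,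 in particular $\mu_{t,x}(B(0,R))=\mathbb{E}[\mathbf{1}_{B(0,R)}(b_t^{\overline{B}_0(x)})]$. *)

theory Defs
  imports "HOL-Probability.Probability"
begin

section \<open>Function spaces on the torus\<close>

text \<open>
  Functions on the torus (R / 2 pi Z)^3 are represented by functions on the whole space that are
  2 pi-periodic in each coordinate; points of the torus by arbitrary representatives.
\<close>

definition periodic :: "(real^3 \<Rightarrow> 'b) \<Rightarrow> bool" where
  "periodic u \<longleftrightarrow> (\<forall>x i. u (x + axis i (2 * pi)) = u x)"

definition torus_cell :: "(real^3) set" where
  "torus_cell = {x. \<forall>i. 0 \<le> x $ i \<and> x $ i < 2 * pi}"

text \<open>
  Representatives of the points of the ball B(x0, r) of the quotient metric.
\<close>

definition torus_ball :: "real^3 \<Rightarrow> real \<Rightarrow> (real^3) set" where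
  "torus_ball x0 r = {x. \<exists>k :: int^3. dist x (x0 + (\<chi> i. 2 * pi * of_int (k $ i))) < r}"

definition partial_deriv :: "3 \<Rightarrow> (real^3 \<Rightarrow> real) \<Rightarrow> real^3 \<Rightarrow> real" where
  "partial_deriv j \<phi> x = frechet_derivative \<phi> (at x) (axis j 1)"

primrec k_times_diff :: "nat \<Rightarrow> (real^3 \<Rightarrow> real) \<Rightarrow> bool" where
  "k_times_diff 0 \<phi> \<longleftrightarrow> continuous_on UNIV \<phi>"
| "k_times_diff (Suc n) \<phi> \<longleftrightarrow>
     \<phi> differentiable_on UNIV \<and> (\<forall>j. k_times_diff n (partial_deriv j \<phi>))"

definition smooth_periodic :: "(real^3 \<Rightarrow> real) \<Rightarrow> bool" where
  "smooth_periodic \<phi> \<longleftrightarrow> periodic \<phi> \<and> (\<forall>n. k_times_diff n \<phi>)"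

definition L2_torus :: "(real^3 \<Rightarrow> 'b::euclidean_space) \<Rightarrow> bool" where
  "L2_torus u \<longleftrightarrow> u \<in> borel_measurable borel \<and>
     set_integrable lborel torus_cell (\<lambda>x. (norm (u x))\<^sup>2)"

text \<open>\<open>G x $ i $ j\<close> is the distributional derivative of the component \<open>u $ i\<close> in direction \<open>j\<close>.\<close>

definition weak_gradient :: "(real^3 \<Rightarrow> real^3) \<Rightarrow> (real^3 \<Rightarrow> real^3^3) \<Rightarrow> bool" where
  "weak_gradient u G \<longleftrightarrow>
     (\<forall>i j \<phi>. smooth_periodic \<phi> \<longrightarrow>
        (LINT x:torus_cell|lborel. u x $ i * partial_deriv j \<phi> x)
          = - (LINT x:torus_cell|lborel. G x $ i $ j * \<phi> x))"

text \<open>Zero-mean divergence-free fields in H^1 of the torus.\<close>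

definition space_V :: "(real^3 \<Rightarrow> real^3) set" where
  "space_V = {u. periodic u \<and> L2_torus u \<and>
     (LINT x:torus_cell|lborel. u x) = 0 \<and>
     (\<exists>G. L2_torus G \<and> weak_gradient u G \<and>
          (AE x in lborel. x \<in> torus_cell \<longrightarrow> (\<Sum>i\<in>UNIV. G x $ i $ i) = 0))}"


section \<open>Brownian motion and the Ito integral\<close>

text \<open>
  Time is the half-line of nonnegative reals; the members of the filtration and of the processes
  with negative index play no role (any filtration on the half-line extends constantly).
\<close>

definition filtered_prob_space :: "'a measure \<Rightarrow> (real \<Rightarrow> 'a measure) \<Rightarrow> bool" where
  "filtered_prob_space M F \<longleftrightarrow>
     prob_space M \<and> filtration (space M) F \<and> (\<forall>t. subalgebra M (F t))"

definition continuous_adapted ::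
    "'a measure \<Rightarrow> (real \<Rightarrow> 'a measure) \<Rightarrow> (real \<Rightarrow> 'a \<Rightarrow> real^3) \<Rightarrow> bool" where
  "continuous_adapted M F X \<longleftrightarrow>
     (\<forall>t\<ge>0. X t \<in> borel_measurable (F t)) \<and>
     (\<forall>\<omega>\<in>space M. continuous_on {0..} (\<lambda>t. X t \<omega>))"

text \<open>Standard 3-dimensional Brownian motion relative to the filtration \<open>F\<close>: the increment over
  [s,t] is independent of \<open>F s\<close> and centred Gaussian with covariance (t - s) I.\<close>

definition brownian_motion ::
    "'a measure \<Rightarrow> (real \<Rightarrow> 'a measure) \<Rightarrow> (real \<Rightarrow> 'a \<Rightarrow> real^3) \<Rightarrow> bool" where
  "brownian_motion M F W \<longleftrightarrow>
     continuous_adapted M F W \<and>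
     (AE \<omega> in M. W 0 \<omega> = 0) \<and>
     (\<forall>s t. 0 \<le> s \<and> s < t \<longrightarrow>
        distributed M lborel (\<lambda>\<omega>. W t \<omega> - W s \<omega>)
          (\<lambda>x. ennreal (\<Prod>i\<in>UNIV. normal_density 0 (sqrt (t - s)) (x $ i))) \<and>
        prob_space.indep_set M (sets (F s))
          {(\<lambda>\<omega>. W t \<omega> - W s \<omega>) -` B \<inter> space M | B. B \<in> sets borel})"

text \<open>
  Matrix-valued simple integrands: the value \<open>\<xi> i\<close> is taken on the interval
  (\<open>\<tau> i\<close>, \<open>\<tau> (i + 1)\<close>], for \<open>i < n\<close>.
\<close>

definition simple_integrand ::
    "'a measure \<Rightarrow> (real \<Rightarrow> 'a measure) \<Rightarrow> nat \<Rightarrow> (nat \<Rightarrow> real) \<Rightarrow> (nat \<Rightarrow> 'a \<Rightarrow> real^3^3) \<Rightarrow> bool"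
  where
  "simple_integrand M F n \<tau> \<xi> \<longleftrightarrow>
     0 \<le> \<tau> 0 \<and> (\<forall>i<n. \<tau> i < \<tau> (Suc i)) \<and>
     (\<forall>i<n. \<xi> i \<in> borel_measurable (F (\<tau> i)) \<and> (\<exists>C. \<forall>\<omega>\<in>space M. norm (\<xi> i \<omega>) \<le> C))"

definition simple_process ::
    "nat \<Rightarrow> (nat \<Rightarrow> real) \<Rightarrow> (nat \<Rightarrow> 'a \<Rightarrow> real^3^3) \<Rightarrow> real \<Rightarrow> 'a \<Rightarrow> real^3^3" where
  "simple_process n \<tau> \<xi> s \<omega> = (\<Sum>i<n. indicator {\<tau> i<..\<tau> (Suc i)} s *\<^sub>R \<xi> i \<omega>)"

definition simple_ito ::
    "(real \<Rightarrow> 'a \<Rightarrow> real^3) \<Rightarrow> nat \<Rightarrow> (nat \<Rightarrow> real) \<Rightarrow> (nat \<Rightarrow> 'a \<Rightarrow> real^3^3) \<Rightarrow> real \<Rightarrow> 'a \<Rightarrow> real^3"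
  where
  "simple_ito W n \<tau> \<xi> t \<omega> =
     (\<Sum>i<n. \<xi> i \<omega> *v (W (min t (\<tau> (Suc i))) \<omega> - W (min t (\<tau> i)) \<omega>))"

definition progressive ::
    "'a measure \<Rightarrow> (real \<Rightarrow> 'a measure) \<Rightarrow> (real \<Rightarrow> 'a \<Rightarrow> real^3^3) \<Rightarrow> bool" where
  "progressive M F H \<longleftrightarrow>
     (\<forall>T\<ge>0. (\<lambda>(s, \<omega>). H s \<omega>) \<in> borel_measurable (restrict_space borel {0..T} \<Otimes>\<^sub>M F T))"

text \<open>
  \<open>I\<close> is a version of the Ito integral of \<open>H\<close> against \<open>W\<close> over [0,t], for progressive \<open>H\<close> that are
  almost surely square integrable in time: the limit in probability of the integrals of simple
  integrands \<open>S k\<close> for which the time integral over [0,t] of the squared norm of \<open>H - S k\<close> tends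
  to 0 in probability.
\<close>

definition is_ito_integral ::
    "'a measure \<Rightarrow> (real \<Rightarrow> 'a measure) \<Rightarrow> (real \<Rightarrow> 'a \<Rightarrow> real^3) \<Rightarrow>
     (real \<Rightarrow> 'a \<Rightarrow> real^3^3) \<Rightarrow> real \<Rightarrow> ('a \<Rightarrow> real^3) \<Rightarrow> bool" where
  "is_ito_integral M F W H t I \<longleftrightarrow>
     progressive M F H \<and>
     (AE \<omega> in M. (\<integral>\<^sup>+s\<in>{0..t}. ennreal ((norm (H s \<omega>))\<^sup>2) \<partial>lborel) < \<infinity>) \<and>
     I \<in> borel_measurable M \<and>
     (\<exists>n \<tau> \<xi>.
        (\<forall>k. simple_integrand M F (n k) (\<tau> k) (\<xi> k)) \<and>
        (\<forall>\<epsilon>>0. (\<lambda>k. measure M {\<omega>\<in>space M.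
             (\<integral>\<^sup>+s\<in>{0..t}. ennreal ((norm (H s \<omega> - simple_process (n k) (\<tau> k) (\<xi> k) s \<omega>))\<^sup>2) \<partial>lborel)
               > ennreal \<epsilon>}) \<longlonglongrightarrow> 0) \<and>
        (\<forall>\<epsilon>>0. (\<lambda>k. measure M {\<omega>\<in>space M.
             norm (simple_ito W (n k) (\<tau> k) (\<xi> k) t \<omega> - I \<omega>) > \<epsilon>}) \<longlonglongrightarrow> 0))"


section \<open>The limit equation\<close>

definition outer :: "real^3 \<Rightarrow> real^3 \<Rightarrow> real^3^3" where
  "outer a b = (\<chi> i j. a $ i * b $ j)"

definition diffusion_matrix :: "real^3 \<Rightarrow> real^3^3" where
  "diffusion_matrix b =
     (if b = 0 then 0
      else (sqrt (8 * pi * ln 2) * norm b / sqrt 15) *\<^sub>R ((1 / (norm b)\<^sup>2) *\<^sub>R outer b b)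
         + (4 * sqrt (pi * ln 2) * norm b / sqrt 15) *\<^sub>R
             (mat 1 - (1 / (norm b)\<^sup>2) *\<^sub>R outer b b))"

text \<open>\<open>X\<close> solves the equation dX = A(X) dW with initial value \<open>\<nu>\<close>, A being the diffusion matrix.\<close>

definition sde_solution ::
    "'a measure \<Rightarrow> (real \<Rightarrow> 'a measure) \<Rightarrow> (real \<Rightarrow> 'a \<Rightarrow> real^3) \<Rightarrow> real^3 \<Rightarrow>
     (real \<Rightarrow> 'a \<Rightarrow> real^3) \<Rightarrow> bool" where
  "sde_solution M F W \<nu> X \<longleftrightarrow>
     continuous_adapted M F X \<and>
     (AE \<omega> in M. X 0 \<omega> = \<nu>) \<and>
     (\<forall>t\<ge>0. is_ito_integral M F W (\<lambda>s \<omega>. diffusion_matrix (X s \<omega>)) t (\<lambda>\<omega>. X t \<omega> - \<nu>))"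

text \<open>
  The solution \<open>\<mu>\<close> of the limit equation, given by its representation as the law at time \<open>t\<close> of
  the solution \<open>b \<nu>\<close> of the stochastic equation started at \<open>\<nu> = B0 x\<close>.
  It is this law, and not the partial differential equation d\<mu>/dt = div(L grad \<mu>) with L = A A,
  that defines \<open>\<mu>\<close> here: for a standard Brownian motion the Kolmogorov equation of dX = A(X) dW is
  d\<mu>/dt = (1/2) div(L grad \<mu>) (L has divergence-free rows), so the two descriptions differ by the
  factor 2 in time and cannot both be imposed.
\<close>

definition limit_measure ::
    "'a measure \<Rightarrow> (real^3 \<Rightarrow> real \<Rightarrow> 'a \<Rightarrow> real^3) \<Rightarrow> (real^3 \<Rightarrow> real^3) \<Rightarrow>
     real \<Rightarrow> real^3 \<Rightarrow> (real^3) measure" where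
  "limit_measure M b B0 t x = distr M borel (b (B0 x) t)"

end

theory Submission
  imports Defs
begin

text \<open>
  The lower bound is uniform over all initial values \<open>\<nu>\<close> with \<open>|\<nu>| \<ge> \<rho>\<close>; by continuity of the initial
  field such values fill a ball of the torus. The reason is the homogeneity of the diffusion matrix:
  over a short time \<open>h\<close> the solution is \<open>X + A(X) \<Delta>W\<close> up to an error of size \<open>O(h) |X|\<close>, while
  \<open>x \<bullet> A(x) v = c |x| (x \<bullet> v)\<close>, so an increment with \<open>X \<bullet> \<Delta>W \<ge> sqrt h |X|\<close> multiplies \<open>|X|\<close> by at
  least \<open>1 + c sqrt h - O(h)\<close>. Conditionally on the past this has a probability bounded below
  independently of \<open>h\<close> and \<open>X\<close>. Iterating over \<open>n = t / h\<close> steps gives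
  \<open>|X t| \<ge> (1 + (c/2) sqrt (t/n))^n \<rho> \<ge> (1 + (c/2) sqrt (n t)) \<rho>\<close> with positive probability, and the right
  side exceeds \<open>R\<close> for large \<open>n\<close>. Ito integrals are only controlled by Lenglart's inequality
  \<open>P(|I| > \<epsilon>) \<le> C \<delta> / \<epsilon>^2 + P(int |H|^2 > \<delta>)\<close>, localized to past events; no moments of the solution
  and no Ito formula are needed.
\<close>

section \<open>Gaussian increments\<close>

text \<open>What has to be balanced is the failure probability of a step. The Euler error is small
  only while the path stays within a relative distance \<theta> of its starting point. By Lenglart,
  leaving that ball has probability of order \<open>h / \<theta>\<^sup>2\<close>, and an error above
  \<open>\<eta> |X|\<close> inside it has probability of order
  \<open>\<theta>\<^sup>2 h / \<eta>\<^sup>2\<close>. With \<theta> of order \<open>sqrt h\<close>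
  and \<eta> of order \<open>h\<close> both are free of \<open>h\<close>, and suitable constants
  push their sum below half of the Gaussian probability. Every estimate of a step carries the factor
  \<open>measure M A\<close> for a past event \<open>A\<close>; this replaces conditional
  probabilities and lets the steps be multiplied. Dividing by \<open>|X s|\<close> turns relative
  bounds into constants; the weight is bounded because on \<open>A\<close> the norm has a
  deterministic positive lower bound. Lenglart's inequality is available at a fixed time only, so
  the supremum over a step is reached through a deterministic time grid. Growth is read off from
  \<open>X s \<bullet> X (s + h)\<close>, which is linear in the increment, so no second-order
  correction appears.\<close>

lemma Basis_vec_real: "(Basis :: (real^'n) set) = range (\<lambda>i. axis i 1)"
  by (auto simp: Basis_vec_def)

lemma nn_integral_lborel_vec_prod:
  fixes g :: "'n::finite \<Rightarrow> real \<Rightarrow> ennreal"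
  assumes [measurable]: "\<And>i. g i \<in> borel_measurable borel"
  shows "(\<integral>\<^sup>+x. (\<Prod>i\<in>UNIV. g i (x $ i)) \<partial>(lborel :: (real^'n) measure)) = (\<Prod>i\<in>UNIV. \<integral>\<^sup>+x. g i x \<partial>lborel)"
proof -
  \<comment> \<open>The product formula for \<open>lborel\<close> is indexed by basis vectors, the
    factors by coordinates; \<open>ix\<close> translates.\<close>
  define ix where "ix = (\<lambda>b :: real^'n. THE i. b = axis i 1)"
  have ix: "ix (axis i 1) = i" for i
    unfolding ix_def by (rule the_equality) (auto simp: axis_eq_axis)
  have inj: "inj (\<lambda>i. axis i 1 :: real^'n)"
    by (auto simp: inj_def axis_eq_axis)
  have "(\<integral>\<^sup>+x. (\<Prod>b\<in>Basis. g (ix b) (x \<bullet> b)) \<partial>(lborel :: (real^'n) measure))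
      = (\<Prod>b\<in>(Basis :: (real^'n) set). \<integral>\<^sup>+x. g (ix b) x \<partial>lborel)"
    by (rule nn_integral_lborel_prod) auto
  then show ?thesis
    unfolding Basis_vec_real using inj by (simp add: prod.reindex ix inner_axis)
qed

text \<open>An indicator is inserted in the \<open>k\<close>-th factor only; the other factors
  integrate to 1.\<close>

lemma normal_prod_component:
  fixes X :: "'a \<Rightarrow> real^'n"
  assumes D: "distributed M lborel X (\<lambda>x. ennreal (\<Prod>i\<in>UNIV. normal_density 0 \<sigma> (x $ i)))" and \<sigma>: "\<sigma> > 0"
  shows "distributed M lborel (\<lambda>\<omega>. X \<omega> $ k) (normal_density 0 \<sigma>)"
proof -
  have X[measurable]: "X \<in> borel_measurable M" using distributed_measurable[OF D] by simp
  have Xk[measurable]: "(\<lambda>\<omega>. X \<omega> $ k) \<in> borel_measurable M"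
    by (rule measurable_compose[OF X]) measurable
  have "distr M lborel (\<lambda>\<omega>. X \<omega> $ k) = density lborel (normal_density 0 \<sigma>)"
  proof (rule measure_eqI)
    fix A assume "A \<in> sets (distr M lborel (\<lambda>\<omega>. X \<omega> $ k))"
    then have A[measurable]: "A \<in> sets borel" by simp
    have [measurable]: "(\<lambda>x::real^'n. indicator A (x $ k) :: ennreal) \<in> borel_measurable borel"
      by measurable
    have "emeasure (distr M lborel (\<lambda>\<omega>. X \<omega> $ k)) A = emeasure M (X -` {x. x $ k \<in> A} \<inter> space M)"
      by (subst emeasure_distr) (auto simp: vimage_def Int_def)
    also have "\<dots> = (\<integral>\<^sup>+x. ennreal (\<Prod>i\<in>UNIV. normal_density 0 \<sigma> (x $ i)) * indicator {x. x $ k \<in> A} x \<partial>lborel)"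
      by (rule distributed_emeasure[OF D]) measurable
    also have "\<dots> = (\<integral>\<^sup>+x. (\<Prod>i\<in>UNIV. ennreal (normal_density 0 \<sigma> (x $ i)) * (if i = k then indicator A (x $ i) else 1)) \<partial>(lborel :: (real^'n) measure))"
    proof (rule nn_integral_cong)
      fix x :: "real^'n"
      have "(\<Prod>i\<in>UNIV. ennreal (normal_density 0 \<sigma> (x $ i)) * (if i = k then indicator A (x $ i) else 1)) =
        (\<Prod>i\<in>UNIV. ennreal (normal_density 0 \<sigma> (x $ i))) * (indicator A (x $ k))"
        by (simp add: prod.distrib prod.delta)
      then show "ennreal (\<Prod>i\<in>UNIV. normal_density 0 \<sigma> (x $ i)) * indicator {x. x $ k \<in> A} x =
        (\<Prod>i\<in>UNIV. ennreal (normal_density 0 \<sigma> (x $ i)) * (if i = k then indicator A (x $ i) else 1))"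
        by (simp add: prod_ennreal indicator_def)
    qed
    also have "\<dots> = (\<Prod>i\<in>UNIV. \<integral>\<^sup>+x. ennreal (normal_density 0 \<sigma> x) * (if i = k then indicator A x else 1) \<partial>lborel)"
      by (rule nn_integral_lborel_vec_prod[of "\<lambda>i x. ennreal (normal_density 0 \<sigma> x) * (if i = k then indicator A x else 1)"]) measurable
    also have "\<dots> = (\<Prod>i\<in>UNIV. if i = k then (\<integral>\<^sup>+x. ennreal (normal_density 0 \<sigma> x) * indicator A x \<partial>lborel) else 1)"
    proof (rule prod.cong[OF refl])
      fix i :: 'n
      have "(\<integral>\<^sup>+x. ennreal (normal_density 0 \<sigma> x) \<partial>lborel) = 1"
        using \<sigma> by (subst nn_integral_eq_integral) auto
      then show "(\<integral>\<^sup>+x. ennreal (normal_density 0 \<sigma> x) * (if i = k then indicator A x else 1) \<partial>lborel)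
         = (if i = k then (\<integral>\<^sup>+x. ennreal (normal_density 0 \<sigma> x) * indicator A x \<partial>lborel) else 1)"
        by auto
    qed
    also have "\<dots> = emeasure (density lborel (normal_density 0 \<sigma>)) A"
      by (simp add: prod.delta emeasure_density)
    finally show "emeasure (distr M lborel (\<lambda>\<omega>. X \<omega> $ k)) A = emeasure (density lborel (normal_density 0 \<sigma>)) A" .
  qed simp
  then show ?thesis unfolding distributed_def by simp
qed

text \<open>In each coordinate the interval from \<sigma> to 2 \<sigma>, or its mirror image, has
  length \<sigma> and density at least \<open>exp (-2) / sqrt (2 * pi * \<sigma>\<^sup>2)\<close>,
  so \<sigma> cancels. This scale invariance makes the success probability of a step independent of
  its length.\<close>

lemma normal_prod_octant_box:
  fixes X :: "'a \<Rightarrow> real^'n" and sg :: "'n \<Rightarrow> real"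
  assumes D: "distributed M lborel X (\<lambda>x. ennreal (\<Prod>i\<in>UNIV. normal_density 0 \<sigma> (x $ i)))" and \<sigma>: "\<sigma> > 0"
    and sg: "\<And>i. sg i = 1 \<or> sg i = -1"
  shows "emeasure M {\<omega>\<in>space M. \<forall>i. sg i * X \<omega> $ i \<ge> \<sigma>} \<ge> ennreal ((exp (-2) / sqrt (2 * pi)) ^ CARD('n))"
proof -
  have X[measurable]: "X \<in> borel_measurable M" using distributed_measurable[OF D] by simp
  define J where "J i = (if sg i = 1 then {\<sigma>..2*\<sigma>} else {-2*\<sigma>..-\<sigma>})" for i
  have [measurable]: "J i \<in> sets borel" for i by (simp add: J_def)
  have one: "ennreal (exp (-2) / sqrt (2 * pi)) \<le> (\<integral>\<^sup>+x. ennreal (normal_density 0 \<sigma> x) * indicator (J i) x \<partial>lborel)" for i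
  proof -
    have bd: "normal_density 0 \<sigma> x \<ge> exp (-2) / sqrt (2 * pi * \<sigma>\<^sup>2)" if "x \<in> J i" for x
    proof -
      have "\<bar>x\<bar> \<le> 2 * \<sigma>" using that \<sigma> by (auto simp: J_def split: if_splits)
      then have "x\<^sup>2 \<le> (2*\<sigma>)\<^sup>2" using \<sigma> by (metis abs_le_square_iff abs_of_pos zero_less_mult_iff zero_less_numeral)
      then have "x\<^sup>2 / (2 * \<sigma>\<^sup>2) \<le> 2" using \<sigma> by (simp add: field_simps power2_eq_square)
      then show ?thesis unfolding normal_density_def using \<sigma>
        by (simp add: divide_right_mono mult.commute)
    qed
    have "ennreal (exp (-2) / sqrt (2 * pi)) = ennreal (exp (-2) / sqrt (2 * pi * \<sigma>\<^sup>2)) * ennreal \<sigma>"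
      using \<sigma> by (simp add: ennreal_mult[symmetric] real_sqrt_mult)
    also have "ennreal \<sigma> = emeasure lborel (J i)" using \<sigma> by (auto simp: J_def)
    also have "ennreal (exp (-2) / sqrt (2 * pi * \<sigma>\<^sup>2)) * emeasure lborel (J i) = (\<integral>\<^sup>+x. ennreal (exp (-2) / sqrt (2 * pi * \<sigma>\<^sup>2)) * indicator (J i) x \<partial>lborel)"
      by (simp add: nn_integral_cmult_indicator)
    also have "\<dots> \<le> (\<integral>\<^sup>+x. ennreal (normal_density 0 \<sigma> x) * indicator (J i) x \<partial>lborel)"
      by (rule nn_integral_mono) (auto simp: indicator_def intro!: ennreal_leI bd)
    finally show ?thesis .
  qed
  have "ennreal ((exp (-2) / sqrt (2 * pi)) ^ CARD('n)) = (\<Prod>i\<in>(UNIV::'n set). ennreal (exp (-2) / sqrt (2 * pi)))"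
    by (simp add: ennreal_power)
  also have "\<dots> \<le> (\<Prod>i\<in>(UNIV::'n set). \<integral>\<^sup>+x. ennreal (normal_density 0 \<sigma> x) * indicator (J i) x \<partial>lborel)"
    by (rule prod_mono_ennreal) (use one in auto)
  also have "\<dots> = (\<integral>\<^sup>+x. (\<Prod>i\<in>UNIV. ennreal (normal_density 0 \<sigma> (x $ i)) * indicator (J i) (x $ i)) \<partial>(lborel :: (real^'n) measure))"
    by (rule nn_integral_lborel_vec_prod[symmetric]) measurable
  also have "\<dots> = (\<integral>\<^sup>+x. ennreal (\<Prod>i\<in>UNIV. normal_density 0 \<sigma> (x $ i)) * indicator {x. \<forall>i. x $ i \<in> J i} x \<partial>lborel)"
  proof (rule nn_integral_cong)
    fix x :: "real^'n"
    have "(\<Prod>i\<in>UNIV. indicator (J i) (x $ i)) = (indicator {x. \<forall>i. x $ i \<in> J i} x :: ennreal)"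
    proof (cases "\<forall>i. x $ i \<in> J i")
      case False
      then obtain i where "x $ i \<notin> J i" by auto
      then have "(\<Prod>i\<in>UNIV. indicator (J i) (x $ i) :: ennreal) = 0" by (intro prod_zero bexI[of _ i]) auto
      then show ?thesis using False by simp
    qed simp
    then show "(\<Prod>i\<in>UNIV. ennreal (normal_density 0 \<sigma> (x $ i)) * indicator (J i) (x $ i)) =
        ennreal (\<Prod>i\<in>UNIV. normal_density 0 \<sigma> (x $ i)) * indicator {x. \<forall>i. x $ i \<in> J i} x"
      by (simp add: prod.distrib prod_ennreal)
  qed
  also have "\<dots> = emeasure M (X -` {x. \<forall>i. x $ i \<in> J i} \<inter> space M)"
    by (rule distributed_emeasure[OF D, symmetric]) measurable
  also have "\<dots> \<le> emeasure M {\<omega>\<in>space M. \<forall>i. sg i * X \<omega> $ i \<ge> \<sigma>}"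
  proof (rule emeasure_mono)
    have "sg i * X \<omega> $ i \<ge> \<sigma>" if "\<forall>i. X \<omega> $ i \<in> J i" for \<omega> i
      using that[rule_format, of i] sg[of i] by (auto simp: J_def)
    then show "X -` {x. \<forall>i. x $ i \<in> J i} \<inter> space M \<subseteq> {\<omega>\<in>space M. \<forall>i. sg i * X \<omega> $ i \<ge> \<sigma>}" by auto
  qed measurable
  finally show ?thesis .
qed

section \<open>Brownian increments and their independence of the past\<close>

locale brownian = prob_space M for M :: "'a measure" +
  fixes F :: "real \<Rightarrow> 'a measure" and W :: "real \<Rightarrow> 'a \<Rightarrow> real^3"
  assumes filtered: "filtered_prob_space M F" and bm: "brownian_motion M F W"
begin

lemma space_F[simp]: "space (F s) = space M"
  using filtered unfolding filtered_prob_space_def filtration_def by auto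

lemma sets_F_mono: "s \<le> t \<Longrightarrow> sets (F s) \<subseteq> sets (F t)"
  using filtered unfolding filtered_prob_space_def filtration_def by auto

lemma sets_F_M: "sets (F s) \<subseteq> sets M"
  using filtered unfolding filtered_prob_space_def subalgebra_def by auto

lemma measurable_F_mono: "f \<in> measurable (F s) N \<Longrightarrow> s \<le> t \<Longrightarrow> f \<in> measurable (F t) N"
  using sets_F_mono[of s t] by (auto simp: measurable_def)

lemma measurable_F_M: "f \<in> measurable (F s) N \<Longrightarrow> f \<in> measurable M N"
  using sets_F_M[of s] by (auto simp: measurable_def)

lemma W_adapted: "0 \<le> t \<Longrightarrow> t \<le> u \<Longrightarrow> W t \<in> borel_measurable (F u)"
  using bm measurable_F_mono unfolding brownian_motion_def continuous_adapted_def by blast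

lemma W_measurable: "0 \<le> t \<Longrightarrow> W t \<in> borel_measurable M"
  using W_adapted[of t t] measurable_F_M by blast

lemma increment_distributed: "0 \<le> s \<Longrightarrow> s < t \<Longrightarrow>
    distributed M lborel (\<lambda>\<omega>. W t \<omega> - W s \<omega>) (\<lambda>x. ennreal (\<Prod>i\<in>UNIV. normal_density 0 (sqrt (t - s)) (x $ i)))"
  using bm unfolding brownian_motion_def by blast

lemma increment_indep_set: "0 \<le> s \<Longrightarrow> s < t \<Longrightarrow>
    indep_set (sets (F s)) {(\<lambda>\<omega>. W t \<omega> - W s \<omega>) -` B \<inter> space M | B. B \<in> sets borel}"
  using bm unfolding brownian_motion_def by blast

text \<open>Independence is given for events, while expectations of products need it for random
  variables. Preimages under the composed map are again preimages under the increment, so both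
  generators lie in the given independent classes.\<close>

lemma increment_indep_var:
  assumes "0 \<le> s" "s < t" and f: "f \<in> borel_measurable (F s)" and g: "g \<in> borel_measurable borel"
  shows "indep_var borel f borel (\<lambda>\<omega>. g (W t \<omega> - W s \<omega>))"
proof -
  have [measurable]: "W t \<in> borel_measurable M" "W s \<in> borel_measurable M" using W_measurable assms by auto
  note g[measurable]
  have ind: "indep_set (sigma_sets (space M) {f -` A \<inter> space M |A. A \<in> sets borel})
     (sigma_sets (space M) {(\<lambda>\<omega>. g (W t \<omega> - W s \<omega>)) -` A \<inter> space M |A. A \<in> sets borel})"
  proof (rule indep_set_sigma_sets)
    have "indep_sets (case_bool (sets (F s)) {(\<lambda>\<omega>. W t \<omega> - W s \<omega>) -` B \<inter> space M | B. B \<in> sets borel}) UNIV"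
      using increment_indep_set[OF assms(1,2)] by (simp add: indep_set_def)
    then have "indep_sets (case_bool {f -` A \<inter> space M |A. A \<in> sets borel} {(\<lambda>\<omega>. g (W t \<omega> - W s \<omega>)) -` A \<inter> space M |A. A \<in> sets borel}) UNIV"
    proof (rule indep_sets_mono_sets)
      fix i :: bool
      show "case_bool {f -` A \<inter> space M |A. A \<in> sets borel} {(\<lambda>\<omega>. g (W t \<omega> - W s \<omega>)) -` A \<inter> space M |A. A \<in> sets borel} i
         \<subseteq> case_bool (sets (F s)) {(\<lambda>\<omega>. W t \<omega> - W s \<omega>) -` B \<inter> space M | B. B \<in> sets borel} i"
      proof (cases i)
        case True
        then show ?thesis using measurable_sets[OF f] by auto
      next
        case False
        have "\<exists>B. (\<lambda>\<omega>. g (W t \<omega> - W s \<omega>)) -` A \<inter> space M = (\<lambda>\<omega>. W t \<omega> - W s \<omega>) -` B \<inter> space M \<and> B \<in> sets borel"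
          if "A \<in> sets borel" for A
          using measurable_sets[OF g that] by (intro exI[of _ "g -` A"]) auto
        then show ?thesis using False by auto
      qed
    qed
    then show "indep_set {f -` A \<inter> space M |A. A \<in> sets borel} {(\<lambda>\<omega>. g (W t \<omega> - W s \<omega>)) -` A \<inter> space M |A. A \<in> sets borel}"
      by (simp add: indep_set_def)
    show "Int_stable {f -` A \<inter> space M |A. A \<in> sets borel}"
      by (rule Int_stableI) (auto intro: exI[of _ "_ \<inter> _"])
    show "Int_stable {(\<lambda>\<omega>. g (W t \<omega> - W s \<omega>)) -` A \<inter> space M |A. A \<in> sets borel}"
      by (rule Int_stableI) (auto intro: exI[of _ "_ \<inter> _"])
  qed
  show ?thesis unfolding indep_var_eq using ind measurable_F_M[OF f] by auto
qed

lemma increment_component: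
  assumes "0 \<le> s" "s < t"
  shows "expectation (\<lambda>\<omega>. (W t \<omega> - W s \<omega>) $ k) = 0"
    and "integrable M (\<lambda>\<omega>. (W t \<omega> - W s \<omega>) $ k)"
    and "expectation (\<lambda>\<omega>. ((W t \<omega> - W s \<omega>) $ k)\<^sup>2) = t - s"
    and "integrable M (\<lambda>\<omega>. ((W t \<omega> - W s \<omega>) $ k)\<^sup>2)"
proof -
  have \<sigma>: "sqrt (t - s) > 0" using assms by simp
  note D = normal_prod_component[OF increment_distributed[OF assms] \<sigma>, of k]
  show E: "expectation (\<lambda>\<omega>. (W t \<omega> - W s \<omega>) $ k) = 0"
    by (rule normal_distributed_expectation[OF \<sigma> D])
  show "expectation (\<lambda>\<omega>. ((W t \<omega> - W s \<omega>) $ k)\<^sup>2) = t - s"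
    using normal_distributed_variance[OF \<sigma> D] assms unfolding E by simp
  show "integrable M (\<lambda>\<omega>. (W t \<omega> - W s \<omega>) $ k)"
    using integrable_normal_moment[OF \<sigma>, of 0 1]
    by (subst distributed_integrable[OF D, symmetric, of "\<lambda>x. x"]) (auto simp: mult.commute)
  show "integrable M (\<lambda>\<omega>. ((W t \<omega> - W s \<omega>) $ k)\<^sup>2)"
    using integrable_normal_moment[OF \<sigma>, of 0 2]
    by (subst distributed_integrable[OF D, symmetric, of "\<lambda>x. x^2"]) (auto simp: mult.commute)
qed

lemma increment_norm_sq:
  assumes "0 \<le> s" "s < t"
  shows "integrable M (\<lambda>\<omega>. (norm (W t \<omega> - W s \<omega>))\<^sup>2)"
    and "expectation (\<lambda>\<omega>. (norm (W t \<omega> - W s \<omega>))\<^sup>2) = 3 * (t - s)"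
proof -
  have eq: "(norm x)\<^sup>2 = (\<Sum>k\<in>UNIV. (x $ k)\<^sup>2)" for x :: "real^3"
    by (simp add: norm_vec_def L2_set_def sum_nonneg)
  show "integrable M (\<lambda>\<omega>. (norm (W t \<omega> - W s \<omega>))\<^sup>2)"
    unfolding eq using increment_component(4)[OF assms] by (intro Bochner_Integration.integrable_sum)
  show "expectation (\<lambda>\<omega>. (norm (W t \<omega> - W s \<omega>))\<^sup>2) = 3 * (t - s)"
    unfolding eq using increment_component(3,4)[OF assms]
    by (subst Bochner_Integration.integral_sum) auto
qed

end

section \<open>Lenglart's inequality for elementary integrals\<close>

lemma norm_matrix_vector_mult_le:
  fixes A :: "real^'n^'m"
  shows "norm (A *v x) \<le> norm A * norm x"
proof -
  have "(norm (A *v x))\<^sup>2 = (\<Sum>i\<in>UNIV. (A $ i \<bullet> x)\<^sup>2)"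
    by (simp add: norm_vec_def L2_set_def sum_nonneg matrix_vector_mult_def inner_vec_def)
  also have "\<dots> \<le> (\<Sum>i\<in>UNIV. (norm (A $ i))\<^sup>2 * (norm x)\<^sup>2)"
    by (intro sum_mono) (metis Cauchy_Schwarz_ineq power2_norm_eq_inner)
  also have "\<dots> = (norm A * norm x)\<^sup>2"
    by (simp add: norm_vec_def[of A] L2_set_def sum_nonneg power_mult_distrib sum_distrib_right)
  finally show ?thesis by (rule power2_le_imp_le) simp
qed

lemma bounded_bilinear_matrix_vector_mult:
  "bounded_bilinear ((*v) :: real^'n^'m \<Rightarrow> real^'n \<Rightarrow> real^'m)"
proof (rule bounded_bilinear.intro)
  show "\<exists>K. \<forall>a b. norm ((a :: real^'n^'m) *v b) \<le> norm a * norm b * K"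
    by (rule exI[of _ 1]) (simp add: norm_matrix_vector_mult_le)
qed (simp_all add: matrix_vector_mult_add_rdistrib matrix_vector_right_distrib scaleR_matrix_vector_assoc matrix_vector_mult_scaleR)

lemma borel_measurable_matrix_vector_mult[measurable (raw)]:
  fixes A :: "'a \<Rightarrow> real^'n^'m"
  assumes "A \<in> borel_measurable M" "x \<in> borel_measurable M"
  shows "(\<lambda>\<omega>. A \<omega> *v x \<omega>) \<in> borel_measurable M"
  by (rule borel_measurable_continuous_Pair[OF assms])
    (intro bounded_bilinear.continuous_on[OF bounded_bilinear_matrix_vector_mult] continuous_intros)

text \<open>Separates the factors known at the left end of a cell from the coordinates of the
  increment, so that the cross term of a second moment becomes a sum of products of independent
  variables.\<close>

lemma inner_matrix_vector_mult_expand: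
  fixes x d :: "real^'n"
  shows "x \<bullet> (A *v d) = (\<Sum>k\<in>UNIV. (x \<bullet> (A *v axis k 1)) * d $ k)"
proof -
  have "x \<bullet> (A *v d) = x \<bullet> (A *v (\<Sum>k\<in>UNIV. d $ k *s axis k 1))"
    by (simp add: basis_expansion)
  also have "\<dots> = (\<Sum>k\<in>UNIV. (x \<bullet> (A *v axis k 1)) * d $ k)"
    by (simp add: linear_sum[OF matrix_vector_mul_linear] inner_sum_right scalar_mult_eq_scaleR matrix_vector_mult_scaleR mult.commute)
  finally show ?thesis .
qed

context brownian begin

definition grid_ito :: "(nat \<Rightarrow> real) \<Rightarrow> (nat \<Rightarrow> 'a \<Rightarrow> real^3^3) \<Rightarrow> nat \<Rightarrow> 'a \<Rightarrow> real^3" where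
  "grid_ito g \<Xi> k \<omega> = (\<Sum>i<k. \<Xi> i \<omega> *v (W (g (Suc i)) \<omega> - W (g i) \<omega>))"

lemma expectation_indep_increment:
  assumes st: "0 \<le> s" "s < t" and f: "f \<in> borel_measurable (F s)" and int: "integrable M f"
  shows "integrable M (\<lambda>\<omega>. f \<omega> * (W t \<omega> - W s \<omega>) $ k)"
    and "expectation (\<lambda>\<omega>. f \<omega> * (W t \<omega> - W s \<omega>) $ k) = 0"
    and "integrable M (\<lambda>\<omega>. f \<omega> * (norm (W t \<omega> - W s \<omega>))\<^sup>2)"
    and "expectation (\<lambda>\<omega>. f \<omega> * (norm (W t \<omega> - W s \<omega>))\<^sup>2) = 3 * (t - s) * expectation f"
proof -
  have i1: "indep_var borel f borel (\<lambda>\<omega>. (W t \<omega> - W s \<omega>) $ k)"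
    by (rule increment_indep_var[OF st f, of "\<lambda>x. x $ k"]) measurable
  have i2: "indep_var borel f borel (\<lambda>\<omega>. (norm (W t \<omega> - W s \<omega>))\<^sup>2)"
    by (rule increment_indep_var[OF st f, of "\<lambda>x. (norm x)\<^sup>2"]) measurable
  note inc = increment_component(1,2)[OF st, of k]  increment_norm_sq[OF st]
  show "integrable M (\<lambda>\<omega>. f \<omega> * (W t \<omega> - W s \<omega>) $ k)"
    by (rule indep_var_integrable[OF i1 int inc(2)])
  show "expectation (\<lambda>\<omega>. f \<omega> * (W t \<omega> - W s \<omega>) $ k) = 0"
    using indep_var_lebesgue_integral[OF i1 int inc(2)] inc(1) by simp
  show "integrable M (\<lambda>\<omega>. f \<omega> * (norm (W t \<omega> - W s \<omega>))\<^sup>2)"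
    by (rule indep_var_integrable[OF i2 int inc(3)])
  show "expectation (\<lambda>\<omega>. f \<omega> * (norm (W t \<omega> - W s \<omega>))\<^sup>2) = 3 * (t - s) * expectation f"
    using indep_var_lebesgue_integral[OF i2 int inc(3)] inc(4) by (simp add: mult.commute)
qed

text \<open>A one-sided Ito isometry. Cross terms vanish since the increment is centred and
  independent of the past. The square of a new term is bounded by the product of the squared norms
  of matrix and increment, whose expectation factors; the 3 is the dimension, as
  \<open>(norm (W t - W s))\<^sup>2\<close> has mean \<open>3 * (t - s)\<close>.\<close>

lemma grid_ito_L2:
  assumes g: "0 \<le> g 0" "\<And>i. i < n \<Longrightarrow> g i < g (Suc i)"
    and \<Xi>: "\<And>i. i < n \<Longrightarrow> \<Xi> i \<in> borel_measurable (F (g i))"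
    and C: "\<And>i \<omega>. i < n \<Longrightarrow> \<omega> \<in> space M \<Longrightarrow> norm (\<Xi> i \<omega>) \<le> C"
    and k: "k \<le> n"
  shows "g k \<ge> 0 \<and> grid_ito g \<Xi> k \<in> borel_measurable (F (g k)) \<and> integrable M (\<lambda>\<omega>. (norm (grid_ito g \<Xi> k \<omega>))\<^sup>2) \<and>
    expectation (\<lambda>\<omega>. (norm (grid_ito g \<Xi> k \<omega>))\<^sup>2) \<le> expectation (\<lambda>\<omega>. 3 * (\<Sum>i<k. (g (Suc i) - g i) * (norm (\<Xi> i \<omega>))\<^sup>2))"
  using k
proof (induction k)
  case 0
  then show ?case using g by (simp add: grid_ito_def[abs_def])
next
  case (Suc k)
  let ?S = "grid_ito g \<Xi> k" and ?X = "\<Xi> k" and ?D = "\<lambda>\<omega>. W (g (Suc k)) \<omega> - W (g k) \<omega>"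
  have IH: "g k \<ge> 0" "?S \<in> borel_measurable (F (g k))" "integrable M (\<lambda>\<omega>. (norm (?S \<omega>))\<^sup>2)"
    "expectation (\<lambda>\<omega>. (norm (?S \<omega>))\<^sup>2) \<le> expectation (\<lambda>\<omega>. 3 * (\<Sum>i<k. (g (Suc i) - g i) * (norm (\<Xi> i \<omega>))\<^sup>2))"
    using Suc by auto
  have gk: "g k < g (Suc k)" using g Suc by auto
  have [measurable]: "?S \<in> borel_measurable (F (g k))" "?X \<in> borel_measurable (F (g k))"
    using IH \<Xi>[of k] Suc by auto
  have SX[measurable]: "?S \<in> borel_measurable M" "?X \<in> borel_measurable M"
     "?S \<in> borel_measurable (F (g (Suc k)))" "?X \<in> borel_measurable (F (g (Suc k)))"
     "W (g (Suc k)) \<in> borel_measurable (F (g (Suc k)))" "W (g k) \<in> borel_measurable (F (g (Suc k)))"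
     "W (g (Suc k)) \<in> borel_measurable M" "W (g k) \<in> borel_measurable M"
    using measurable_F_M[OF IH(2)] measurable_F_M[OF \<Xi>[of k]] measurable_F_mono[OF IH(2), of "g (Suc k)"]
      measurable_F_mono[OF \<Xi>[of k], of "g (Suc k)"] IH(1) Suc(2) gk by (auto intro: W_adapted W_measurable)
  have C0: "C \<ge> 0" using C[of k] Suc not_empty norm_ge_zero by (metis ex_in_conv less_eq_Suc_le order_trans)
  have Sk: "grid_ito g \<Xi> (Suc k) \<omega> = ?S \<omega> + ?X \<omega> *v ?D \<omega>" for \<omega>
    by (simp add: grid_ito_def)
  have meas: "grid_ito g \<Xi> (Suc k) \<in> borel_measurable (F (g (Suc k)))"
    unfolding Sk[abs_def] by measurable
  define u where "u l \<omega> = ?S \<omega> \<bullet> (?X \<omega> *v axis l 1)" for l \<omega>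
  have u[measurable]: "u l \<in> borel_measurable (F (g k))" for l unfolding u_def by measurable
  then have [measurable]: "u l \<in> borel_measurable M" for l using measurable_F_M by blast
  \<comment> \<open>The matrix is bounded, and \<open>norm (?S \<omega>)\<close> is at most
    \<open>1 + (norm (?S \<omega>))\<^sup>2\<close>, which is integrable by the induction
    hypothesis.\<close>
  have uint: "integrable M (u l)" for l
  proof (rule Bochner_Integration.integrable_bound)
    show "integrable M (\<lambda>\<omega>. C * (1 + (norm (?S \<omega>))\<^sup>2))" using IH by auto
    have "norm (u l \<omega>) \<le> norm (C * (1 + (norm (?S \<omega>))\<^sup>2))" if "\<omega> \<in> space M" for \<omega>
    proof -
      have "2 * norm (?S \<omega>) \<le> 1 + (norm (?S \<omega>))\<^sup>2"
        using sum_squares_bound[of 1 "norm (?S \<omega>)"] by simp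
      then have le1: "norm (?S \<omega>) \<le> 1 + (norm (?S \<omega>))\<^sup>2"
        using norm_ge_zero[of "?S \<omega>"] by linarith
      have "norm (u l \<omega>) \<le> norm (?S \<omega>) * norm (?X \<omega> *v axis l 1)"
        unfolding u_def by (simp add: Cauchy_Schwarz_ineq2)
      also have "\<dots> \<le> norm (?S \<omega>) * (norm (?X \<omega>) * norm (axis l (1::real) :: real^3))"
        by (intro mult_left_mono norm_matrix_vector_mult_le) auto
      also have "\<dots> \<le> norm (?S \<omega>) * C"
        using C[OF _ that, of k] Suc by (intro mult_left_mono) auto
      also have "\<dots> \<le> (1 + (norm (?S \<omega>))\<^sup>2) * C"
        using C0 le1 by (rule mult_right_mono[rotated])
      finally show ?thesis using C0 by (simp add: mult.commute)
    qed
    then show "AE \<omega> in M. norm (u l \<omega>) \<le> norm (C * (1 + (norm (?S \<omega>))\<^sup>2))" by auto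
  qed measurable
  have Xint: "integrable M (\<lambda>\<omega>. (norm (\<Xi> i \<omega>))\<^sup>2)" if "i \<le> k" for i
  proof (rule integrable_const_bound[of _ "C\<^sup>2"])
    show "AE \<omega> in M. norm ((norm (\<Xi> i \<omega>))\<^sup>2) \<le> C\<^sup>2"
      using C[of i] that Suc by (auto intro!: power_mono)
    have "\<Xi> i \<in> borel_measurable M" using measurable_F_M[OF \<Xi>[of i]] that Suc by simp
    then show "(\<lambda>\<omega>. (norm (\<Xi> i \<omega>))\<^sup>2) \<in> borel_measurable M" by measurable
  qed
  have ud: "?S \<omega> \<bullet> (?X \<omega> *v ?D \<omega>) = (\<Sum>l\<in>UNIV. u l \<omega> * (?D \<omega> $ l))" for \<omega>
    unfolding u_def by (rule inner_matrix_vector_mult_expand)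
  note inc = expectation_indep_increment[OF IH(1) gk]
  have cross: "integrable M (\<lambda>\<omega>. ?S \<omega> \<bullet> (?X \<omega> *v ?D \<omega>))" "expectation (\<lambda>\<omega>. ?S \<omega> \<bullet> (?X \<omega> *v ?D \<omega>)) = 0"
    unfolding ud using inc(1)[OF u uint] inc(2)[OF u uint]
    by (auto simp: Bochner_Integration.integral_sum)
  have XF: "(\<lambda>\<omega>. (norm (?X \<omega>))\<^sup>2) \<in> borel_measurable (F (g k))" by measurable
  note sq = inc(3,4)[OF XF Xint[OF order_refl]]
  have le: "(norm (?X \<omega> *v ?D \<omega>))\<^sup>2 \<le> (norm (?X \<omega>))\<^sup>2 * (norm (?D \<omega>))\<^sup>2" for \<omega>
    by (metis norm_ge_zero norm_matrix_vector_mult_le power_mono power_mult_distrib)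
  have dint: "integrable M (\<lambda>\<omega>. (norm (?X \<omega> *v ?D \<omega>))\<^sup>2)"
    by (rule Bochner_Integration.integrable_bound[OF sq(1)]) (use le in auto)
  have split: "(norm (grid_ito g \<Xi> (Suc k) \<omega>))\<^sup>2 = (norm (?S \<omega>))\<^sup>2 + 2 * (?S \<omega> \<bullet> (?X \<omega> *v ?D \<omega>)) + (norm (?X \<omega> *v ?D \<omega>))\<^sup>2" for \<omega>
    unfolding Sk by (simp add: power2_norm_eq_inner inner_add inner_commute)
  have int: "integrable M (\<lambda>\<omega>. (norm (grid_ito g \<Xi> (Suc k) \<omega>))\<^sup>2)"
    unfolding split using IH cross dint by auto
  have "expectation (\<lambda>\<omega>. (norm (grid_ito g \<Xi> (Suc k) \<omega>))\<^sup>2) =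
    expectation (\<lambda>\<omega>. (norm (?S \<omega>))\<^sup>2) + expectation (\<lambda>\<omega>. (norm (?X \<omega> *v ?D \<omega>))\<^sup>2)"
    unfolding split using IH cross dint by simp
  also have "expectation (\<lambda>\<omega>. (norm (?X \<omega> *v ?D \<omega>))\<^sup>2) \<le> expectation (\<lambda>\<omega>. (norm (?X \<omega>))\<^sup>2 * (norm (?D \<omega>))\<^sup>2)"
    by (rule integral_mono[OF dint sq(1) le])
  also note sq(2)
  also note IH(4)
  also have "expectation (\<lambda>\<omega>. 3 * (\<Sum>i<k. (g (Suc i) - g i) * (norm (\<Xi> i \<omega>))\<^sup>2)) + 3 * (g (Suc k) - g k) * expectation (\<lambda>x. (norm (\<Xi> k x))\<^sup>2)
    = expectation (\<lambda>\<omega>. 3 * (\<Sum>i<Suc k. (g (Suc i) - g i) * (norm (\<Xi> i \<omega>))\<^sup>2))"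
  proof -
    have "integrable M (\<lambda>\<omega>. \<Sum>i<k. (g (Suc i) - g i) * (norm (\<Xi> i \<omega>))\<^sup>2)"
      using Xint by (intro Bochner_Integration.integrable_sum integrable_mult_right) auto
    then have "expectation (\<lambda>\<omega>. 3 * (\<Sum>i<Suc k. (g (Suc i) - g i) * (norm (\<Xi> i \<omega>))\<^sup>2)) =
      3 * (expectation (\<lambda>\<omega>. \<Sum>i<k. (g (Suc i) - g i) * (norm (\<Xi> i \<omega>))\<^sup>2) + (g (Suc k) - g k) * expectation (\<lambda>x. (norm (\<Xi> k x))\<^sup>2))"
      using Xint[of k] by simp
    moreover have "3 * a + 3 * c * b = 3 * (a + c * b)" for a b c :: real by algebra
    ultimately show ?thesis by simp
  qed
  finally show ?case using meas int gk IH(1) by auto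
qed

text \<open>The integrand is stopped before its accumulated squared norm exceeds \<open>\<delta>\<close>; the value on a cell is
  known at its left end, so the stopped integrand is still adapted.\<close>

lemma grid_ito_lenglart:
  assumes g: "0 \<le> g 0" "\<And>i. i < n \<Longrightarrow> g i < g (Suc i)"
    and \<Xi>: "\<And>i. i < n \<Longrightarrow> \<Xi> i \<in> borel_measurable (F (g i))"
    and C: "\<And>i \<omega>. i < n \<Longrightarrow> \<omega> \<in> space M \<Longrightarrow> norm (\<Xi> i \<omega>) \<le> C"
    and A: "A \<in> sets M" "\<And>i \<omega>. i < n \<Longrightarrow> \<omega> \<in> space M - A \<Longrightarrow> \<Xi> i \<omega> = 0"
    and N: "N \<in> sets M" "\<And>\<omega>. \<omega> \<in> space M - N \<Longrightarrow> (\<Sum>i<n. (g (Suc i) - g i) * (norm (\<Xi> i \<omega>))\<^sup>2) \<le> \<delta>"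
    and \<delta>: "0 \<le> \<delta>" and \<epsilon>: "0 < \<epsilon>"
  shows "measure M {\<omega>\<in>space M. \<epsilon> < norm (grid_ito g \<Xi> n \<omega>)} \<le> 3 * \<delta> * measure M A / \<epsilon>\<^sup>2 + measure M N"
proof -
  define V where "V k \<omega> = (\<Sum>i<k. (g (Suc i) - g i) * (norm (\<Xi> i \<omega>))\<^sup>2)" for k \<omega>
  define \<Xi>' where "\<Xi>' i \<omega> = (if V (Suc i) \<omega> \<le> \<delta> then \<Xi> i \<omega> else 0)" for i \<omega>
  have gmono: "g i \<le> g j" if "i \<le> j" "j \<le> n" for i j
    using that
  proof (induction j rule: dec_induct)
    case (step k)
    then show ?case using g(2)[of k] by simp
  qed simp
  have V[measurable]: "V (Suc i) \<in> borel_measurable (F (g i))" if "i < n" for i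
  proof -
    have "(\<lambda>\<omega>. (g (Suc j) - g j) * (norm (\<Xi> j \<omega>))\<^sup>2) \<in> borel_measurable (F (g i))" if "j < Suc i" for j
    proof -
      have [measurable]: "\<Xi> j \<in> borel_measurable (F (g i))"
        using \<Xi>[of j] gmono[of j i] that \<open>i < n\<close> by (auto intro: measurable_F_mono)
      show ?thesis by measurable
    qed
    then show ?thesis unfolding V_def by (intro borel_measurable_sum) auto
  qed
  have \<Xi>'m: "\<Xi>' i \<in> borel_measurable (F (g i))" if "i < n" for i
    using V[OF that] \<Xi>[OF that] unfolding \<Xi>'_def by measurable
  have C': "norm (\<Xi>' i \<omega>) \<le> C" if "i < n" "\<omega> \<in> space M" for i \<omega>
    using C[OF that] norm_ge_zero[of "\<Xi> i \<omega>"] by (auto simp: \<Xi>'_def intro: order_trans[of _ "norm (\<Xi> i \<omega>)"])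
  note L2 = grid_ito_L2[where n=n and k=n and g=g, OF g \<Xi>'m C' order_refl, simplified]
  have Vmono: "V i \<omega> \<le> V j \<omega>" if "i \<le> j" "j \<le> n" for i j \<omega>
    unfolding V_def using g(2) that by (intro sum_mono2) (auto simp: less_imp_le)
  have "(\<Sum>i<k. (g (Suc i) - g i) * (norm (\<Xi>' i \<omega>))\<^sup>2) \<le> \<delta>" if "k \<le> n" for k \<omega>
    using that
  proof (induction k)
    case (Suc k)
    show ?case
    proof (cases "V (Suc k) \<omega> \<le> \<delta>")
      case True
      have "(\<Sum>i<Suc k. (g (Suc i) - g i) * (norm (\<Xi>' i \<omega>))\<^sup>2) \<le> V (Suc k) \<omega>"
        unfolding V_def using g(2) Suc by (intro sum_mono mult_left_mono) (auto simp: \<Xi>'_def less_imp_le)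
      then show ?thesis using True by simp
    next
      case False
      then have "\<Xi>' k \<omega> = 0" by (simp add: \<Xi>'_def)
      then show ?thesis using Suc by simp
    qed
  qed (use \<delta> in simp)
  \<comment> \<open>Off \<open>A\<close> all terms vanish, so the bound may carry the indicator of
    \<open>A\<close>. Its expectation is the origin of the factor \<open>measure M A\<close> in all
    later estimates.\<close>
  then have V': "(\<Sum>i<n. (g (Suc i) - g i) * (norm (\<Xi>' i \<omega>))\<^sup>2) \<le> \<delta> * indicator A \<omega>" if "\<omega> \<in> space M" for \<omega>
    using A(2)[of _ \<omega>] that by (cases "\<omega> \<in> A") (auto simp: \<Xi>'_def intro!: sum_nonpos)
  let ?S = "grid_ito g \<Xi> n" and ?S' = "grid_ito g \<Xi>' n"
  have [measurable]: "?S' \<in> borel_measurable M" using L2 measurable_F_M[of ?S' "g n"] by blast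
  have E: "expectation (\<lambda>\<omega>. (norm (?S' \<omega>))\<^sup>2) \<le> 3 * \<delta> * measure M A"
  proof -
    have [measurable]: "\<Xi>' i \<in> borel_measurable M" if "i < n" for i by (rule measurable_F_M[OF \<Xi>'m[OF that]])
    have int: "integrable M (\<lambda>\<omega>. 3 * (\<delta> * indicator A \<omega>))"
      using A(1) by (intro integrable_mult_right) (auto simp: emeasure_eq_measure)
    have nn: "0 \<le> (\<Sum>i<n. (g (Suc i) - g i) * (norm (\<Xi>' i \<omega>))\<^sup>2)" for \<omega>
      using g(2) by (intro sum_nonneg mult_nonneg_nonneg) (auto simp: less_imp_le)
    have m: "(\<lambda>\<omega>. 3 * (\<Sum>i<n. (g (Suc i) - g i) * (norm (\<Xi>' i \<omega>))\<^sup>2)) \<in> borel_measurable M"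
      by (intro borel_measurable_times borel_measurable_const borel_measurable_sum) auto
    have "expectation (\<lambda>\<omega>. 3 * (\<Sum>i<n. (g (Suc i) - g i) * (norm (\<Xi>' i \<omega>))\<^sup>2)) \<le> expectation (\<lambda>\<omega>. 3 * (\<delta> * indicator A \<omega>))"
    proof (rule integral_mono_AE)
      show "integrable M (\<lambda>\<omega>. 3 * (\<Sum>i<n. (g (Suc i) - g i) * (norm (\<Xi>' i \<omega>))\<^sup>2))"
      proof (rule Bochner_Integration.integrable_bound[OF int m], rule AE_I2)
        fix \<omega> assume "\<omega> \<in> space M"
        then show "norm (3 * (\<Sum>i<n. (g (Suc i) - g i) * (norm (\<Xi>' i \<omega>))\<^sup>2)) \<le> norm (3 * (\<delta> * indicator A \<omega>))"
          using V'[of \<omega>] nn[of \<omega>] \<delta> by (simp add: abs_mult)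
      qed
    qed (use int V' in auto)
    also have "\<dots> = 3 * \<delta> * measure M A" using A(1) by simp
    finally show ?thesis using L2 by simp
  qed
  \<comment> \<open>Off \<open>N\<close> the threshold is never passed, so stopping changes nothing
    there; the stopped sum is left to Markov's inequality.\<close>
  have "{\<omega>\<in>space M. \<epsilon> < norm (?S \<omega>)} \<subseteq> {\<omega>\<in>space M. \<epsilon>\<^sup>2 \<le> (norm (?S' \<omega>))\<^sup>2} \<union> N"
  proof safe
    fix \<omega> assume \<omega>: "\<omega> \<in> space M" "\<epsilon> < norm (?S \<omega>)" "\<omega> \<notin> N"
    then have "V (Suc i) \<omega> \<le> \<delta>" if "i < n" for i
      using order_trans[OF Vmono[of "Suc i" n \<omega>], of \<delta>] N(2)[of \<omega>, folded V_def] \<omega> that by simp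
    then have "?S \<omega> = ?S' \<omega>" unfolding grid_ito_def by (intro sum.cong) (auto simp: \<Xi>'_def)
    then show "\<epsilon>\<^sup>2 \<le> (norm (?S' \<omega>))\<^sup>2" using \<omega> \<epsilon> by (intro power_mono) auto
  qed
  then have "measure M {\<omega>\<in>space M. \<epsilon> < norm (?S \<omega>)} \<le> measure M ({\<omega>\<in>space M. \<epsilon>\<^sup>2 \<le> (norm (?S' \<omega>))\<^sup>2} \<union> N)"
    using N(1) by (intro finite_measure_mono) auto
  also have "\<dots> \<le> measure M {\<omega>\<in>space M. \<epsilon>\<^sup>2 \<le> (norm (?S' \<omega>))\<^sup>2} + measure M N"
    using N(1) by (intro measure_Un_le) auto
  also have "measure M {\<omega>\<in>space M. \<epsilon>\<^sup>2 \<le> (norm (?S' \<omega>))\<^sup>2} \<le> expectation (\<lambda>\<omega>. (norm (?S' \<omega>))\<^sup>2) / \<epsilon>\<^sup>2"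
    using L2 \<epsilon> by (intro integral_Markov_inequality_measure[where A="{}"]) auto
  also have "\<dots> \<le> 3 * \<delta> * measure M A / \<epsilon>\<^sup>2" using E \<epsilon> by (intro divide_right_mono) auto
  finally show ?thesis by simp
qed

end

text \<open>Cells are left-open like the intervals of simple integrands, so the value on a cell is
  read at its right end. Only one direction holds: nothing is known of \<open>E\<close> outside the
  cells.\<close>

lemma sq_integral_cells_le:
  fixes E :: "real \<Rightarrow> 'b::real_normed_vector"
  assumes g: "\<And>i. i < n \<Longrightarrow> g i < g (Suc i)"
    and E: "\<And>i s. i < n \<Longrightarrow> g i < s \<Longrightarrow> s \<le> g (Suc i) \<Longrightarrow> E s = E (g (Suc i))"
  shows "ennreal (\<Sum>i<n. (g (Suc i) - g i) * (norm (E (g (Suc i))))\<^sup>2) \<le> (\<integral>\<^sup>+s. ennreal ((norm (E s))\<^sup>2) \<partial>lborel)"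
proof -
  have gmono: "g i \<le> g j" if "i \<le> j" "j \<le> n" for i j
    using that
  proof (induction j rule: dec_induct)
    case (step k)
    then show ?case using g[of k] by simp
  qed simp
  have "ennreal (\<Sum>i<n. (g (Suc i) - g i) * (norm (E (g (Suc i))))\<^sup>2)
      = (\<Sum>i<n. ennreal ((norm (E (g (Suc i))))\<^sup>2) * emeasure lborel {g i<..g (Suc i)})"
    using g by (subst sum_ennreal[symmetric]) (auto simp: ennreal_mult[symmetric] less_imp_le mult.commute intro!: sum.cong)
  also have "\<dots> = (\<integral>\<^sup>+s. (\<Sum>i<n. ennreal ((norm (E (g (Suc i))))\<^sup>2) * indicator {g i<..g (Suc i)} s) \<partial>lborel)"
    by (subst nn_integral_sum) (auto simp: nn_integral_cmult_indicator)
  also have "\<dots> \<le> (\<integral>\<^sup>+s. ennreal ((norm (E s))\<^sup>2) \<partial>lborel)"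
  proof (rule nn_integral_mono)
    fix s :: real
    show "(\<Sum>i<n. ennreal ((norm (E (g (Suc i))))\<^sup>2) * indicator {g i<..g (Suc i)} s) \<le> ennreal ((norm (E s))\<^sup>2)"
    proof (cases "\<exists>j<n. s \<in> {g j<..g (Suc j)}")
      case True
      then obtain j where j: "j < n" "s \<in> {g j<..g (Suc j)}" by auto
      have "s \<notin> {g i<..g (Suc i)}" if "i < n" "i \<noteq> j" for i
        using j that gmono[of "Suc i" j] gmono[of "Suc j" i] by (cases "i < j") auto
      then have "(\<Sum>i<n. ennreal ((norm (E (g (Suc i))))\<^sup>2) * indicator {g i<..g (Suc i)} s)
         = (\<Sum>i<n. if i = j then ennreal ((norm (E (g (Suc j))))\<^sup>2) else 0)"
        using j by (intro sum.cong) (auto simp: indicator_def)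
      also have "\<dots> = ennreal ((norm (E s))\<^sup>2)" using j E[of j s] by (simp add: sum.delta)
      finally show ?thesis by simp
    next
      case False
      then have "(\<Sum>i<n. ennreal ((norm (E (g (Suc i))))\<^sup>2) * indicator {g i<..g (Suc i)} s) = (\<Sum>i<n. 0)"
        by (intro sum.cong) (auto simp: indicator_def)
      then show ?thesis by simp
    qed
  qed
  finally show ?thesis .
qed

section \<open>Algebra of elementary integrands and their representation on grids\<close>

context brownian begin

text \<open>Sums of terms \<open>\<xi> 1_(a,b]\<close> with overlaps allowed, so that sums and restrictions stay in the class.\<close>

inductive elem :: "(real \<Rightarrow> 'a \<Rightarrow> real^3^3) \<Rightarrow> ('a \<Rightarrow> real^3) \<Rightarrow> bool" where
  elem_zero: "elem (\<lambda>s \<omega>. 0) (\<lambda>\<omega>. 0)"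
| elem_add_term: "elem E Y \<Longrightarrow> 0 \<le> a \<Longrightarrow> a \<le> b \<Longrightarrow> \<xi> \<in> borel_measurable (F a) \<Longrightarrow>
     (\<And>\<omega>. \<omega> \<in> space M \<Longrightarrow> norm (\<xi> \<omega>) \<le> C) \<Longrightarrow>
     elem (\<lambda>s \<omega>. E s \<omega> + indicator {a<..b} s *\<^sub>R \<xi> \<omega>) (\<lambda>\<omega>. Y \<omega> + \<xi> \<omega> *v (W b \<omega> - W a \<omega>))"

lemma elem_cong:
  assumes "elem E Y" "\<And>s \<omega>. E' s \<omega> = E s \<omega>" "\<And>\<omega>. Y' \<omega> = Y \<omega>"
  shows "elem E' Y'"
proof -
  have "E' = E" "Y' = Y" using assms(2,3) by (intro ext; simp)+
  then show ?thesis using assms(1) by simp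
qed

lemma elem_term:
  assumes "0 \<le> a" "a \<le> b" "\<xi> \<in> borel_measurable (F a)" "\<And>\<omega>. \<omega> \<in> space M \<Longrightarrow> norm (\<xi> \<omega>) \<le> C"
  shows "elem (\<lambda>s \<omega>. indicator {a<..b} s *\<^sub>R \<xi> \<omega>) (\<lambda>\<omega>. \<xi> \<omega> *v (W b \<omega> - W a \<omega>))"
  using elem_add_term[OF elem_zero assms] by simp

lemma elem_add:
  assumes "elem E Y" "elem E' Y'"
  shows "elem (\<lambda>s \<omega>. E s \<omega> + E' s \<omega>) (\<lambda>\<omega>. Y \<omega> + Y' \<omega>)"
  using assms(2)
proof (induction rule: elem.induct)
  case elem_zero
  then show ?case using assms(1) by simp
next
  case (elem_add_term E' Y' a b \<xi> C)
  from elem.elem_add_term[OF this(6,2-5)] show ?case by (rule elem_cong) (auto simp: add.assoc)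
qed

lemma elem_uminus: "elem E Y \<Longrightarrow> elem (\<lambda>s \<omega>. - E s \<omega>) (\<lambda>\<omega>. - Y \<omega>)"
proof (induction rule: elem.induct)
  case elem_zero
  then show ?case using elem.elem_zero by simp
next
  case (elem_add_term E Y a b \<xi> C)
  have "elem (\<lambda>s \<omega>. - E s \<omega> + indicator {a<..b} s *\<^sub>R (- \<xi> \<omega>)) (\<lambda>\<omega>. - Y \<omega> + (- \<xi> \<omega>) *v (W b \<omega> - W a \<omega>))"
    by (rule elem.elem_add_term[where C=C]) (use elem_add_term in auto)
  then show ?case
    by (rule elem_cong) (auto simp: bounded_bilinear.minus_left[OF bounded_bilinear_matrix_vector_mult])
qed

lemma elem_diff: "elem E Y \<Longrightarrow> elem E' Y' \<Longrightarrow> elem (\<lambda>s \<omega>. E s \<omega> - E' s \<omega>) (\<lambda>\<omega>. Y \<omega> - Y' \<omega>)"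
  using elem_add[OF _ elem_uminus, of E Y E' Y'] by simp

lemma elem_sum:
  fixes n :: nat
  shows "(\<And>i. i < n \<Longrightarrow> elem (E i) (Y i)) \<Longrightarrow> elem (\<lambda>s \<omega>. \<Sum>i<n. E i s \<omega>) (\<lambda>\<omega>. \<Sum>i<n. Y i \<omega>)"
proof (induction n)
  case 0
  then show ?case using elem_zero by simp
next
  case (Suc n)
  then have "elem (\<lambda>s \<omega>. \<Sum>i<n. E i s \<omega>) (\<lambda>\<omega>. \<Sum>i<n. Y i \<omega>)" "elem (E n) (Y n)" by auto
  from elem_add[OF this] show ?case by simp
qed

text \<open>A factor known at time \<open>r\<close> may multiply only terms that start at
  \<open>r\<close> or later, since otherwise the product is not known at the left end of the
  interval. Cutting at \<open>r\<close> replaces the end points by \<open>max a r\<close> and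
  \<open>max b r\<close>; a term that ends before \<open>r\<close> becomes an empty interval with
  zero increment.\<close>

lemma elem_restrict:
  assumes "elem E Y" and r: "0 \<le> r" and Z: "Z \<in> borel_measurable (F r)" "\<And>\<omega>. \<omega> \<in> space M \<Longrightarrow> \<bar>Z \<omega>\<bar> \<le> B"
  shows "\<exists>Y'. elem (\<lambda>s \<omega>. indicator {r<..} s *\<^sub>R E s \<omega>) Y' \<and> elem (\<lambda>s \<omega>. indicator {r<..} s *\<^sub>R Z \<omega> *\<^sub>R E s \<omega>) (\<lambda>\<omega>. Z \<omega> *\<^sub>R Y' \<omega>)"
  using assms(1)
proof (induction rule: elem.induct)
  case elem_zero
  then show ?case using elem.elem_zero by (intro exI[of _ "\<lambda>_. 0"]) simp
next
  case (elem_add_term E Y a b \<xi> C)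
  then obtain Y' where Y': "elem (\<lambda>s \<omega>. indicator {r<..} s *\<^sub>R E s \<omega>) Y'"
    "elem (\<lambda>s \<omega>. indicator {r<..} s *\<^sub>R Z \<omega> *\<^sub>R E s \<omega>) (\<lambda>\<omega>. Z \<omega> *\<^sub>R Y' \<omega>)" by auto
  let ?a = "max a r" and ?b = "max b r"
  have \<xi>: "\<xi> \<in> borel_measurable (F ?a)" and Zm: "Z \<in> borel_measurable (F ?a)"
    using elem_add_term Z by (auto intro: measurable_F_mono[of _ a] measurable_F_mono[of _ r])
  have ind: "indicator {?a<..?b} s = (indicator {r<..} s * indicator {a<..b} s :: real)" for s
    by (auto simp: indicator_def)
  have "elem (\<lambda>s \<omega>. indicator {r<..} s *\<^sub>R E s \<omega> + indicator {?a<..?b} s *\<^sub>R \<xi> \<omega>) (\<lambda>\<omega>. Y' \<omega> + \<xi> \<omega> *v (W ?b \<omega> - W ?a \<omega>))"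
    by (rule elem.elem_add_term[where C=C]) (use Y' \<xi> elem_add_term in auto)
  moreover have "elem (\<lambda>s \<omega>. indicator {r<..} s *\<^sub>R Z \<omega> *\<^sub>R E s \<omega> + indicator {?a<..?b} s *\<^sub>R Z \<omega> *\<^sub>R \<xi> \<omega>)
      (\<lambda>\<omega>. Z \<omega> *\<^sub>R Y' \<omega> + (Z \<omega> *\<^sub>R \<xi> \<omega>) *v (W ?b \<omega> - W ?a \<omega>))"
  proof (rule elem.elem_add_term[where C="B * C"])
    fix \<omega> assume "\<omega> \<in> space M"
    then have "\<bar>Z \<omega>\<bar> \<le> B" "norm (\<xi> \<omega>) \<le> C" using Z elem_add_term by auto
    then show "norm (Z \<omega> *\<^sub>R \<xi> \<omega>) \<le> B * C" by (auto intro!: mult_mono)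
  qed (use Y' \<xi> Zm elem_add_term in \<open>auto intro!: borel_measurable_scaleR\<close>)
  ultimately show ?case
    by (intro exI[of _ "\<lambda>\<omega>. Y' \<omega> + \<xi> \<omega> *v (W ?b \<omega> - W ?a \<omega>)"] conjI; elim elem_cong)
      (auto simp: ind algebra_simps scaleR_matrix_vector_assoc)
qed

definition is_grid :: "nat \<Rightarrow> (nat \<Rightarrow> real) \<Rightarrow> bool" where
  "is_grid n g \<longleftrightarrow> 0 \<le> g 0 \<and> (\<forall>i<n. g i < g (Suc i))"

lemma is_grid_less:
  assumes "is_grid n g" "i \<le> n" "j \<le> n"
  shows "g i < g j \<longleftrightarrow> i < j"
proof -
  have *: "g i < g j" if "i < j" "j \<le> n" for i j
    using that
  proof (induction j)
    case (Suc j)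
    then show ?case using assms(1) unfolding is_grid_def by (cases "i = j") (auto intro: less_trans)
  qed simp
  show ?thesis using *[of i j] *[of j i] assms by (cases i j rule: linorder_cases) auto
qed

text \<open>Quantified over all grids through the points of \<open>P\<close> instead of a single
  grid: a further term brings its own end points, and the induction hypothesis must still apply on
  the finer grid.\<close>

definition grid_rep :: "(real \<Rightarrow> 'a \<Rightarrow> real^3^3) \<Rightarrow> ('a \<Rightarrow> real^3) \<Rightarrow> real set \<Rightarrow> real \<Rightarrow> bool" where
  "grid_rep E Y P C \<longleftrightarrow> (\<forall>n g. is_grid n g \<and> P \<subseteq> g ` {..n} \<longrightarrow>
     (\<forall>i<n. E (g (Suc i)) \<in> borel_measurable (F (g i))) \<and>
     (\<forall>i<n. \<forall>s \<omega>. g i < s \<and> s \<le> g (Suc i) \<longrightarrow> E s \<omega> = E (g (Suc i)) \<omega>) \<and>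
     (\<forall>i<n. \<forall>\<omega>\<in>space M. norm (E (g (Suc i)) \<omega>) \<le> C) \<and>
     (\<forall>\<omega>. Y \<omega> = grid_ito g (\<lambda>i. E (g (Suc i))) n \<omega>))"

lemma grid_repD:
  assumes "grid_rep E Y P C" "is_grid n g" "P \<subseteq> g ` {..n}"
  shows "i < n \<Longrightarrow> E (g (Suc i)) \<in> borel_measurable (F (g i))"
    and "i < n \<Longrightarrow> g i < s \<Longrightarrow> s \<le> g (Suc i) \<Longrightarrow> E s \<omega> = E (g (Suc i)) \<omega>"
    and "i < n \<Longrightarrow> \<omega> \<in> space M \<Longrightarrow> norm (E (g (Suc i)) \<omega>) \<le> C"
    and "Y \<omega> = grid_ito g (\<lambda>i. E (g (Suc i))) n \<omega>"
proof -
  note * = assms(1)[unfolded grid_rep_def, rule_format, OF conjI[OF assms(2,3)]]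
  show "i < n \<Longrightarrow> E (g (Suc i)) \<in> borel_measurable (F (g i))"
    using *[THEN conjunct1] by simp
  show "i < n \<Longrightarrow> g i < s \<Longrightarrow> s \<le> g (Suc i) \<Longrightarrow> E s \<omega> = E (g (Suc i)) \<omega>"
    using *[THEN conjunct2, THEN conjunct1] by blast
  show "i < n \<Longrightarrow> \<omega> \<in> space M \<Longrightarrow> norm (E (g (Suc i)) \<omega>) \<le> C"
    using *[THEN conjunct2, THEN conjunct2, THEN conjunct1] by simp
  show "Y \<omega> = grid_ito g (\<lambda>i. E (g (Suc i))) n \<omega>"
    using *[THEN conjunct2, THEN conjunct2, THEN conjunct2] by simp
qed

lemma elem_grid:
  assumes "elem E Y"
  shows "\<exists>P C. finite P \<and> P \<subseteq> {0..} \<and> grid_rep E Y P C"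
  using assms
proof (induction rule: elem.induct)
  case elem_zero
  then show ?case by (intro exI[of _ "{}"] exI[of _ 0]) (auto simp: grid_ito_def grid_rep_def)
next
  case (elem_add_term E Y a b \<xi> C)
  then obtain P C' where P: "finite P" "P \<subseteq> {0..}" and IH: "grid_rep E Y P C'" by blast
  show ?case
  proof (intro exI[of _ "P \<union> {a, b}"] exI[of _ "C' + C"] conjI)
    show "grid_rep (\<lambda>s \<omega>. E s \<omega> + indicator {a<..b} s *\<^sub>R \<xi> \<omega>) (\<lambda>\<omega>. Y \<omega> + \<xi> \<omega> *v (W b \<omega> - W a \<omega>)) (P \<union> {a, b}) (C' + C)"
      unfolding grid_rep_def
    proof (intro conjI allI impI)
    fix n g assume "is_grid n g \<and> P \<union> {a, b} \<subseteq> g ` {..n}"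
    then obtain p q where g: "is_grid n g" and Pg: "P \<subseteq> g ` {..n}" and p: "a = g p" "p \<le> n" and q: "b = g q" "q \<le> n"
      by auto
    note ih = grid_repD[OF IH g Pg]
    note lt = is_grid_less[OF g]
    have le: "g i \<le> g j \<longleftrightarrow> i \<le> j" if "i \<le> n" "j \<le> n" for i j
      using lt[of j i] that by auto
    have pq: "p \<le> q" using \<open>a \<le> b\<close> p q le by auto
    have ind: "indicator {a<..b} (g (Suc i)) = (if p \<le> i \<and> i < q then 1 else 0 :: real)" if "i < n" for i
      using lt[of p "Suc i"] le[of "Suc i" q] p q that by (auto simp: indicator_def)
    {
      fix i assume i: "i < n"
      have "(\<lambda>\<omega>. indicator {a<..b} (g (Suc i)) *\<^sub>R \<xi> \<omega>) \<in> borel_measurable (F (g i))"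
      proof (cases "p \<le> i \<and> i < q")
        case True
        then have "a \<le> g i" using le[of p i] p i by simp
        then have "\<xi> \<in> borel_measurable (F (g i))" by (rule measurable_F_mono[OF elem_add_term(4)])
        then show ?thesis by (intro borel_measurable_scaleR borel_measurable_const)
      next
        case False
        then have "indicator {a<..b} (g (Suc i)) = (0 :: real)" unfolding ind[OF i] by (rule if_not_P)
        then show ?thesis by simp
      qed
      then show "(\<lambda>\<omega>. E (g (Suc i)) \<omega> + indicator {a<..b} (g (Suc i)) *\<^sub>R \<xi> \<omega>) \<in> borel_measurable (F (g i))"
        by (rule borel_measurable_add[OF ih(1)[OF i]])
    }
    {
      fix i s \<omega> assume i: "i < n" and s: "g i < s \<and> s \<le> g (Suc i)"
      \<comment> \<open>Both \<open>a\<close> and \<open>b\<close> are grid points, so neither lies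
        strictly inside a cell, and a left-open indicator is constant on a left-open cell.\<close>
      have "indicator {a<..b} s = (indicator {a<..b} (g (Suc i)) :: real)"
      proof -
        have "a < s \<longleftrightarrow> a < g (Suc i)"
          using s i p lt[of p "Suc i"] le[of p i] by (auto simp: less_Suc_eq_le)
        moreover have "s \<le> b \<longleftrightarrow> g (Suc i) \<le> b"
          using s i q le[of "Suc i" q] le[of q i] by (auto simp: not_less_eq_eq[symmetric])
        ultimately show ?thesis by (simp add: indicator_def)
      qed
      then show "E s \<omega> + indicator {a<..b} s *\<^sub>R \<xi> \<omega> = E (g (Suc i)) \<omega> + indicator {a<..b} (g (Suc i)) *\<^sub>R \<xi> \<omega>"
        using ih(2)[OF i, of s \<omega>] s by simp
    }
    {
      fix i \<omega> assume i: "i < n"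
      show "\<forall>\<omega>\<in>space M. norm (E (g (Suc i)) \<omega> + indicator {a<..b} (g (Suc i)) *\<^sub>R \<xi> \<omega>) \<le> C' + C"
      proof
        fix \<omega> assume \<omega>: "\<omega> \<in> space M"
        have "norm (indicator {a<..b} (g (Suc i)) *\<^sub>R \<xi> \<omega>) \<le> C"
          using elem_add_term(5)[OF \<omega>] order_trans[OF norm_ge_zero elem_add_term(5)[OF \<omega>]]
          by (simp add: indicator_def)
        moreover have "norm (E (g (Suc i)) \<omega>) \<le> C'" by (rule ih(3)[OF i \<omega>])
        ultimately show "norm (E (g (Suc i)) \<omega> + indicator {a<..b} (g (Suc i)) *\<^sub>R \<xi> \<omega>) \<le> C' + C"
          by (intro order_trans[OF norm_triangle_ineq] add_mono)
      qed
    }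
    {
      fix \<omega>
      \<comment> \<open>Only the cells between \<open>a = g p\<close> and \<open>b = g q\<close>
        contribute, and over these the increments of \<open>W\<close> telescope.\<close>
      have "(\<Sum>i<n. (indicator {a<..b} (g (Suc i)) *\<^sub>R \<xi> \<omega>) *v (W (g (Suc i)) \<omega> - W (g i) \<omega>))
         = (\<Sum>i<n. if p \<le> i \<and> i < q then \<xi> \<omega> *v (W (g (Suc i)) \<omega> - W (g i) \<omega>) else 0)"
      proof (rule sum.cong[OF refl])
        fix i assume "i \<in> {..<n}"
        then show "(indicator {a<..b} (g (Suc i)) *\<^sub>R \<xi> \<omega>) *v (W (g (Suc i)) \<omega> - W (g i) \<omega>)
          = (if p \<le> i \<and> i < q then \<xi> \<omega> *v (W (g (Suc i)) \<omega> - W (g i) \<omega>) else 0)"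
          by (subst ind) auto
      qed
      also have "\<dots> = (\<Sum>i\<in>{p..<q}. \<xi> \<omega> *v (W (g (Suc i)) \<omega> - W (g i) \<omega>))"
        using q by (intro sum.mono_neutral_cong_right) auto
      also have "\<dots> = \<xi> \<omega> *v (\<Sum>i\<in>{p..<q}. W (g (Suc i)) \<omega> - W (g i) \<omega>)"
        by (simp add: linear_sum[OF matrix_vector_mul_linear])
      also have "(\<Sum>i\<in>{p..<q}. W (g (Suc i)) \<omega> - W (g i) \<omega>) = W b \<omega> - W a \<omega>"
        using sum_Suc_diff'[OF pq, of "\<lambda>i. W (g i) \<omega>"] p q by simp
      finally show "Y \<omega> + \<xi> \<omega> *v (W b \<omega> - W a \<omega>) = grid_ito g (\<lambda>i \<omega>. E (g (Suc i)) \<omega> + indicator {a<..b} (g (Suc i)) *\<^sub>R \<xi> \<omega>) n \<omega>"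
        using ih(4) by (simp add: grid_ito_def matrix_vector_mult_add_rdistrib sum.distrib)
    }
    qed
  qed (use P elem_add_term in auto)
qed

lemma elem_lenglart:
  assumes "elem E Y" and A: "A \<in> sets M" "\<And>\<omega> s. \<omega> \<in> space M - A \<Longrightarrow> E s \<omega> = 0"
    and N: "N \<in> sets M" "\<And>\<omega>. \<omega> \<in> space M - N \<Longrightarrow> (\<integral>\<^sup>+s. ennreal ((norm (E s \<omega>))\<^sup>2) \<partial>lborel) \<le> ennreal \<delta>"
    and \<delta>: "0 \<le> \<delta>" and \<epsilon>: "0 < \<epsilon>"
  shows "measure M {\<omega>\<in>space M. \<epsilon> < norm (Y \<omega>)} \<le> 3 * \<delta> * measure M A / \<epsilon>\<^sup>2 + measure M N"
proof -
  obtain P C where P: "finite P" "P \<subseteq> {0..}" and IH: "grid_rep E Y P C" using elem_grid[OF assms(1)] by blast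
  \<comment> \<open>Inserting 0 keeps the list nonempty even for empty \<open>P\<close>; its
    \<open>Suc n\<close> points bound \<open>n\<close> cells.\<close>
  define l where "l = sorted_list_of_set (insert 0 P)"
  define n where "n = length l - 1"
  define g where "g i = l ! i" for i
  have l: "set l = insert 0 P" "sorted_wrt (<) l" using P by (simp_all add: l_def del: sorted_list_of_set_insert_remove)
  then have ln: "length l = Suc n" unfolding n_def by (cases l) auto
  have "{..n} = {0..<length l}" using ln by auto
  then have "g ` {..n} = set l" unfolding g_def set_conv_nth ln by (auto simp: less_Suc_eq_le)
  then have Pg: "P \<subseteq> g ` {..n}" using l by auto
  have "g 0 \<in> insert 0 P" using \<open>g ` {..n} = set l\<close> l by auto
  then have g0: "0 \<le> g 0" using P by auto
  have g: "is_grid n g"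
    unfolding is_grid_def using g0 l(2) ln by (auto simp: g_def sorted_wrt_nth_less)
  note ih = grid_repD[OF IH g Pg]
  have "measure M {\<omega>\<in>space M. \<epsilon> < norm (grid_ito g (\<lambda>i. E (g (Suc i))) n \<omega>)} \<le> 3 * \<delta> * measure M A / \<epsilon>\<^sup>2 + measure M N"
  proof (rule grid_ito_lenglart[where C=C])
    fix \<omega> assume \<omega>: "\<omega> \<in> space M - N"
    have "ennreal (\<Sum>i<n. (g (Suc i) - g i) * (norm (E (g (Suc i)) \<omega>))\<^sup>2) \<le> (\<integral>\<^sup>+s. ennreal ((norm (E s \<omega>))\<^sup>2) \<partial>lborel)"
      using g by (intro sq_integral_cells_le ih(2)) (simp_all add: is_grid_def)
    also have "\<dots> \<le> ennreal \<delta>" by (rule N(2)[OF \<omega>])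
    finally show "(\<Sum>i<n. (g (Suc i) - g i) * (norm (E (g (Suc i)) \<omega>))\<^sup>2) \<le> \<delta>" using \<delta> by simp
  qed (use g ih(1,3) A N \<delta> \<epsilon> in \<open>auto simp: is_grid_def\<close>)
  then show ?thesis using ih(4) by simp
qed

end

section \<open>Limits of elementary integrals\<close>

lemma nn_integral_sq_norm_add_le:
  fixes f g :: "real \<Rightarrow> 'b::euclidean_space"
  assumes [measurable]: "f \<in> borel_measurable borel" "g \<in> borel_measurable borel"
    and a: "(\<integral>\<^sup>+s. ennreal ((norm (f s))\<^sup>2) \<partial>lborel) \<le> ennreal a" and b: "(\<integral>\<^sup>+s. ennreal ((norm (g s))\<^sup>2) \<partial>lborel) \<le> ennreal b"
    and nn: "0 \<le> a" "0 \<le> b"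
  shows "(\<integral>\<^sup>+s. ennreal ((norm (f s + g s))\<^sup>2) \<partial>lborel) \<le> ennreal (2 * a + 2 * b)"
proof -
  have "(\<integral>\<^sup>+s. ennreal ((norm (f s + g s))\<^sup>2) \<partial>lborel) \<le> (\<integral>\<^sup>+s. 2 * ennreal ((norm (f s))\<^sup>2) + 2 * ennreal ((norm (g s))\<^sup>2) \<partial>lborel)"
  proof (rule nn_integral_mono)
    fix s
    have "(norm (f s + g s))\<^sup>2 \<le> (norm (f s) + norm (g s))\<^sup>2" by (intro power_mono norm_triangle_ineq) auto
    also have "\<dots> \<le> 2 * (norm (f s))\<^sup>2 + 2 * (norm (g s))\<^sup>2"
      using sum_squares_bound[of "norm (f s)" "norm (g s)"] by (simp add: power2_sum)
    finally have "ennreal ((norm (f s + g s))\<^sup>2) \<le> ennreal (2 * (norm (f s))\<^sup>2 + 2 * (norm (g s))\<^sup>2)"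
      by (rule ennreal_leI)
    then show "ennreal ((norm (f s + g s))\<^sup>2) \<le> 2 * ennreal ((norm (f s))\<^sup>2) + 2 * ennreal ((norm (g s))\<^sup>2)"
      by (simp add: ennreal_mult)
  qed
  also have "\<dots> = 2 * (\<integral>\<^sup>+s. ennreal ((norm (f s))\<^sup>2) \<partial>lborel) + 2 * (\<integral>\<^sup>+s. ennreal ((norm (g s))\<^sup>2) \<partial>lborel)"
    by (simp add: nn_integral_add nn_integral_cmult)
  also have "\<dots> \<le> 2 * ennreal a + 2 * ennreal b"
    using a b by (intro add_mono mult_left_mono) auto
  also have "\<dots> = ennreal (2 * a + 2 * b)" using nn by (simp add: ennreal_mult)
  finally show ?thesis .
qed

context brownian begin

lemma elem_path_measurable: "elem E Y \<Longrightarrow> (\<lambda>s. E s \<omega>) \<in> borel_measurable borel"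
  by (induction rule: elem.induct) auto

lemma elem_integral_measurable: "elem E Y \<Longrightarrow> Y \<in> borel_measurable M"
proof (induction rule: elem.induct)
  case (elem_add_term E Y a b \<xi> C)
  have [measurable]: "\<xi> \<in> borel_measurable M" "W a \<in> borel_measurable M" "W b \<in> borel_measurable M" "Y \<in> borel_measurable M"
    using measurable_F_M[OF elem_add_term(4)] W_measurable elem_add_term by auto
  show ?case by measurable
qed simp

text \<open>Convergence in probability is phrased with a single tolerance and an exceptional event \<open>N\<close>, so
  that \<open>N\<close> is the only set whose measurability matters. Integrals run over the whole time axis; a
  finite horizon is encoded by multiplying the integrand by an indicator.\<close>

definition elem_approx ::
    "(real \<Rightarrow> 'a \<Rightarrow> real^3^3) \<Rightarrow> ('a \<Rightarrow> real^3) \<Rightarrow> real \<Rightarrow> (real \<Rightarrow> 'a \<Rightarrow> real^3^3) \<Rightarrow> ('a \<Rightarrow> real^3) \<Rightarrow> 'a set \<Rightarrow> bool"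
  where
  "elem_approx H X e E Y N \<longleftrightarrow> elem E Y \<and> N \<in> sets M \<and> measure M N \<le> e \<and>
     (\<forall>\<omega>\<in>space M - N. (\<integral>\<^sup>+s. ennreal ((norm (H s \<omega> - E s \<omega>))\<^sup>2) \<partial>lborel) \<le> ennreal e \<and> norm (X \<omega> - Y \<omega>) \<le> e)"

lemma elem_approxD:
  assumes "elem_approx H X e E Y N"
  shows "elem E Y" "N \<in> sets M" "measure M N \<le> e"
    "\<omega> \<in> space M - N \<Longrightarrow> (\<integral>\<^sup>+s. ennreal ((norm (H s \<omega> - E s \<omega>))\<^sup>2) \<partial>lborel) \<le> ennreal e"
    "\<omega> \<in> space M - N \<Longrightarrow> norm (X \<omega> - Y \<omega>) \<le> e"
  using assms by (simp_all add: elem_approx_def)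

lemma elem_approxI:
  assumes "elem E Y" "N \<in> sets M" "measure M N \<le> e"
    "\<And>\<omega>. \<omega> \<in> space M - N \<Longrightarrow> (\<integral>\<^sup>+s. ennreal ((norm (H s \<omega> - E s \<omega>))\<^sup>2) \<partial>lborel) \<le> ennreal e"
    "\<And>\<omega>. \<omega> \<in> space M - N \<Longrightarrow> norm (X \<omega> - Y \<omega>) \<le> e"
  shows "elem_approx H X e E Y N"
  unfolding elem_approx_def by (intro conjI ballI assms)

definition ito_lim :: "(real \<Rightarrow> 'a \<Rightarrow> real^3^3) \<Rightarrow> ('a \<Rightarrow> real^3) \<Rightarrow> bool" where
  "ito_lim H X \<longleftrightarrow> (\<forall>\<omega>\<in>space M. (\<lambda>s. H s \<omega>) \<in> borel_measurable borel) \<and>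
     (\<forall>e>0. \<exists>E Y N. elem_approx H X e E Y N)"

lemma ito_lim_path_measurable: "ito_lim H X \<Longrightarrow> \<omega> \<in> space M \<Longrightarrow> (\<lambda>s. H s \<omega>) \<in> borel_measurable borel"
  by (simp add: ito_lim_def)

lemma ito_lim_approx: "ito_lim H X \<Longrightarrow> e > 0 \<Longrightarrow> \<exists>E Y N. elem_approx H X e E Y N"
  by (simp add: ito_lim_def)

lemma ito_limI:
  assumes "\<And>\<omega>. \<omega> \<in> space M \<Longrightarrow> (\<lambda>s. H s \<omega>) \<in> borel_measurable borel"
    and "\<And>e. e > 0 \<Longrightarrow> \<exists>E Y N. elem_approx H X e E Y N"
  shows "ito_lim H X"
  unfolding ito_lim_def by (intro conjI ballI allI impI assms)

lemma ito_lim_cong: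
  assumes "ito_lim H X" "\<And>s \<omega>. \<omega> \<in> space M \<Longrightarrow> H' s \<omega> = H s \<omega>" "\<And>\<omega>. \<omega> \<in> space M \<Longrightarrow> X' \<omega> = X \<omega>"
  shows "ito_lim H' X'"
  using assms(1) unfolding ito_lim_def elem_approx_def by (simp add: assms(2,3))

lemma ito_lim_elem: "elem E Y \<Longrightarrow> ito_lim E Y"
  by (rule ito_limI) (auto intro: elem_path_measurable simp: elem_approx_def intro!: exI[of _ E] exI[of _ Y] exI[of _ "{}"])

lemma ito_lim_add:
  assumes "ito_lim H X" "ito_lim H' X'"
  shows "ito_lim (\<lambda>s \<omega>. H s \<omega> + H' s \<omega>) (\<lambda>\<omega>. X \<omega> + X' \<omega>)"
proof (rule ito_limI)
  fix e :: real assume e: "e > 0"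
  obtain E Y N where "elem_approx H X (e/4) E Y N" using ito_lim_approx[OF assms(1), of "e/4"] e by auto
  note E = elem_approxD[OF this]
  obtain E' Y' N' where "elem_approx H' X' (e/4) E' Y' N'" using ito_lim_approx[OF assms(2), of "e/4"] e by auto
  note E' = elem_approxD[OF this]
  show "\<exists>E Y N. elem_approx (\<lambda>s \<omega>. H s \<omega> + H' s \<omega>) (\<lambda>\<omega>. X \<omega> + X' \<omega>) e E Y N"
  proof (intro exI, rule elem_approxI)
    show "elem (\<lambda>s \<omega>. E s \<omega> + E' s \<omega>) (\<lambda>\<omega>. Y \<omega> + Y' \<omega>)" by (rule elem_add[OF E(1) E'(1)])
    show "N \<union> N' \<in> sets M" using E E' by auto
    show "measure M (N \<union> N') \<le> e" using measure_Un_le[OF E(2) E'(2)] E(3) E'(3) e by linarith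
  next
    fix \<omega> assume \<omega>: "\<omega> \<in> space M - (N \<union> N')"
    have "(\<integral>\<^sup>+s. ennreal ((norm ((H s \<omega> - E s \<omega>) + (H' s \<omega> - E' s \<omega>)))\<^sup>2) \<partial>lborel) \<le> ennreal (2 * (e/4) + 2 * (e/4))"
      using \<omega> E(4) E'(4) e elem_path_measurable[OF E(1)] elem_path_measurable[OF E'(1)]
        ito_lim_path_measurable[OF assms(1)] ito_lim_path_measurable[OF assms(2)]
      by (intro nn_integral_sq_norm_add_le borel_measurable_diff) auto
    then show "(\<integral>\<^sup>+s. ennreal ((norm (H s \<omega> + H' s \<omega> - (E s \<omega> + E' s \<omega>)))\<^sup>2) \<partial>lborel) \<le> ennreal e"
      by (simp add: algebra_simps)
    have "norm ((X \<omega> - Y \<omega>) + (X' \<omega> - Y' \<omega>)) \<le> e/4 + e/4"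
      using E(5)[of \<omega>] E'(5)[of \<omega>] \<omega> by (intro norm_triangle_mono) auto
    then show "norm (X \<omega> + X' \<omega> - (Y \<omega> + Y' \<omega>)) \<le> e"
      using e by (simp add: algebra_simps)
  qed
next
  fix \<omega> assume "\<omega> \<in> space M"
  then show "(\<lambda>s. H s \<omega> + H' s \<omega>) \<in> borel_measurable borel"
    using ito_lim_path_measurable assms by (intro borel_measurable_add) auto
qed

lemma ito_lim_uminus:
  assumes "ito_lim H X"
  shows "ito_lim (\<lambda>s \<omega>. - H s \<omega>) (\<lambda>\<omega>. - X \<omega>)"
proof (rule ito_limI)
  fix e :: real assume e: "e > 0"
  obtain E Y N where "elem_approx H X e E Y N" using ito_lim_approx[OF assms e] by auto
  note E = elem_approxD[OF this]
  have eq: "norm (- H s \<omega> - - E s \<omega>) = norm (H s \<omega> - E s \<omega>)" "norm (- X \<omega> - - Y \<omega>) = norm (X \<omega> - Y \<omega>)" for s \<omega>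
    by (simp_all add: norm_minus_commute)
  have "elem_approx (\<lambda>s \<omega>. - H s \<omega>) (\<lambda>\<omega>. - X \<omega>) e (\<lambda>s \<omega>. - E s \<omega>) (\<lambda>\<omega>. - Y \<omega>) N"
    by (rule elem_approxI) (simp_all only: eq E elem_uminus)
  then show "\<exists>E Y N. elem_approx (\<lambda>s \<omega>. - H s \<omega>) (\<lambda>\<omega>. - X \<omega>) e E Y N" by blast
qed (use ito_lim_path_measurable[OF assms] in auto)

lemma ito_lim_diff:
  "ito_lim H X \<Longrightarrow> ito_lim H' X' \<Longrightarrow> ito_lim (\<lambda>s \<omega>. H s \<omega> - H' s \<omega>) (\<lambda>\<omega>. X \<omega> - X' \<omega>)"
  using ito_lim_add[OF _ ito_lim_uminus, of H X H' X'] by simp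

lemma ito_lim_sum:
  fixes n :: nat
  shows "(\<And>i. i < n \<Longrightarrow> ito_lim (H i) (X i)) \<Longrightarrow> ito_lim (\<lambda>s \<omega>. \<Sum>i<n. H i s \<omega>) (\<lambda>\<omega>. \<Sum>i<n. X i \<omega>)"
proof (induction n)
  case 0
  then show ?case using ito_lim_elem[OF elem_zero] by simp
next
  case (Suc n)
  then have "ito_lim (\<lambda>s \<omega>. \<Sum>i<n. H i s \<omega>) (\<lambda>\<omega>. \<Sum>i<n. X i \<omega>)" "ito_lim (H n) (X n)" by auto
  from ito_lim_add[OF this] show ?case by simp
qed

text \<open>As \<open>H\<close> vanishes up to time \<open>r\<close>, the part of an approximant
  that lives before \<open>r\<close> is pure error: its squared norm is within the tolerance, so by
  Lenglart its integral is small and it can be cut away. What remains may be multiplied by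
  \<open>Z\<close>. That the new approximants vanish where \<open>Z\<close> does is recorded because
  it preserves the factor \<open>measure M A\<close> in the limit.\<close>

lemma ito_lim_restrict_approx:
  assumes H: "ito_lim H X" and r: "0 \<le> r" and H0: "\<And>s \<omega>. \<omega> \<in> space M \<Longrightarrow> s \<le> r \<Longrightarrow> H s \<omega> = 0"
    and Z: "Z \<in> borel_measurable (F r)" "\<And>\<omega>. \<omega> \<in> space M \<Longrightarrow> \<bar>Z \<omega>\<bar> \<le> B" and e: "e > 0"
  shows "\<exists>E Y N. elem_approx (\<lambda>s \<omega>. Z \<omega> *\<^sub>R H s \<omega>) (\<lambda>\<omega>. Z \<omega> *\<^sub>R X \<omega>) e E Y N \<and> (\<forall>s \<omega>. Z \<omega> = 0 \<longrightarrow> E s \<omega> = 0)"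
proof -
  have B: "B \<ge> 0" using Z(2) not_empty by (meson abs_ge_zero ex_in_conv order_trans)
  define \<eta> where "\<eta> = e / (2 * (B + 1))"
  have \<eta>: "\<eta> > 0" using e B by (simp add: \<eta>_def)
  \<comment> \<open>The three bounds serve the distance of the integrals (\<eta> from the
    approximation and \<eta> from the cut, times \<open>B\<close>), the time integral (times
    \<open>B\<^sup>2\<close>), and the exceptional event, of probability at most
    \<open>2 * e1 + 3 * e1 / \<eta>\<^sup>2\<close>.\<close>
  define e1 where "e1 = min \<eta> (min (e / (B\<^sup>2 + 1)) (e * \<eta>\<^sup>2 / (2 * \<eta>\<^sup>2 + 3)))"
  have B1: "B\<^sup>2 + 1 > 0" by (simp add: add_nonneg_pos)
  have \<eta>3: "2 * \<eta>\<^sup>2 + 3 > 0" by (simp add: add_nonneg_pos)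
  have e1: "e1 > 0" using \<eta> e B1 \<eta>3 by (simp add: e1_def)
  have "e1 \<le> e / (B\<^sup>2 + 1)" by (simp add: e1_def)
  then have e1B: "B\<^sup>2 * e1 \<le> e" using B1 e1 by (simp add: field_simps)
  have "e1 \<le> e * \<eta>\<^sup>2 / (2 * \<eta>\<^sup>2 + 3)" by (simp add: e1_def)
  then have "e1 * (2 * \<eta>\<^sup>2 + 3) \<le> e * \<eta>\<^sup>2" using \<eta>3 by (simp add: pos_le_divide_eq)
  then have e1p: "e1 + (3 * e1 * 1 / \<eta>\<^sup>2 + e1) \<le> e" using \<eta> by (simp add: field_simps)
  have "B * (2 * \<eta>) \<le> (B + 1) * (2 * \<eta>)" using \<eta> by (intro mult_right_mono) auto
  also have "\<dots> = e" using B by (simp add: \<eta>_def field_simps)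
  finally have e1n: "B * (2 * \<eta>) \<le> e" .
  obtain E Y N where "elem_approx H X e1 E Y N" using ito_lim_approx[OF H e1] by auto
  note E = elem_approxD[OF this]
  let ?E1 = "\<lambda>s \<omega>. indicator {r<..} s *\<^sub>R E s \<omega>"
  obtain Y1 where Y1: "elem ?E1 Y1" "elem (\<lambda>s \<omega>. indicator {r<..} s *\<^sub>R Z \<omega> *\<^sub>R E s \<omega>) (\<lambda>\<omega>. Z \<omega> *\<^sub>R Y1 \<omega>)"
    using elem_restrict[OF E(1) r Z] by blast
  have D: "elem (\<lambda>s \<omega>. E s \<omega> - ?E1 s \<omega>) (\<lambda>\<omega>. Y \<omega> - Y1 \<omega>)" by (rule elem_diff[OF E(1) Y1(1)])
  define N1 where "N1 = {\<omega>\<in>space M. \<eta> < norm (Y \<omega> - Y1 \<omega>)}"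
  have N1m: "N1 \<in> sets M"
    unfolding N1_def using elem_integral_measurable[OF D] by measurable
  have "measure M N1 \<le> 3 * e1 * measure M (space M) / \<eta>\<^sup>2 + measure M N"
    unfolding N1_def
  proof (rule elem_lenglart[OF D])
    fix \<omega> assume \<omega>: "\<omega> \<in> space M - N"
    have "(\<integral>\<^sup>+s. ennreal ((norm (E s \<omega> - ?E1 s \<omega>))\<^sup>2) \<partial>lborel) \<le> (\<integral>\<^sup>+s. ennreal ((norm (H s \<omega> - E s \<omega>))\<^sup>2) \<partial>lborel)"
      using H0[of \<omega>] \<omega> by (intro nn_integral_mono) (auto simp: indicator_def)
    then show "(\<integral>\<^sup>+s. ennreal ((norm (E s \<omega> - ?E1 s \<omega>))\<^sup>2) \<partial>lborel) \<le> ennreal e1"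
      using E(4)[OF \<omega>] by (rule order_trans)
  qed (use E e1 \<eta> in auto)
  then have "measure M N1 \<le> 3 * e1 * 1 / \<eta>\<^sup>2 + e1" using E(3) by (simp add: prob_space)
  then have NN: "measure M (N \<union> N1) \<le> e" using measure_Un_le[OF E(2) N1m] E(3) e1p by linarith
  show ?thesis
  proof (rule exI, rule exI, rule exI, rule conjI, rule elem_approxI[OF Y1(2) _ NN])
    fix \<omega> assume \<omega>: "\<omega> \<in> space M - (N \<union> N1)"
    have Zb: "\<bar>Z \<omega>\<bar> \<le> B" using Z \<omega> by auto
    have [measurable]: "(\<lambda>s. H s \<omega>) \<in> borel_measurable borel" "(\<lambda>s. E s \<omega>) \<in> borel_measurable borel"
      using ito_lim_path_measurable[OF H] elem_path_measurable[OF E(1)] \<omega> by auto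
    have "(\<integral>\<^sup>+s. ennreal ((norm (Z \<omega> *\<^sub>R H s \<omega> - indicator {r<..} s *\<^sub>R Z \<omega> *\<^sub>R E s \<omega>))\<^sup>2) \<partial>lborel)
      \<le> (\<integral>\<^sup>+s. ennreal (B\<^sup>2) * ennreal ((norm (H s \<omega> - E s \<omega>))\<^sup>2) \<partial>lborel)"
    proof (rule nn_integral_mono)
      fix s
      have "norm (Z \<omega> *\<^sub>R H s \<omega> - indicator {r<..} s *\<^sub>R Z \<omega> *\<^sub>R E s \<omega>) \<le> \<bar>Z \<omega>\<bar> * norm (H s \<omega> - E s \<omega>)"
        using H0[of \<omega> s] \<omega> by (auto simp: indicator_def scaleR_diff_right[symmetric] simp del: scaleR_diff_right)
      also have "\<dots> \<le> B * norm (H s \<omega> - E s \<omega>)" using Zb by (intro mult_right_mono) auto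
      finally have "(norm (Z \<omega> *\<^sub>R H s \<omega> - indicator {r<..} s *\<^sub>R Z \<omega> *\<^sub>R E s \<omega>))\<^sup>2 \<le> (B * norm (H s \<omega> - E s \<omega>))\<^sup>2"
        by (intro power_mono) auto
      then show "ennreal ((norm (Z \<omega> *\<^sub>R H s \<omega> - indicator {r<..} s *\<^sub>R Z \<omega> *\<^sub>R E s \<omega>))\<^sup>2) \<le> ennreal (B\<^sup>2) * ennreal ((norm (H s \<omega> - E s \<omega>))\<^sup>2)"
        by (simp add: ennreal_mult[symmetric] power_mult_distrib ennreal_leI)
    qed
    also have "\<dots> = ennreal (B\<^sup>2) * (\<integral>\<^sup>+s. ennreal ((norm (H s \<omega> - E s \<omega>))\<^sup>2) \<partial>lborel)"
      by (rule nn_integral_cmult) measurable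
    also have "\<dots> \<le> ennreal (B\<^sup>2) * ennreal e1"
      using E(4)[of \<omega>] \<omega> by (intro mult_left_mono) auto
    also have "\<dots> \<le> ennreal e" using e1B e1 by (simp add: ennreal_mult[symmetric] ennreal_leI)
    finally show "(\<integral>\<^sup>+s. ennreal ((norm (Z \<omega> *\<^sub>R H s \<omega> - indicator {r<..} s *\<^sub>R Z \<omega> *\<^sub>R E s \<omega>))\<^sup>2) \<partial>lborel) \<le> ennreal e" .
    have "norm (X \<omega> - Y1 \<omega>) \<le> norm (X \<omega> - Y \<omega>) + norm (Y \<omega> - Y1 \<omega>)"
      by (metis diff_add_cancel add_diff_eq norm_triangle_ineq)
    also have "\<dots> \<le> 2 * \<eta>"
    proof -
      have "norm (X \<omega> - Y \<omega>) \<le> \<eta>" using order_trans[OF E(5)[of \<omega>], of \<eta>] \<omega> by (simp add: e1_def)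
      moreover have "norm (Y \<omega> - Y1 \<omega>) \<le> \<eta>" using \<omega> by (auto simp: N1_def)
      ultimately show ?thesis by simp
    qed
    finally have "\<bar>Z \<omega>\<bar> * norm (X \<omega> - Y1 \<omega>) \<le> B * (2 * \<eta>)"
      using Zb by (intro mult_mono) auto
    then show "norm (Z \<omega> *\<^sub>R X \<omega> - Z \<omega> *\<^sub>R Y1 \<omega>) \<le> e"
      using e1n by (simp add: scaleR_diff_right[symmetric] del: scaleR_diff_right)
  qed (use E N1m in auto)
qed

lemma ito_lim_restrict:
  assumes H: "ito_lim H X" and r: "0 \<le> r" and H0: "\<And>s \<omega>. \<omega> \<in> space M \<Longrightarrow> s \<le> r \<Longrightarrow> H s \<omega> = 0"
    and Z: "Z \<in> borel_measurable (F r)" "\<And>\<omega>. \<omega> \<in> space M \<Longrightarrow> \<bar>Z \<omega>\<bar> \<le> B"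
  shows "ito_lim (\<lambda>s \<omega>. Z \<omega> *\<^sub>R H s \<omega>) (\<lambda>\<omega>. Z \<omega> *\<^sub>R X \<omega>)"
proof (rule ito_limI)
  fix e :: real assume "e > 0"
  from ito_lim_restrict_approx[OF H r H0 Z this]
  show "\<exists>E Y N. elem_approx (\<lambda>s \<omega>. Z \<omega> *\<^sub>R H s \<omega>) (\<lambda>\<omega>. Z \<omega> *\<^sub>R X \<omega>) e E Y N" by blast
qed (use ito_lim_path_measurable[OF H] in auto)

text \<open>Localization to \<open>A\<close> is multiplication by its indicator, which is known at
  time \<open>r\<close>. Half of the level \<open>2 * \<epsilon>\<close> pays for the distance to an
  approximant, and \<delta> doubles through the bound of the square of a sum by twice the sum of
  squares; the tolerance \<open>e\<close> then tends to 0.\<close>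

lemma ito_lim_lenglart:
  assumes H: "ito_lim H X" and r: "0 \<le> r" and H0: "\<And>s \<omega>. \<omega> \<in> space M \<Longrightarrow> s \<le> r \<Longrightarrow> H s \<omega> = 0"
    and A: "A \<in> sets (F r)"
    and N: "N \<in> sets M" "\<And>\<omega>. \<omega> \<in> A - N \<Longrightarrow> (\<integral>\<^sup>+s. ennreal ((norm (H s \<omega>))\<^sup>2) \<partial>lborel) \<le> ennreal \<delta>"
    and \<delta>: "0 \<le> \<delta>" and \<epsilon>: "0 < \<epsilon>"
  shows "measure M {\<omega>\<in>A. 2 * \<epsilon> < norm (X \<omega>)} \<le> 6 * \<delta> * measure M A / \<epsilon>\<^sup>2 + measure M N"
proof -
  define Z where "Z = (indicator A :: 'a \<Rightarrow> real)"
  have Z: "Z \<in> borel_measurable (F r)" "\<And>\<omega>. \<omega> \<in> space M \<Longrightarrow> \<bar>Z \<omega>\<bar> \<le> 1"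
    using A by (auto simp: Z_def indicator_def)
  have AM: "A \<in> sets M" using A sets_F_M by auto
  have main: "measure M {\<omega>\<in>A. 2 * \<epsilon> < norm (X \<omega>)} \<le> 6 * \<delta> * measure M A / \<epsilon>\<^sup>2 + measure M N + (6 * measure M A / \<epsilon>\<^sup>2 + 2) * e"
    if e: "0 < e" "e \<le> \<epsilon>" for e
  proof -
    obtain E Y N' where ap: "elem_approx (\<lambda>s \<omega>. Z \<omega> *\<^sub>R H s \<omega>) (\<lambda>\<omega>. Z \<omega> *\<^sub>R X \<omega>) e E Y N'"
      and E6: "\<And>s \<omega>. Z \<omega> = 0 \<Longrightarrow> E s \<omega> = 0"
      using ito_lim_restrict_approx[OF H r H0 Z e(1)] by blast
    note E = elem_approxD[OF ap]
    have "measure M {\<omega>\<in>space M. \<epsilon> < norm (Y \<omega>)} \<le> 3 * (2 * \<delta> + 2 * e) * measure M A / \<epsilon>\<^sup>2 + measure M (N \<union> N')"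
    proof (rule elem_lenglart[OF E(1) AM])
      fix \<omega> assume \<omega>: "\<omega> \<in> space M - (N \<union> N')"
      show "(\<integral>\<^sup>+s. ennreal ((norm (E s \<omega>))\<^sup>2) \<partial>lborel) \<le> ennreal (2 * \<delta> + 2 * e)"
      proof (cases "\<omega> \<in> A")
        case True
        then have Z1: "Z \<omega> = 1" by (simp add: Z_def)
        have m: "(\<lambda>s. H s \<omega>) \<in> borel_measurable borel" "(\<lambda>s. E s \<omega>) \<in> borel_measurable borel"
          using ito_lim_path_measurable[OF H] elem_path_measurable[OF E(1)] \<omega> by auto
        have "(\<integral>\<^sup>+s. ennreal ((norm (H s \<omega> + (E s \<omega> - H s \<omega>)))\<^sup>2) \<partial>lborel) \<le> ennreal (2 * \<delta> + 2 * e)"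
        proof (rule nn_integral_sq_norm_add_le)
          show "(\<integral>\<^sup>+s. ennreal ((norm (E s \<omega> - H s \<omega>))\<^sup>2) \<partial>lborel) \<le> ennreal e"
            using E(4)[of \<omega>] \<omega> Z1 by (simp add: norm_minus_commute)
        qed (use m \<omega> True N(2) \<delta> e in auto)
        then show ?thesis by simp
      next
        case False
        then show ?thesis using E6[of \<omega>] by (simp add: Z_def)
      qed
    qed (use E(2) E6 N(1) \<delta> e \<epsilon> in \<open>auto simp: Z_def\<close>)
    moreover have "{\<omega>\<in>A. 2 * \<epsilon> < norm (X \<omega>)} \<subseteq> {\<omega>\<in>space M. \<epsilon> < norm (Y \<omega>)} \<union> N'"
    proof safe
      fix \<omega> assume \<omega>: "\<omega> \<in> A" "2 * \<epsilon> < norm (X \<omega>)" "\<omega> \<notin> N'"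
      then show sp: "\<omega> \<in> space M" using AM sets.sets_into_space by auto
      have "norm (X \<omega> - Y \<omega>) \<le> e" using E(5)[of \<omega>] sp \<omega> by (simp add: Z_def)
      then show "\<epsilon> < norm (Y \<omega>)" using \<omega> e norm_triangle_sub[of "X \<omega>" "Y \<omega>"] by linarith
    qed
    then have "measure M {\<omega>\<in>A. 2 * \<epsilon> < norm (X \<omega>)} \<le> measure M ({\<omega>\<in>space M. \<epsilon> < norm (Y \<omega>)} \<union> N')"
      using E(2) elem_integral_measurable[OF E(1)] by (intro finite_measure_mono) auto
    moreover have "measure M ({\<omega>\<in>space M. \<epsilon> < norm (Y \<omega>)} \<union> N') \<le> measure M {\<omega>\<in>space M. \<epsilon> < norm (Y \<omega>)} + measure M N'"
      using E(2) elem_integral_measurable[OF E(1)] by (intro measure_Un_le) auto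
    moreover have "measure M (N \<union> N') \<le> measure M N + measure M N'" using N E by (intro measure_Un_le) auto
    moreover have "3 * (2 * \<delta> + 2 * e) * measure M A / \<epsilon>\<^sup>2 = 6 * \<delta> * measure M A / \<epsilon>\<^sup>2 + 6 * measure M A / \<epsilon>\<^sup>2 * e"
      by (simp add: field_simps add_divide_distrib)
    ultimately show ?thesis using E(3) by (simp add: distrib_right)
  qed
  show ?thesis
  proof (rule field_le_epsilon)
    fix d :: real assume d: "d > 0"
    define K where "K = 6 * measure M A / \<epsilon>\<^sup>2 + 2"
    have K: "K > 0" unfolding K_def by (simp add: add_nonneg_pos)
    define e where "e = min \<epsilon> (d / K)"
    have e: "0 < e" "e \<le> \<epsilon>" "e \<le> d / K" using d K \<epsilon> by (auto simp: e_def)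
    then have "K * e \<le> d" using K by (simp add: field_simps)
    then show "measure M {\<omega>\<in>A. 2 * \<epsilon> < norm (X \<omega>)} \<le> 6 * \<delta> * measure M A / \<epsilon>\<^sup>2 + measure M N + d"
      using main[OF e(1,2)] unfolding K_def by linarith
  qed
qed

section \<open>Ito integrals as limits of elementary ones\<close>

lemma simple_elem:
  assumes S: "simple_integrand M F n \<tau> \<xi>" and t: "0 \<le> t"
  shows "elem (\<lambda>s \<omega>. indicator {0<..t} s *\<^sub>R simple_process n \<tau> \<xi> s \<omega>) (simple_ito W n \<tau> \<xi> t)"
proof -
  have inc: "\<tau> i < \<tau> (Suc i)" if "i < n" for i using S that by (simp add: simple_integrand_def)
  have \<tau>0: "0 \<le> \<tau> i" if "i \<le> n" for i
    using that
  proof (induction i)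
    case 0 then show ?case using S by (simp add: simple_integrand_def)
  next
    case (Suc i) then show ?case using inc[of i] by simp
  qed
  have "elem (\<lambda>s \<omega>. \<Sum>i<n. indicator {min t (\<tau> i)<..min t (\<tau> (Suc i))} s *\<^sub>R \<xi> i \<omega>)
     (\<lambda>\<omega>. \<Sum>i<n. \<xi> i \<omega> *v (W (min t (\<tau> (Suc i))) \<omega> - W (min t (\<tau> i)) \<omega>))"
  proof (rule elem_sum)
    fix i assume i: "i < n"
    obtain C where C: "\<And>\<omega>. \<omega> \<in> space M \<Longrightarrow> norm (\<xi> i \<omega>) \<le> C"
      using S i unfolding simple_integrand_def by blast
    have m: "\<xi> i \<in> borel_measurable (F (\<tau> i))" using S i by (simp add: simple_integrand_def)
    show "elem (\<lambda>s \<omega>. indicator {min t (\<tau> i)<..min t (\<tau> (Suc i))} s *\<^sub>R \<xi> i \<omega>)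
       (\<lambda>\<omega>. \<xi> i \<omega> *v (W (min t (\<tau> (Suc i))) \<omega> - W (min t (\<tau> i)) \<omega>))"
    proof (cases "\<tau> i \<le> t")
      case True
      then have "min t (\<tau> i) = \<tau> i" by simp
      then show ?thesis using elem_term[OF _ _ m C, of "min t (\<tau> (Suc i))"] \<tau>0[of i] i inc[OF i] True by simp
    next
      case False
      \<comment> \<open>The interval collapses to the point \<open>t\<close>. This case is separate
        since \<open>\<xi> i\<close> is measurable at \<open>\<tau> i\<close> but possibly not at
        the earlier time \<open>t\<close>.\<close>
      then have "min t (\<tau> i) = t" "min t (\<tau> (Suc i)) = t" using inc[OF i] by auto
      then show ?thesis using elem_zero by simp
    qed
  qed
  then show ?thesis
  proof (rule elem_cong)
    fix s \<omega>
    have "indicator {0<..t} s * indicator {\<tau> i<..\<tau> (Suc i)} s = (indicator {min t (\<tau> i)<..min t (\<tau> (Suc i))} s :: real)" if "i < n" for i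
      using \<tau>0[of i] that by (auto simp: indicator_def)
    then show "indicator {0<..t} s *\<^sub>R simple_process n \<tau> \<xi> s \<omega> = (\<Sum>i<n. indicator {min t (\<tau> i)<..min t (\<tau> (Suc i))} s *\<^sub>R \<xi> i \<omega>)"
      unfolding simple_process_def scaleR_sum_right scaleR_scaleR by (intro sum.cong) simp_all
  qed (simp add: simple_ito_def)
qed

text \<open>Progressive measurability enters twice: for the measurability of single paths and,
  through Tonelli, for that of the event where the time integral of the squared error is
  large.\<close>

lemma ito_integral_ito_lim:
  assumes I: "is_ito_integral M F W H t I" and t: "0 \<le> t"
  shows "ito_lim (\<lambda>s \<omega>. indicator {0<..t} s *\<^sub>R H s \<omega>) I"
proof (rule ito_limI)
  have prog: "(\<lambda>(s, \<omega>). H s \<omega>) \<in> borel_measurable (restrict_space borel {0..t} \<Otimes>\<^sub>M F t)"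
    using I t by (simp add: is_ito_integral_def progressive_def)
  have Im[measurable]: "I \<in> borel_measurable M" using I by (simp add: is_ito_integral_def)
  {
    fix \<omega> assume "\<omega> \<in> space M"
    then have "(\<lambda>s. H s \<omega>) \<in> borel_measurable (restrict_space borel {0..t})"
      using measurable_Pair1[OF prog, of \<omega>] by simp
    then have "(\<lambda>s. indicator {0..t} s *\<^sub>R H s \<omega>) \<in> borel_measurable borel"
      by (subst (asm) borel_measurable_restrict_space_iff) auto
    then have "(\<lambda>s. indicator {0<..t} s *\<^sub>R (indicator {0..t} s *\<^sub>R H s \<omega>)) \<in> borel_measurable borel"
      by (rule borel_measurable_scaleR[rotated]) simp
    moreover have "(\<lambda>s. indicator {0<..t} s *\<^sub>R (indicator {0..t} s *\<^sub>R H s \<omega>)) = (\<lambda>s. indicator {0<..t} s *\<^sub>R H s \<omega>)"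
      by (auto simp: indicator_def fun_eq_iff)
    ultimately show "(\<lambda>s. indicator {0<..t} s *\<^sub>R H s \<omega>) \<in> borel_measurable borel"
      by simp
  }
  have HM: "(\<lambda>(\<omega>, s). H s \<omega>) \<in> borel_measurable (M \<Otimes>\<^sub>M restrict_space lborel {0..t})"
  proof -
    have "(\<lambda>x. x) \<in> measurable M (F t)" by (rule measurable_F_M[of _ t]) simp
    then have "fst \<in> measurable (M \<Otimes>\<^sub>M restrict_space lborel {0..t}) (F t)"
      using measurable_compose[OF measurable_fst] by auto
    moreover have "snd \<in> measurable (M \<Otimes>\<^sub>M restrict_space lborel {0..t}) (restrict_space borel {0..t})"
    proof -
      have "sets (restrict_space lborel {0..t}) = sets (restrict_space borel {0..t} :: real measure)"
        by (intro sets_restrict_space_cong) simp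
      then have "measurable (M \<Otimes>\<^sub>M restrict_space lborel {0..t}) (restrict_space lborel {0..t}) = measurable (M \<Otimes>\<^sub>M restrict_space lborel {0..t}) (restrict_space borel {0..t} :: real measure)"
        by (intro measurable_cong_sets) auto
      then show ?thesis using measurable_snd by auto
    qed
    ultimately have "(\<lambda>p. (snd p, fst p)) \<in> measurable (M \<Otimes>\<^sub>M restrict_space lborel {0..t}) (restrict_space borel {0..t} \<Otimes>\<^sub>M F t)"
      by measurable
    from measurable_compose[OF this prog] show ?thesis by (simp add: case_prod_beta')
  qed
  fix e :: real assume e: "e > 0"
  obtain n \<tau> \<xi> where S: "\<And>k. simple_integrand M F (n k) (\<tau> k) (\<xi> k)" and
    l1: "(\<lambda>k. measure M {\<omega>\<in>space M.
             (\<integral>\<^sup>+s\<in>{0..t}. ennreal ((norm (H s \<omega> - simple_process (n k) (\<tau> k) (\<xi> k) s \<omega>))\<^sup>2) \<partial>lborel)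
               > ennreal e}) \<longlonglongrightarrow> 0" and
    l2: "(\<lambda>k. measure M {\<omega>\<in>space M. norm (simple_ito W (n k) (\<tau> k) (\<xi> k) t \<omega> - I \<omega>) > e}) \<longlonglongrightarrow> 0"
    using I e unfolding is_ito_integral_def by blast
  have "eventually (\<lambda>k. measure M {\<omega>\<in>space M.
             (\<integral>\<^sup>+s\<in>{0..t}. ennreal ((norm (H s \<omega> - simple_process (n k) (\<tau> k) (\<xi> k) s \<omega>))\<^sup>2) \<partial>lborel)
               > ennreal e} < e/2 \<and> measure M {\<omega>\<in>space M. norm (simple_ito W (n k) (\<tau> k) (\<xi> k) t \<omega> - I \<omega>) > e} < e/2) sequentially"
    using order_tendstoD(2)[OF l1, of "e/2"] order_tendstoD(2)[OF l2, of "e/2"] e by (intro eventually_conj) auto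
  then obtain k where k: "measure M {\<omega>\<in>space M.
             (\<integral>\<^sup>+s\<in>{0..t}. ennreal ((norm (H s \<omega> - simple_process (n k) (\<tau> k) (\<xi> k) s \<omega>))\<^sup>2) \<partial>lborel)
               > ennreal e} < e/2" "measure M {\<omega>\<in>space M. norm (simple_ito W (n k) (\<tau> k) (\<xi> k) t \<omega> - I \<omega>) > e} < e/2"
    by (auto simp: eventually_sequentially)
  let ?S = "simple_process (n k) (\<tau> k) (\<xi> k)" and ?Y = "simple_ito W (n k) (\<tau> k) (\<xi> k) t"
  define N1 where "N1 = {\<omega>\<in>space M. (\<integral>\<^sup>+s\<in>{0..t}. ennreal ((norm (H s \<omega> - ?S s \<omega>))\<^sup>2) \<partial>lborel) > ennreal e}"
  define N2 where "N2 = {\<omega>\<in>space M. norm (?Y \<omega> - I \<omega>) > e}"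
  note el = simple_elem[OF S[of k] t]
  note [measurable] = elem_integral_measurable[OF el]
  have N2m: "N2 \<in> sets M" unfolding N2_def by measurable
  have SM: "(\<lambda>(\<omega>, s). ?S s \<omega>) \<in> borel_measurable (M \<Otimes>\<^sub>M restrict_space lborel {0..t})"
  proof -
    have "(\<lambda>p. indicator {\<tau> k i<..\<tau> k (Suc i)} (snd p) *\<^sub>R \<xi> k i (fst p)) \<in> borel_measurable (M \<Otimes>\<^sub>M restrict_space lborel {0..t})" if "i < n k" for i
    proof -
      have [measurable]: "\<xi> k i \<in> borel_measurable M"
        by (rule measurable_F_M[of _ "\<tau> k i"]) (use S[of k] that in \<open>simp add: simple_integrand_def\<close>)
      have [measurable]: "(\<lambda>s. indicator {\<tau> k i<..\<tau> k (Suc i)} s :: real) \<in> borel_measurable (restrict_space lborel {0..t})"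
        by (intro measurable_restrict_space1) measurable
      show ?thesis by measurable
    qed
    then show ?thesis unfolding simple_process_def case_prod_beta' by (intro borel_measurable_sum) auto
  qed
  have N1m: "N1 \<in> sets M"
  proof -
    have sf: "sigma_finite_measure (restrict_space lborel {0..t} :: real measure)"
      by (rule sigma_finite_measure_restrict_space) (auto intro: sigma_finite_lborel)
    have "(\<lambda>(\<omega>, s). ennreal ((norm (H s \<omega> - ?S s \<omega>))\<^sup>2)) \<in> borel_measurable (M \<Otimes>\<^sub>M restrict_space lborel {0..t})"
      using HM SM unfolding case_prod_beta' by measurable
    from sigma_finite_measure.borel_measurable_nn_integral[OF sf this]
    have "(\<lambda>\<omega>. \<integral>\<^sup>+s\<in>{0..t}. ennreal ((norm (H s \<omega> - ?S s \<omega>))\<^sup>2) \<partial>lborel) \<in> borel_measurable M"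
      by (subst (asm) nn_integral_restrict_space) auto
    then show ?thesis unfolding N1_def by measurable
  qed
  show "\<exists>E Y N. elem_approx (\<lambda>s \<omega>. indicator {0<..t} s *\<^sub>R H s \<omega>) I e E Y N"
  proof (intro exI, rule elem_approxI)
    show "elem (\<lambda>s \<omega>. indicator {0<..t} s *\<^sub>R ?S s \<omega>) ?Y" by (rule el)
    show "N1 \<union> N2 \<in> sets M" using N1m N2m by auto
    show "measure M (N1 \<union> N2) \<le> e"
      using measure_Un_le[OF N1m N2m] k unfolding N1_def[symmetric] N2_def[symmetric] by linarith
    fix \<omega> assume \<omega>: "\<omega> \<in> space M - (N1 \<union> N2)"
    have "(\<integral>\<^sup>+s. ennreal ((norm (indicator {0<..t} s *\<^sub>R H s \<omega> - indicator {0<..t} s *\<^sub>R ?S s \<omega>))\<^sup>2) \<partial>lborel)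
      \<le> (\<integral>\<^sup>+s\<in>{0..t}. ennreal ((norm (H s \<omega> - ?S s \<omega>))\<^sup>2) \<partial>lborel)"
      by (intro nn_integral_mono) (auto simp: indicator_def)
    also have "\<dots> \<le> ennreal e" using \<omega> by (auto simp: N1_def)
    finally show "(\<integral>\<^sup>+s. ennreal ((norm (indicator {0<..t} s *\<^sub>R H s \<omega> - indicator {0<..t} s *\<^sub>R ?S s \<omega>))\<^sup>2) \<partial>lborel) \<le> ennreal e" .
    show "norm (I \<omega> - ?Y \<omega>) \<le> e" using \<omega> by (auto simp: N2_def norm_minus_commute)
  qed
qed

end

section \<open>The diffusion matrix\<close>

lemma norm_outer: "norm (outer a b) = norm a * norm b"
proof -
  have "norm (outer a b) = L2_set (\<lambda>i. \<bar>a $ i\<bar> * norm b) UNIV"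
    unfolding norm_vec_def[of "outer a b"] outer_def
    by (simp add: norm_vec_def[of b] norm_vec_def L2_set_right_distrib[symmetric] abs_mult)
  also have "\<dots> = norm a * norm b"
    by (simp add: norm_vec_def[of a] L2_set_left_distrib[symmetric])
  finally show ?thesis .
qed

lemma outer_mult_vector: "outer a b *v x = (b \<bullet> x) *\<^sub>R a"
  by (simp add: vec_eq_iff outer_def matrix_vector_mult_def inner_vec_def sum_distrib_left mult_ac)

text \<open>At \<open>0\<close> the junk value \<open>1 / 0 = 0\<close> provides the continuous extension.\<close>

lemma outer_normalized_lipschitz:
  "norm ((1 / norm a) *\<^sub>R outer a a - (1 / norm b) *\<^sub>R outer b b) \<le> 3 * norm (a - b)"
proof (cases "a = 0 \<or> b = 0")
  case True
  moreover have "outer 0 0 = 0" using norm_outer[of 0 0] by simp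
  ultimately show ?thesis by (auto simp: norm_outer)
next
  case False
  let ?u = "(1 / norm a) *\<^sub>R a" and ?v = "(1 / norm b) *\<^sub>R b"
  \<comment> \<open>The terms are \<open>outer ?u a\<close> and \<open>outer ?v b\<close> with unit
    vectors \<open>?u\<close> and \<open>?v\<close>; the difference is split as in the product
    rule.\<close>
  have eq: "(1 / norm a) *\<^sub>R outer a a - (1 / norm b) *\<^sub>R outer b b = outer ?u (a - b) + outer (?u - ?v) b"
    by (simp add: vec_eq_iff outer_def algebra_simps)
  have "norm (outer ?u (a - b)) = norm (a - b)"
    using False by (simp add: norm_outer)
  moreover have "norm (outer (?u - ?v) b) \<le> 2 * norm (a - b)"
  proof -
    have "norm (outer (?u - ?v) b) = norm (norm b *\<^sub>R (?u - ?v))"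
      by (simp add: norm_outer mult.commute)
    \<comment> \<open>The direction of a vector is not Lipschitz near 0, but the weight
      \<open>norm b\<close> compensates for it.\<close>
    also have "norm b *\<^sub>R (?u - ?v) = (norm b - norm a) *\<^sub>R ?u + (a - b)"
      using False by (simp add: algebra_simps)
    also have "norm \<dots> \<le> \<bar>norm b - norm a\<bar> * norm ?u + norm (a - b)"
      by (metis norm_scaleR norm_triangle_ineq)
    also have "\<dots> \<le> norm (a - b) + norm (a - b)"
      using False norm_triangle_ineq3[of b a] by (simp add: norm_minus_commute)
    finally show ?thesis by simp
  qed
  ultimately show ?thesis
    unfolding eq using norm_triangle_ineq[of "outer ?u (a - b)" "outer (?u - ?v) b"] by linarith
qed

text \<open>\<open>p * norm b\<close> and \<open>q * norm b\<close> are the eigenvalues along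
  \<open>b\<close> and orthogonal to it. With the isotropic part split off, the normalized tensor is
  the only term whose Lipschitz continuity needs an argument.\<close>

lemma diffusion_matrix_eq:
  fixes b :: "real^3"
  defines "p \<equiv> sqrt (8 * pi * ln 2) / sqrt 15" and "q \<equiv> 4 * sqrt (pi * ln 2) / sqrt 15"
  shows "diffusion_matrix b = q *\<^sub>R (norm b *\<^sub>R mat 1) + (p - q) *\<^sub>R ((1 / norm b) *\<^sub>R outer b b)"
proof (cases "b = 0")
  case True
  then show ?thesis by (simp add: diffusion_matrix_def)
next
  case False
  have "norm b * (1 / (norm b)\<^sup>2) = 1 / norm b" using False by (simp add: power2_eq_square)
  then show ?thesis
    using False unfolding diffusion_matrix_def p_def q_def
    by (simp add: algebra_simps power2_eq_square)
qed

text \<open>Condenses the matrix to what the growth argument uses; \<open>c\<close> is the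
  coefficient \<open>p\<close> of the eigenvalue along \<open>b\<close>.\<close>

lemma diffusion_matrix_props:
  "\<exists>c>0. \<exists>L>0. (\<forall>a b. norm (diffusion_matrix a - diffusion_matrix b) \<le> L * norm (a - b)) \<and>
     (\<forall>b x. b \<bullet> (diffusion_matrix b *v x) = c * norm b * (b \<bullet> x))"
proof -
  define p where "p = sqrt (8 * pi * ln 2) / sqrt 15"
  define q where "q = 4 * sqrt (pi * ln 2) / sqrt 15"
  note eq = diffusion_matrix_eq[folded p_def q_def]
  have "p > 0" by (simp add: p_def)
  \<comment> \<open>The summand 1 makes positivity immediate.\<close>
  define L where "L = \<bar>q\<bar> * norm (mat 1 :: real^3^3) + \<bar>p - q\<bar> * 3 + 1"
  have "L > 0" by (simp add: L_def add_nonneg_pos)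
  have lip: "norm (diffusion_matrix a - diffusion_matrix b) \<le> L * norm (a - b)" for a b
  proof -
    have "diffusion_matrix a - diffusion_matrix b = q *\<^sub>R ((norm a - norm b) *\<^sub>R mat 1)
        + (p - q) *\<^sub>R ((1 / norm a) *\<^sub>R outer a a - (1 / norm b) *\<^sub>R outer b b)"
      unfolding eq by (simp only: scaleR_diff_right scaleR_diff_left) simp
    also have "norm \<dots> \<le> \<bar>q\<bar> * (\<bar>norm a - norm b\<bar> * norm (mat 1 :: real^3^3))
        + \<bar>p - q\<bar> * norm ((1 / norm a) *\<^sub>R outer a a - (1 / norm b) *\<^sub>R outer b b)"
      by (rule order_trans[OF norm_triangle_ineq]) (simp add: abs_mult)
    also have "\<dots> \<le> \<bar>q\<bar> * (norm (a - b) * norm (mat 1 :: real^3^3)) + \<bar>p - q\<bar> * (3 * norm (a - b))"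
      by (intro add_mono mult_left_mono mult_right_mono outer_normalized_lipschitz norm_triangle_ineq3) auto
    also have "\<dots> \<le> L * norm (a - b)"
      by (simp add: L_def algebra_simps)
    finally show ?thesis .
  qed
  have rad: "b \<bullet> (diffusion_matrix b *v x) = p * norm b * (b \<bullet> x)" for b x
  proof (cases "b = 0")
    case False
    have "diffusion_matrix b *v x = (q * norm b) *\<^sub>R x + ((p - q) * (1 / norm b) * (b \<bullet> x)) *\<^sub>R b"
      unfolding eq by (simp add: matrix_vector_mult_add_rdistrib scaleR_matrix_vector_assoc[symmetric] outer_mult_vector)
    then have "b \<bullet> (diffusion_matrix b *v x) = q * norm b * (b \<bullet> x) + (p - q) * (1 / norm b) * (b \<bullet> x) * (norm b)\<^sup>2"
      by (simp add: inner_add_right power2_norm_eq_inner)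
    also have "\<dots> = p * norm b * (b \<bullet> x)"
      using False by (simp add: field_simps power2_eq_square)
    finally show ?thesis .
  qed simp
  show ?thesis using \<open>p > 0\<close> \<open>L > 0\<close> lip rad by blast
qed

section \<open>Growth of solutions of radial equations\<close>

text \<open>Uniform continuity holds path by path with a mesh depending on the path; discarding an
  event of small probability leaves one mesh that works for all remaining paths. The bad event is
  formed over rational positions in a cell, which keeps it measurable, and continuity extends the
  bound to the closed cell.\<close>

lemma (in prob_space) continuous_paths_grid_modulus:
  fixes X :: "real \<Rightarrow> 'a \<Rightarrow> 'b::euclidean_space"
  assumes X: "\<And>r. 0 \<le> r \<Longrightarrow> X r \<in> borel_measurable M"
    and cont: "\<And>\<omega>. \<omega> \<in> space M \<Longrightarrow> continuous_on {0..} (\<lambda>r. X r \<omega>)"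
    and sh: "0 \<le> s" "0 < h" and d: "0 < d" and \<eta>: "0 < \<eta>"
  shows "\<exists>m>0. \<exists>N\<in>sets M. measure M N \<le> \<eta> \<and> (\<forall>\<omega>\<in>space M - N. \<forall>i<m. \<forall>x\<in>{0..1}.
     norm (X (s + (real i + x) * (h / real m)) \<omega> - X (s + real i * (h / real m)) \<omega>) \<le> d)"
proof -
  define Q where "Q = {0<..<1::real} \<inter> \<rat>"
  have Q: "countable Q" unfolding Q_def using countable_rat by auto
  have clQ: "closure Q = {0..1}"
    unfolding Q_def by (subst closure_open_Int_superset) (auto simp: Rats_closure_real)
  define f where "f m i x \<omega> = norm (X (s + (real i + x) * (h / real m)) \<omega> - X (s + real i * (h / real m)) \<omega>)" for m i x \<omega>
  define B where "B m = (\<Union>i\<in>{..<m}. \<Union>x\<in>Q. {\<omega>\<in>space M. f m i x \<omega> > d})" for m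
  \<comment> \<open>Failure on some mesh from \<open>k\<close> on, so that the events decrease.
    Their intersection is empty because each path is uniformly continuous on the compact
    interval.\<close>
  define B' where "B' k = (\<Union>m\<in>{k..}. B m)" for k
  have B: "B m \<in> sets M" for m
  proof -
    have "{\<omega>\<in>space M. f m i x \<omega> > d} \<in> sets M" if "x \<in> Q" for i x
    proof -
      have [measurable]: "X (s + (real i + x) * (h / real m)) \<in> borel_measurable M" "X (s + real i * (h / real m)) \<in> borel_measurable M"
        using that sh by (auto simp: Q_def intro!: X add_nonneg_nonneg mult_nonneg_nonneg)
      show ?thesis unfolding f_def by measurable
    qed
    then show ?thesis unfolding B_def using Q by (intro sets.finite_UN sets.countable_UN'') auto
  qed
  then have B'm: "range B' \<subseteq> sets M" unfolding B'_def by (auto intro!: sets.countable_UN'')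
  have dec: "decseq B'" unfolding B'_def decseq_def by (auto intro: order_trans)
  have "(\<Inter>k. B' k) = {}"
  proof (rule ccontr)
    assume "(\<Inter>k. B' k) \<noteq> {}"
    then obtain \<omega> where \<omega>: "\<And>k. \<omega> \<in> B' k" by auto
    then have sp: "\<omega> \<in> space M" by (auto simp: B'_def B_def)
    have "uniformly_continuous_on {s..s+h} (\<lambda>r. X r \<omega>)"
      using sh by (intro compact_uniformly_continuous continuous_on_subset[OF cont[OF sp]]) auto
    then obtain \<delta> where \<delta>: "\<delta> > 0" "\<And>r r'. r \<in> {s..s+h} \<Longrightarrow> r' \<in> {s..s+h} \<Longrightarrow> dist r' r < \<delta> \<Longrightarrow> dist (X r' \<omega>) (X r \<omega>) < d"
      using d unfolding uniformly_continuous_on_def by metis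
    obtain k where k: "h / \<delta> < real k" using reals_Archimedean2 by auto
    obtain m i x where m: "k \<le> m" "i < m" "x \<in> Q" "f m i x \<omega> > d"
      using \<omega>[of k] by (auto simp: B'_def B_def)
    have m0: "real m > 0" using m by auto
    have x: "0 < x" "x < 1" using m by (auto simp: Q_def)
    have hm: "h / real m < \<delta>"
    proof -
      have "h / \<delta> < real m" using k m by linarith
      then show ?thesis using m0 \<delta>(1) by (simp add: field_simps)
    qed
    have le: "(real i + y) * (h / real m) \<le> h" if "y \<le> 1" for y
    proof -
      have "(real i + y) * (h / real m) \<le> real m * (h / real m)"
        using that m(2) sh by (intro mult_right_mono) auto
      then show ?thesis using m0 by simp
    qed
    have "x * (h / real m) < \<delta>"
      using hm x sh m0 mult_strict_right_mono[of x 1 "h / real m"] by simp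
    then have "dist (X (s + (real i + x) * (h / real m)) \<omega>) (X (s + real i * (h / real m)) \<omega>) < d"
    proof (intro \<delta>(2))
      have "s + (real i + x) * (h / real m) - (s + real i * (h / real m)) = x * (h / real m)"
        by algebra
      then show "dist (s + (real i + x) * (h / real m)) (s + real i * (h / real m)) < \<delta>"
        using \<open>x * (h / real m) < \<delta>\<close> x sh by (simp add: dist_real_def)
      show "s + (real i + x) * (h / real m) \<in> {s..s + h}" "s + real i * (h / real m) \<in> {s..s + h}"
        using x sh le[of x] le[of 0] by auto
    qed
    then show False using m(4) by (simp add: f_def dist_norm)
  qed
  then have "(\<lambda>k. measure M (B' k)) \<longlonglongrightarrow> 0"
    using finite_Lim_measure_decseq[OF B'm dec] by simp
  then have "eventually (\<lambda>k. measure M (B' k) < \<eta>) sequentially"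
    using \<eta> by (intro order_tendstoD(2))
  then have "eventually (\<lambda>k. measure M (B' k) < \<eta> \<and> 0 < k) sequentially"
    by (intro eventually_conj eventually_gt_at_top)
  then obtain m where m: "measure M (B' m) < \<eta>" "m > 0"
    using eventually_happens'[OF sequentially_bot] by blast
  show ?thesis
  proof (intro exI[of _ m] conjI bexI[of _ "B' m"] ballI allI impI)
    fix \<omega> i x assume \<omega>: "\<omega> \<in> space M - B' m" and i: "i < m" and x: "x \<in> {0..1::real}"
    have "f m i x \<omega> \<le> d"
    proof (rule continuous_le_on_closure[where S=Q and f="\<lambda>x. f m i x \<omega>"])
      have "continuous_on {0..1} ((\<lambda>r. X r \<omega>) \<circ> (\<lambda>x. s + (real i + x) * (h / real m)))"
        using \<omega> sh by (intro continuous_on_compose continuous_intros continuous_on_subset[OF cont[of \<omega>]]) auto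
      then show "continuous_on (closure Q) (\<lambda>x. f m i x \<omega>)"
        unfolding clQ f_def by (intro continuous_intros) (simp_all add: o_def)
      show "x \<in> closure Q" using x clQ by simp
      show "f m i y \<omega> \<le> d" if "y \<in> Q" for y
      proof (rule ccontr)
        assume "\<not> f m i y \<omega> \<le> d"
        then have "d < f m i y \<omega>" by simp
        then have "\<omega> \<in> B m" using i that \<omega> unfolding B_def by (intro UN_I[of i] UN_I[of y]) simp_all
        then show False using \<omega> by (auto simp: B'_def)
      qed
    qed
    then show "norm (X (s + (real i + x) * (h / real m)) \<omega> - X (s + real i * (h / real m)) \<omega>) \<le> d" by (simp add: f_def)
  qed (use m B'm in auto)
qed

context brownian begin

text \<open>The past is split according to the signs of the components of \<open>V\<close>; on each part it suffices that
  every component of the increment has the matching sign and modulus at least \<open>sqrt h\<close>.\<close>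

lemma increment_octant:
  assumes s: "0 \<le> s" and h: "0 < h" and A: "A \<in> sets (F s)" and V: "V \<in> borel_measurable (F s)"
  shows "measure M {\<omega>\<in>A. sqrt h * norm (V \<omega>) \<le> V \<omega> \<bullet> (W (s + h) \<omega> - W s \<omega>)} \<ge> (exp (-2) / sqrt (2 * pi)) ^ 3 * measure M A"
proof -
  define q :: real where "q = (exp (-2) / sqrt (2 * pi)) ^ 3"
  define D where "D \<omega> = W (s + h) \<omega> - W s \<omega>" for \<omega>
  have [measurable]: "W (s + h) \<in> borel_measurable M" "W s \<in> borel_measurable M" using W_measurable s h by auto
  have Dm[measurable]: "D \<in> borel_measurable M" unfolding D_def by measurable
  have Vk: "(\<lambda>\<omega>. V \<omega> $ i) \<in> borel_measurable (F s)" for i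
    by (rule measurable_compose[OF V]) measurable
  have VM[measurable]: "V \<in> borel_measurable M" by (rule measurable_F_M[OF V])
  have AM[measurable]: "A \<in> sets M" using A sets_F_M by auto
  have Dist: "distributed M lborel D (\<lambda>x. ennreal (\<Prod>i\<in>UNIV. normal_density 0 (sqrt h) (x $ i)))"
    using increment_distributed[of s "s + h"] s h by (simp add: D_def[abs_def])
  define sg where "sg \<sigma> i = (if \<sigma> i then 1 else -1 :: real)" for \<sigma> :: "3 \<Rightarrow> bool" and i
  define B where "B \<sigma> = {\<omega>\<in>A. \<forall>i. (0 \<le> V \<omega> $ i) = \<sigma> i}" for \<sigma>
  define O' where "O' \<sigma> = {x :: real^3. \<forall>i. sg \<sigma> i * x $ i \<ge> sqrt h}" for \<sigma>
  define C where "C \<sigma> = B \<sigma> \<inter> (D -` O' \<sigma> \<inter> space M)" for \<sigma>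
  have BF: "B \<sigma> \<in> sets (F s)" for \<sigma>
  proof -
    have "{\<omega> \<in> space (F s). \<forall>i\<in>UNIV. (0 \<le> V \<omega> $ i) = \<sigma> i} \<in> sets (F s)"
    proof (rule sets.sets_Collect_finite_All)
      fix i :: 3
      have "{\<omega> \<in> space (F s). 0 \<le> V \<omega> $ i} \<in> sets (F s)" using Vk[of i] by measurable
      moreover have "{\<omega> \<in> space (F s). \<not> 0 \<le> V \<omega> $ i} \<in> sets (F s)" using Vk[of i] by measurable
      ultimately show "{\<omega> \<in> space (F s). (0 \<le> V \<omega> $ i) = \<sigma> i} \<in> sets (F s)" by (cases "\<sigma> i") simp_all
    qed simp
    then have "A \<inter> {\<omega> \<in> space (F s). \<forall>i\<in>UNIV. (0 \<le> V \<omega> $ i) = \<sigma> i} \<in> sets (F s)" using A by blast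
    moreover have "A \<inter> {\<omega> \<in> space (F s). \<forall>i\<in>UNIV. (0 \<le> V \<omega> $ i) = \<sigma> i} = B \<sigma>"
      unfolding B_def using sets.sets_into_space[OF A] by auto
    ultimately show ?thesis by simp
  qed
  have BM: "B \<sigma> \<in> sets M" for \<sigma> using BF sets_F_M by blast
  have Om[measurable]: "O' \<sigma> \<in> sets borel" for \<sigma>
  proof -
    have "closed (\<Inter>i. {x :: real^3. sg \<sigma> i * x $ i \<ge> sqrt h})"
      by (intro closed_INT ballI closed_Collect_le continuous_intros)
    moreover have "(\<Inter>i. {x :: real^3. sg \<sigma> i * x $ i \<ge> sqrt h}) = O' \<sigma>" by (auto simp: O'_def)
    ultimately show ?thesis by auto
  qed
  have CM: "C \<sigma> \<in> sets M" for \<sigma> unfolding C_def using BM Om by (intro sets.Int measurable_sets[OF Dm]) auto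
  have disj: "disjoint_family_on B UNIV"
    unfolding disjoint_family_on_def
  proof (intro ballI impI)
    fix \<sigma> \<sigma>' :: "3 \<Rightarrow> bool" assume "\<sigma> \<noteq> \<sigma>'"
    then obtain i where "\<sigma> i \<noteq> \<sigma>' i" by auto
    then show "B \<sigma> \<inter> B \<sigma>' = {}" unfolding B_def by blast
  qed
  have PC: "measure M (C \<sigma>) \<ge> q * measure M (B \<sigma>)" for \<sigma>
  proof -
    have "measure M (C \<sigma>) = measure M (B \<sigma>) * measure M (D -` O' \<sigma> \<inter> space M)"
      unfolding C_def
    proof (rule indep_setD[OF increment_indep_set[of s "s + h"] BF])
      show "D -` O' \<sigma> \<inter> space M \<in> {(\<lambda>\<omega>. W (s + h) \<omega> - W s \<omega>) -` B \<inter> space M |B. B \<in> sets borel}"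
        unfolding D_def[abs_def] using Om by blast
    qed (use s h in auto)
    moreover have "D -` O' \<sigma> \<inter> space M = {\<omega>\<in>space M. \<forall>i. sg \<sigma> i * D \<omega> $ i \<ge> sqrt h}"
      by (auto simp: O'_def)
    moreover have "ennreal q \<le> emeasure M {\<omega>\<in>space M. \<forall>i. sg \<sigma> i * D \<omega> $ i \<ge> sqrt h}"
      using normal_prod_octant_box[OF Dist, of "sg \<sigma>"] h by (simp add: q_def sg_def)
    then have "q \<le> measure M {\<omega>\<in>space M. \<forall>i. sg \<sigma> i * D \<omega> $ i \<ge> sqrt h}"
      by (simp add: emeasure_eq_measure)
    then have "q * measure M (B \<sigma>) \<le> measure M {\<omega>\<in>space M. \<forall>i. sg \<sigma> i * D \<omega> $ i \<ge> sqrt h} * measure M (B \<sigma>)"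
      by (rule mult_right_mono) simp
    ultimately show ?thesis by (simp add: mult.commute)
  qed
  have "q * measure M A = q * (\<Sum>\<sigma>\<in>UNIV. measure M (B \<sigma>))"
  proof -
    have "\<omega> \<in> B (\<lambda>i. 0 \<le> V \<omega> $ i)" if "\<omega> \<in> A" for \<omega> using that by (simp add: B_def)
    moreover have "B \<sigma> \<subseteq> A" for \<sigma> by (simp add: B_def)
    ultimately have "A = (\<Union>\<sigma>\<in>UNIV. B \<sigma>)" by blast
    moreover have "measure M (\<Union>\<sigma>\<in>UNIV. B \<sigma>) = (\<Sum>\<sigma>\<in>UNIV. measure M (B \<sigma>))"
      using BM disj by (intro finite_measure_finite_Union) auto
    ultimately show ?thesis by simp
  qed
  also have "\<dots> \<le> (\<Sum>\<sigma>\<in>UNIV. measure M (C \<sigma>))"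
    unfolding sum_distrib_left by (intro sum_mono PC)
  also have "\<dots> = measure M (\<Union>\<sigma>\<in>UNIV. C \<sigma>)"
  proof (rule finite_measure_finite_Union[symmetric])
    show "disjoint_family_on C UNIV"
      using disj unfolding disjoint_family_on_def C_def by blast
  qed (use CM in auto)
  also have "\<dots> \<le> measure M {\<omega>\<in>A. sqrt h * norm (V \<omega>) \<le> V \<omega> \<bullet> D \<omega>}"
  proof (rule finite_measure_mono)
    show "(\<Union>\<sigma>\<in>UNIV. C \<sigma>) \<subseteq> {\<omega>\<in>A. sqrt h * norm (V \<omega>) \<le> V \<omega> \<bullet> D \<omega>}"
    proof (intro subsetI CollectI conjI)
      fix \<omega> assume "\<omega> \<in> (\<Union>\<sigma>\<in>UNIV. C \<sigma>)"
      then obtain \<sigma> where \<omega>: "\<omega> \<in> A" "\<And>i. (0 \<le> V \<omega> $ i) = \<sigma> i" "\<And>i. sg \<sigma> i * D \<omega> $ i \<ge> sqrt h"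
        by (auto simp: C_def B_def O'_def)
      show "\<omega> \<in> A" by fact
      \<comment> \<open>Components of modulus at least \<open>sqrt h\<close> with matching signs
        pair with \<open>V\<close> to at least \<open>sqrt h\<close> times its l1 norm, which
        dominates the Euclidean norm.\<close>
      have "sqrt h * norm (V \<omega>) \<le> sqrt h * (\<Sum>i\<in>UNIV. \<bar>V \<omega> $ i\<bar>)"
        using h by (intro mult_left_mono norm_le_l1_cart) auto
      also have "\<dots> \<le> (\<Sum>i\<in>UNIV. V \<omega> $ i * D \<omega> $ i)"
        unfolding sum_distrib_left
      proof (rule sum_mono)
        fix i :: 3
        have "sqrt h * \<bar>V \<omega> $ i\<bar> \<le> sg \<sigma> i * D \<omega> $ i * \<bar>V \<omega> $ i\<bar>"
          using \<omega>(3)[of i] by (intro mult_right_mono) auto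
        also have "\<dots> = V \<omega> $ i * D \<omega> $ i"
          using \<omega>(2)[of i] by (auto simp: sg_def)
        finally show "sqrt h * \<bar>V \<omega> $ i\<bar> \<le> V \<omega> $ i * D \<omega> $ i" .
      qed
      finally show "sqrt h * norm (V \<omega>) \<le> V \<omega> \<bullet> D \<omega>" by (simp add: inner_vec_def)
    qed
    have "A \<inter> {\<omega>\<in>space M. sqrt h * norm (V \<omega>) \<le> V \<omega> \<bullet> D \<omega>} \<in> sets M" by measurable
    moreover have "A \<inter> {\<omega>\<in>space M. sqrt h * norm (V \<omega>) \<le> V \<omega> \<bullet> D \<omega>} = {\<omega>\<in>A. sqrt h * norm (V \<omega>) \<le> V \<omega> \<bullet> D \<omega>}"
      using sets.sets_into_space[OF AM] by auto
    ultimately show "{\<omega>\<in>A. sqrt h * norm (V \<omega>) \<le> V \<omega> \<bullet> D \<omega>} \<in> sets M" by simp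
  qed
  finally show ?thesis by (simp add: q_def D_def)
qed

end

lemma sq_integral_interval_bound:
  assumes f: "\<And>r. norm (f r) \<le> K * indicator {s<..s + h} r" and h: "0 \<le> h"
  shows "(\<integral>\<^sup>+r. ennreal ((norm (f r))\<^sup>2) \<partial>lborel) \<le> ennreal (K\<^sup>2 * h)"
proof -
  have "(\<integral>\<^sup>+r. ennreal ((norm (f r))\<^sup>2) \<partial>lborel) \<le> (\<integral>\<^sup>+r. ennreal (K\<^sup>2) * indicator {s<..s + h} r \<partial>lborel)"
  proof (rule nn_integral_mono)
    fix r
    have "(norm (f r))\<^sup>2 \<le> (K * indicator {s<..s + h} r)\<^sup>2" by (intro power_mono f) simp
    then show "ennreal ((norm (f r))\<^sup>2) \<le> ennreal (K\<^sup>2) * indicator {s<..s + h} r"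
      by (cases "r \<in> {s<..s + h}") (auto intro: ennreal_leI)
  qed
  also have "\<dots> = ennreal (K\<^sup>2 * h)" using h by (simp add: nn_integral_cmult_indicator ennreal_mult)
  finally show ?thesis .
qed

text \<open>Lipschitz continuity together with \<open>\<sigma> 0 = 0\<close> bounds the coefficient
  linearly, so that all errors scale with the norm of the solution; the radial identity quantifies
  the outward push of an increment.\<close>

locale radial_sde = brownian M F W
  for M :: "'a measure" and F :: "real \<Rightarrow> 'a measure" and W :: "real \<Rightarrow> 'a \<Rightarrow> real^3" +
  fixes \<sigma> :: "real^3 \<Rightarrow> real^3^3" and c L :: real
  assumes c_pos: "0 < c" and L_pos: "0 < L"
    and lipschitz: "norm (\<sigma> x - \<sigma> y) \<le> L * norm (x - y)"
    and \<sigma>_zero: "\<sigma> 0 = 0"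
    and radial: "x \<bullet> (\<sigma> x *v v) = c * norm x * (x \<bullet> v)"
begin

lemma \<sigma>_norm: "norm (\<sigma> x) \<le> L * norm x"
  using lipschitz[of x 0] by (simp add: \<sigma>_zero)

lemma \<sigma>_measurable[measurable]: "\<sigma> \<in> borel_measurable borel"
proof (rule borel_measurable_continuous_onI)
  have "L-lipschitz_on UNIV \<sigma>"
    by (rule lipschitz_onI) (use L_pos in \<open>auto simp: dist_norm lipschitz\<close>)
  then show "continuous_on UNIV \<sigma>" by (rule lipschitz_on_continuous_on)
qed

definition solves :: "real^3 \<Rightarrow> (real \<Rightarrow> 'a \<Rightarrow> real^3) \<Rightarrow> bool" where
  "solves \<nu> X \<longleftrightarrow> continuous_adapted M F X \<and> (AE \<omega> in M. X 0 \<omega> = \<nu>) \<and>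
     (\<forall>t\<ge>0. is_ito_integral M F W (\<lambda>s \<omega>. \<sigma> (X s \<omega>)) t (\<lambda>\<omega>. X t \<omega> - \<nu>))"

context
  fixes \<nu> :: "real^3" and X :: "real \<Rightarrow> 'a \<Rightarrow> real^3"
  assumes X: "solves \<nu> X"
begin

lemma X_adapted: "0 \<le> s \<Longrightarrow> s \<le> t \<Longrightarrow> X s \<in> borel_measurable (F t)"
  using X measurable_F_mono[of "X s" s borel t] unfolding solves_def continuous_adapted_def by blast

lemma X_measurable: "0 \<le> s \<Longrightarrow> X s \<in> borel_measurable M"
  by (rule measurable_F_M[OF X_adapted[OF _ order_refl]])

lemma X_continuous: "\<omega> \<in> space M \<Longrightarrow> continuous_on {0..} (\<lambda>r. X r \<omega>)"
  using X unfolding solves_def continuous_adapted_def by blast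

lemma increment_ito:
  assumes "0 \<le> s" "s \<le> u"
  shows "ito_lim (\<lambda>r \<omega>. indicator {s<..u} r *\<^sub>R \<sigma> (X r \<omega>)) (\<lambda>\<omega>. X u \<omega> - X s \<omega>)"
proof -
  have "ito_lim (\<lambda>r \<omega>. indicator {0<..t} r *\<^sub>R \<sigma> (X r \<omega>)) (\<lambda>\<omega>. X t \<omega> - \<nu>)" if "0 \<le> t" for t
    using X that unfolding solves_def by (intro ito_integral_ito_lim) auto
  from ito_lim_diff[OF this[of u] this[of s]] show ?thesis
    by (rule ito_lim_cong) (use assms in \<open>auto simp: indicator_def\<close>)
qed

text \<open>Used with weights that equal the inverse norm of an earlier position on a past event and
  0 elsewhere.\<close>

lemma weighted_increment_ito:
  assumes s: "0 \<le> s" "s \<le> u" and Z: "Z \<in> borel_measurable (F s)" "\<And>\<omega>. \<omega> \<in> space M \<Longrightarrow> \<bar>Z \<omega>\<bar> \<le> B"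
  shows "ito_lim (\<lambda>r \<omega>. Z \<omega> *\<^sub>R (indicator {s<..u} r *\<^sub>R \<sigma> (X r \<omega>))) (\<lambda>\<omega>. Z \<omega> *\<^sub>R (X u \<omega> - X s \<omega>))"
  by (rule ito_lim_restrict[OF increment_ito[OF s] s(1) _ Z]) simp

section \<open>One time step from a past event on which the norm is bounded below\<close>

context
  fixes s h \<rho> \<theta> :: real and A :: "'a set"
  assumes s: "0 \<le> s" and h: "0 < h" and A: "A \<in> sets (F s)"
    and \<rho>: "0 < \<rho>" "\<And>\<omega>. \<omega> \<in> A \<Longrightarrow> \<rho> \<le> norm (X s \<omega>)" and \<theta>: "0 < \<theta>" "\<theta> \<le> 1"
begin

lemma past_event_in_space: "\<omega> \<in> A \<Longrightarrow> \<omega> \<in> space M"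
  using sets.sets_into_space[OF A] by auto

lemma past_event_measurable: "A \<in> sets M"
  using A sets_F_M by blast

text \<open>The exit from the ball of radius \<open>\<theta>|X s|\<close> around \<open>X s\<close> is detected along a fine grid: the
  increments stopped at the first grid exit form an Ito integral of a process of size at most
  \<open>3 L |X s|\<close>, except on the event that the path oscillates inside a grid cell.\<close>

lemma deviation:
  assumes \<kappa>: "0 < \<kappa>"
  shows "\<exists>N\<in>sets M. measure M N \<le> 864 * L\<^sup>2 * h / \<theta>\<^sup>2 * measure M A + \<kappa> \<and>
     (\<forall>\<omega>\<in>A - N. \<forall>r\<in>{s..s + h}. norm (X r \<omega> - X s \<omega>) \<le> 2 * \<theta> * norm (X s \<omega>))"
proof -
  obtain m N0 where m: "m > 0" and N0: "N0 \<in> sets M" "measure M N0 \<le> \<kappa> / 2" and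
    mod: "\<And>\<omega> i x. \<omega> \<in> space M - N0 \<Longrightarrow> i < m \<Longrightarrow> x \<in> {0..1} \<Longrightarrow>
      norm (X (s + (real i + x) * (h / real m)) \<omega> - X (s + real i * (h / real m)) \<omega>) \<le> \<theta> * \<rho>"
    using continuous_paths_grid_modulus[OF X_measurable X_continuous s h, of "\<theta> * \<rho>" "\<kappa> / 2"] \<theta> \<rho>(1) \<kappa>
    by (force simp: Ball_def)
  define g where "g i = s + real i * (h / real m)" for i
  have hm: "0 < h / real m" using h m by simp
  have g0: "g 0 = s" and gm: "g m = s + h" using m by (simp_all add: g_def)
  have gS: "g (Suc i) = g i + h / real m" for i by (simp add: g_def distrib_right add_divide_distrib)
  have gmono: "g i \<le> g j" if "i \<le> j" for i j
    unfolding g_def using that hm by (intro add_left_mono mult_right_mono) auto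
  have gs: "s \<le> g i" for i using gmono[of 0 i] g0 by simp
  have gnn: "0 \<le> g i" for i using gs[of i] s by simp
  have mod': "norm (X r \<omega> - X (g i) \<omega>) \<le> \<theta> * \<rho>" if "\<omega> \<in> space M - N0" "i < m" "g i \<le> r" "r \<le> g (Suc i)" for \<omega> i r
  proof -
    define x where "x = (r - g i) / (h / real m)"
    have "0 \<le> x" unfolding x_def by (rule divide_nonneg_pos) (use that hm in auto)
    moreover have "x \<le> 1" unfolding x_def by (subst pos_divide_le_eq[OF hm]) (use that gS[of i] in simp)
    ultimately have x: "x \<in> {0..1}" by simp
    have "a / y * y = a" if "0 < y" for a y :: real using that by simp
    from this[OF hm] have "x * (h / real m) = r - g i" unfolding x_def .
    then have "s + (real i + x) * (h / real m) = r"
      using distrib_right[of "real i" x "h / real m"] unfolding g_def by linarith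
    then show ?thesis using mod[OF that(1,2) x] by (simp add: g_def)
  qed
  \<comment> \<open>No grid exit up to index \<open>i\<close>, an event known at time
    \<open>g i\<close>. Weighting the increment over cell \<open>i\<close> with it stops the sum at
    the first exit.\<close>
  define G where "G i = {\<omega>\<in>A. \<forall>j\<in>{..i}. norm (X (g j) \<omega> - X s \<omega>) \<le> \<theta> * norm (X s \<omega>)}" for i
  have Gm: "G i \<in> sets (F (g i))" for i
  proof -
    have "{\<omega>\<in>space (F (g i)). \<forall>j\<in>{..i}. norm (X (g j) \<omega> - X s \<omega>) \<le> \<theta> * norm (X s \<omega>)} \<in> sets (F (g i))"
    proof (rule sets.sets_Collect_finite_All')
      fix j assume "j \<in> {..i}"
      then have [measurable]: "X (g j) \<in> borel_measurable (F (g i))" "X s \<in> borel_measurable (F (g i))"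
        using gmono[of j i] gnn[of j] gs[of i] s by (auto intro!: X_adapted)
      show "{\<omega>\<in>space (F (g i)). norm (X (g j) \<omega> - X s \<omega>) \<le> \<theta> * norm (X s \<omega>)} \<in> sets (F (g i))"
        by measurable
    qed auto
    moreover have "A \<in> sets (F (g i))" using A sets_F_mono[OF gs[of i]] by blast
    ultimately have "A \<inter> {\<omega>\<in>space (F (g i)). \<forall>j\<in>{..i}. norm (X (g j) \<omega> - X s \<omega>) \<le> \<theta> * norm (X s \<omega>)} \<in> sets (F (g i))"
      by blast
    moreover have "A \<inter> {\<omega>\<in>space (F (g i)). \<forall>j\<in>{..i}. norm (X (g j) \<omega> - X s \<omega>) \<le> \<theta> * norm (X s \<omega>)} = G i"
      unfolding G_def using past_event_in_space by auto
    ultimately show ?thesis by simp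
  qed
  define Z where "Z i \<omega> = indicator (G i) \<omega> / norm (X s \<omega>)" for i \<omega>
  have Zm: "Z i \<in> borel_measurable (F (g i))" for i
  proof -
    have [measurable]: "X s \<in> borel_measurable (F (g i))" using gs[of i] s by (intro X_adapted)
    note Gm[of i, measurable]
    show ?thesis unfolding Z_def by measurable
  qed
  have Zb: "\<bar>Z i \<omega>\<bar> \<le> 1 / \<rho>" for i \<omega>
  proof (cases "\<omega> \<in> G i")
    case True
    then have "\<rho> \<le> norm (X s \<omega>)" by (intro \<rho>(2)) (simp add: G_def)
    then show ?thesis using True \<rho>(1) by (simp add: Z_def frac_le)
  qed (use \<rho>(1) in \<open>simp add: Z_def\<close>)
  define H where "H r \<omega> = (\<Sum>i<m. Z i \<omega> *\<^sub>R (indicator {g i<..g (Suc i)} r *\<^sub>R \<sigma> (X r \<omega>)))" for r \<omega>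
  define Y where "Y \<omega> = (\<Sum>i<m. Z i \<omega> *\<^sub>R (X (g (Suc i)) \<omega> - X (g i) \<omega>))" for \<omega>
  have HY: "ito_lim H Y"
    unfolding H_def Y_def
    by (intro ito_lim_sum weighted_increment_ito[OF gnn _ Zm Zb]) (simp add: gmono)
  have ind_sum: "(\<Sum>i<k. indicator {g i<..g (Suc i)} r) = (indicator {g 0<..g k} r :: real)" for k r
  proof (induction k)
    case (Suc k)
    then show ?case using gmono[of 0 k] gmono[of k "Suc k"] by (auto simp: indicator_def)
  qed simp
  \<comment> \<open>On \<open>G i\<close> and off \<open>N0\<close>, \<open>X r\<close> is within
    \<open>norm (X s \<omega>)\<close> of \<open>X (g i)\<close>, which is within the same distance
    of \<open>X s\<close>, as \<open>\<theta> \<le> 1\<close>. Hence its norm is at most three times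
    that of \<open>X s\<close>.\<close>
  have Hb: "norm (H r \<omega>) \<le> (3 * L) * indicator {s<..s + h} r" if \<omega>: "\<omega> \<in> A - N0" for r \<omega>
  proof -
    have "norm (H r \<omega>) \<le> (\<Sum>i<m. (3 * L) * indicator {g i<..g (Suc i)} r)"
      unfolding H_def
    proof (rule sum_norm_le)
      fix i assume i: "i \<in> {..<m}"
      show "norm (Z i \<omega> *\<^sub>R (indicator {g i<..g (Suc i)} r *\<^sub>R \<sigma> (X r \<omega>))) \<le> (3 * L) * indicator {g i<..g (Suc i)} r"
      proof (cases "r \<in> {g i<..g (Suc i)} \<and> \<omega> \<in> G i")
        case True
        have Xs: "\<rho> \<le> norm (X s \<omega>)" using \<omega> by (intro \<rho>(2)) simp
        have "norm (X r \<omega> - X (g i) \<omega>) \<le> \<theta> * \<rho>" using mod'[of \<omega> i r] True i \<omega> past_event_in_space by auto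
        also have "\<dots> \<le> 1 * norm (X s \<omega>)" using \<theta> Xs \<rho>(1) by (intro mult_mono) auto
        finally have 1: "norm (X r \<omega> - X (g i) \<omega>) \<le> norm (X s \<omega>)" by simp
        have "norm (X (g i) \<omega> - X s \<omega>) \<le> \<theta> * norm (X s \<omega>)" using True by (simp add: G_def)
        also have "\<dots> \<le> 1 * norm (X s \<omega>)" using \<theta> by (intro mult_right_mono) auto
        finally have 2: "norm (X (g i) \<omega> - X s \<omega>) \<le> norm (X s \<omega>)" by simp
        have "norm (X r \<omega>) = norm ((X r \<omega> - X (g i) \<omega>) + (X (g i) \<omega> - X s \<omega>) + X s \<omega>)" by simp
        also have "\<dots> \<le> norm (X s \<omega>) + norm (X s \<omega>) + norm (X s \<omega>)"
          by (intro norm_triangle_mono 1 2 order_refl)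
        finally have "norm (X r \<omega>) \<le> 3 * norm (X s \<omega>)" by simp
        then have "norm (\<sigma> (X r \<omega>)) \<le> L * (3 * norm (X s \<omega>))"
          using L_pos by (intro order_trans[OF \<sigma>_norm] mult_left_mono) auto
        then show ?thesis using True Xs \<rho>(1) L_pos by (simp add: Z_def divide_le_eq mult_ac)
      next
        case False
        then show ?thesis using L_pos by (auto simp: Z_def indicator_def)
      qed
    qed
    also have "\<dots> = (3 * L) * indicator {s<..s + h} r"
      unfolding sum_distrib_left[symmetric] ind_sum g0 gm ..
    finally show ?thesis .
  qed
  define N1 where "N1 = {\<omega>\<in>A. 2 * (\<theta> / 4) < norm (Y \<omega>)}"
  have "measure M N1 \<le> 6 * ((3 * L)\<^sup>2 * h) * measure M A / (\<theta> / 4)\<^sup>2 + measure M N0"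
    unfolding N1_def
  proof (rule ito_lim_lenglart[OF HY s _ A N0(1)])
    show "H r \<omega> = 0" if "r \<le> s" for r \<omega>
    proof -
      have "indicator {g i<..g (Suc i)} r = (0 :: real)" for i using that gs[of i] by (simp add: indicator_def)
      then show ?thesis unfolding H_def by simp
    qed
    show "(\<integral>\<^sup>+r. ennreal ((norm (H r \<omega>))\<^sup>2) \<partial>lborel) \<le> ennreal ((3 * L)\<^sup>2 * h)" if "\<omega> \<in> A - N0" for \<omega>
      using h by (intro sq_integral_interval_bound[where s=s] Hb that) simp
  qed (use h \<theta> in auto)
  \<comment> \<open>864 = 6 * 9 * 16: the constant of Lenglart's inequality, the square of 3, and
    the level \<theta> / 4.\<close>
  also have "6 * ((3 * L)\<^sup>2 * h) * measure M A / (\<theta> / 4)\<^sup>2 = 864 * L\<^sup>2 * h / \<theta>\<^sup>2 * measure M A"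
    by (simp add: power_mult_distrib power_divide)
  finally have PN1: "measure M N1 \<le> 864 * L\<^sup>2 * h / \<theta>\<^sup>2 * measure M A + measure M N0" .
  have N1m: "N1 \<in> sets M"
  proof -
    have [measurable]: "Z i \<in> borel_measurable M" "X (g i) \<in> borel_measurable M" for i
      by (rule measurable_F_M[OF Zm], rule X_measurable[OF gnn])
    have "{\<omega>\<in>space M. 2 * (\<theta> / 4) < norm (Y \<omega>)} \<in> sets M" unfolding Y_def by measurable
    then have "A \<inter> {\<omega>\<in>space M. 2 * (\<theta> / 4) < norm (Y \<omega>)} \<in> sets M" using past_event_measurable by blast
    moreover have "A \<inter> {\<omega>\<in>space M. 2 * (\<theta> / 4) < norm (Y \<omega>)} = N1" unfolding N1_def using past_event_in_space by auto
    ultimately show ?thesis by simp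
  qed
  \<comment> \<open>At the smallest failing index \<open>k\<close> exactly the increments before
    \<open>k\<close> carry a nonzero weight, so \<open>Y\<close> telescopes to the displacement at
    \<open>g k\<close> divided by the starting norm, which off \<open>N1\<close> is too small for an
    exit.\<close>
  have grid: "norm (X (g k) \<omega> - X s \<omega>) \<le> \<theta> * norm (X s \<omega>)" if \<omega>: "\<omega> \<in> A - N1" and k: "k \<le> m" for \<omega> k
    using k
  proof (induction k rule: less_induct)
    case (less k)
    have Xs: "0 < norm (X s \<omega>)" using \<rho>(2)[of \<omega>] \<rho>(1) \<omega> by auto
    show ?case
    proof (rule ccontr)
      assume "\<not> norm (X (g k) \<omega> - X s \<omega>) \<le> \<theta> * norm (X s \<omega>)"
      then have gt: "\<theta> * norm (X s \<omega>) < norm (X (g k) \<omega> - X s \<omega>)" by simp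
      have Gi: "\<omega> \<in> G i \<longleftrightarrow> i < k" if "i < m" for i
      proof
        assume "\<omega> \<in> G i"
        then show "i < k" using gt unfolding G_def by (auto simp: not_less[symmetric])
      next
        assume "i < k"
        then show "\<omega> \<in> G i" using less \<omega> by (auto simp: G_def)
      qed
      have "Y \<omega> = (\<Sum>i<m. if i < k then (1 / norm (X s \<omega>)) *\<^sub>R (X (g (Suc i)) \<omega> - X (g i) \<omega>) else 0)"
        unfolding Y_def Z_def by (intro sum.cong) (auto simp: Gi)
      also have "\<dots> = (\<Sum>i<k. (1 / norm (X s \<omega>)) *\<^sub>R (X (g (Suc i)) \<omega> - X (g i) \<omega>))"
        using less.prems by (intro sum.mono_neutral_cong_right) auto
      also have "\<dots> = (1 / norm (X s \<omega>)) *\<^sub>R (\<Sum>i<k. X (g (Suc i)) \<omega> - X (g i) \<omega>)"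
        by (rule scaleR_sum_right[symmetric])
      also have "(\<Sum>i<k. X (g (Suc i)) \<omega> - X (g i) \<omega>) = X (g k) \<omega> - X s \<omega>"
        using sum_lessThan_telescope[of "\<lambda>i. X (g i) \<omega>" k] g0 by simp
      finally have "norm (Y \<omega>) = norm (X (g k) \<omega> - X s \<omega>) / norm (X s \<omega>)" by simp
      then have "\<theta> < norm (Y \<omega>)" using gt Xs by (simp add: pos_less_divide_eq)
      then show False using \<omega> \<theta> by (simp add: N1_def)
    qed
  qed
  have cell: "\<exists>i<k. g i \<le> r \<and> r \<le> g (Suc i)" if "s \<le> r" "r \<le> g k" "k > 0" for r k
    using that
  proof (induction k)
    case (Suc k)
    show ?case
    proof (cases "r \<le> g k \<and> k > 0")
      case True
      then show ?thesis using Suc less_SucI by blast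
    next
      case False
      then have "g k \<le> r" using Suc g0 by (cases k) auto
      then show ?thesis using Suc by blast
    qed
  qed simp
  show ?thesis
  proof (intro bexI[of _ "N0 \<union> N1"] conjI ballI)
    show "measure M (N0 \<union> N1) \<le> 864 * L\<^sup>2 * h / \<theta>\<^sup>2 * measure M A + \<kappa>"
      using measure_Un_le[OF N0(1) N1m] PN1 N0(2) by linarith
    fix \<omega> r assume \<omega>: "\<omega> \<in> A - (N0 \<union> N1)" and r: "r \<in> {s..s + h}"
    obtain i where i: "i < m" "g i \<le> r" "r \<le> g (Suc i)" using cell[of r m] r gm m by auto
    \<comment> \<open>One \<theta> for the oscillation inside a cell, one for the grid
      points.\<close>
    have "norm (X r \<omega> - X (g i) \<omega>) \<le> \<theta> * \<rho>" using mod'[of \<omega> i r] \<omega> i past_event_in_space by auto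
    also have "\<dots> \<le> \<theta> * norm (X s \<omega>)" using \<rho>(2)[of \<omega>] \<omega> \<theta> by (intro mult_left_mono) auto
    finally have "norm ((X r \<omega> - X (g i) \<omega>) + (X (g i) \<omega> - X s \<omega>)) \<le> \<theta> * norm (X s \<omega>) + \<theta> * norm (X s \<omega>)"
      using grid[of \<omega> i] \<omega> i by (intro norm_triangle_mono) auto
    then show "norm (X r \<omega> - X s \<omega>) \<le> 2 * \<theta> * norm (X s \<omega>)" by simp
  qed (use N0 N1m in auto)
qed

text \<open>The Euler step is the integral with the coefficient frozen at \<open>X s\<close>, an
  elementary integrand after division by the norm. While the path stays in the ball of
  \<open>deviation\<close>, the two coefficients differ by at most
  \<open>2 * L * \<theta> * norm (X s \<omega>)\<close>. The first summand is Lenglart's bound for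
  the difference, with 96 = 6 * 4 * 4; the second is the probability of leaving the ball.\<close>

lemma euler_error:
  assumes \<eta>: "0 < \<eta>"
  shows "measure M {\<omega>\<in>A. \<eta> * norm (X s \<omega>) < norm (X (s + h) \<omega> - X s \<omega> - \<sigma> (X s \<omega>) *v (W (s + h) \<omega> - W s \<omega>))}
    \<le> (96 * L\<^sup>2 * \<theta>\<^sup>2 * h / \<eta>\<^sup>2 + 864 * L\<^sup>2 * h / \<theta>\<^sup>2) * measure M A"
proof (rule field_le_epsilon)
  fix \<kappa> :: real assume "\<kappa> > 0"
  from deviation[OF this] obtain N where N: "N \<in> sets M" "measure M N \<le> 864 * L\<^sup>2 * h / \<theta>\<^sup>2 * measure M A + \<kappa>"
    and dev: "\<forall>\<omega>\<in>A - N. \<forall>r\<in>{s..s + h}. norm (X r \<omega> - X s \<omega>) \<le> 2 * \<theta> * norm (X s \<omega>)"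
    by (elim bexE conjE)
  define Z where "Z \<omega> = indicator A \<omega> / norm (X s \<omega>)" for \<omega>
  note [measurable] = X_adapted[OF s order_refl] A
  have Zm[measurable]: "Z \<in> borel_measurable (F s)" unfolding Z_def by measurable
  have Zb: "\<bar>Z \<omega>\<bar> \<le> 1 / \<rho>" for \<omega>
    using \<rho>(2)[of \<omega>] \<rho>(1) by (cases "\<omega> \<in> A") (simp_all add: Z_def frac_le)
  have 1: "ito_lim (\<lambda>r \<omega>. Z \<omega> *\<^sub>R (indicator {s<..s + h} r *\<^sub>R \<sigma> (X r \<omega>))) (\<lambda>\<omega>. Z \<omega> *\<^sub>R (X (s + h) \<omega> - X s \<omega>))"
    using h by (intro weighted_increment_ito[OF s _ Zm Zb]) simp
  have 2: "ito_lim (\<lambda>r \<omega>. indicator {s<..s + h} r *\<^sub>R (Z \<omega> *\<^sub>R \<sigma> (X s \<omega>))) (\<lambda>\<omega>. (Z \<omega> *\<^sub>R \<sigma> (X s \<omega>)) *v (W (s + h) \<omega> - W s \<omega>))"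
  proof (rule ito_lim_elem[OF elem_term[OF s, where C=L]])
    show "(\<lambda>\<omega>. Z \<omega> *\<^sub>R \<sigma> (X s \<omega>)) \<in> borel_measurable (F s)" by measurable
    show "norm (Z \<omega> *\<^sub>R \<sigma> (X s \<omega>)) \<le> L" for \<omega>
      using \<sigma>_norm[of "X s \<omega>"] L_pos by (cases "\<omega> \<in> A") (auto simp: Z_def divide_le_eq)
  qed (use h in simp)
  note HY = ito_lim_diff[OF 1 2]
  have sq: "norm (Z \<omega> *\<^sub>R (indicator {s<..s + h} r *\<^sub>R \<sigma> (X r \<omega>)) - indicator {s<..s + h} r *\<^sub>R (Z \<omega> *\<^sub>R \<sigma> (X s \<omega>)))
     \<le> (2 * L * \<theta>) * indicator {s<..s + h} r" if \<omega>: "\<omega> \<in> A - N" for \<omega> r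
  proof (cases "r \<in> {s<..s + h}")
    case True
    have Xs: "0 < norm (X s \<omega>)" using \<rho>(2)[of \<omega>] \<rho>(1) \<omega> by auto
    have "norm (\<sigma> (X r \<omega>) - \<sigma> (X s \<omega>)) \<le> L * (2 * \<theta> * norm (X s \<omega>))"
      using dev[rule_format, OF \<omega>, of r] True L_pos by (intro order_trans[OF lipschitz] mult_left_mono) auto
    moreover have "norm (Z \<omega> *\<^sub>R (indicator {s<..s + h} r *\<^sub>R \<sigma> (X r \<omega>)) - indicator {s<..s + h} r *\<^sub>R (Z \<omega> *\<^sub>R \<sigma> (X s \<omega>)))
       = norm (\<sigma> (X r \<omega>) - \<sigma> (X s \<omega>)) / norm (X s \<omega>)"
    proof -
      have "Z \<omega> *\<^sub>R (indicator {s<..s + h} r *\<^sub>R \<sigma> (X r \<omega>)) - indicator {s<..s + h} r *\<^sub>R (Z \<omega> *\<^sub>R \<sigma> (X s \<omega>))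
        = (1 / norm (X s \<omega>)) *\<^sub>R (\<sigma> (X r \<omega>) - \<sigma> (X s \<omega>))"
        using True \<omega> by (simp add: Z_def scaleR_diff_right)
      then show ?thesis by simp
    qed
    ultimately show ?thesis using True Xs L_pos by (simp add: divide_le_eq mult_ac)
  qed simp
  have "measure M {\<omega>\<in>A. 2 * (\<eta> / 2) < norm (Z \<omega> *\<^sub>R (X (s + h) \<omega> - X s \<omega>) - (Z \<omega> *\<^sub>R \<sigma> (X s \<omega>)) *v (W (s + h) \<omega> - W s \<omega>))}
    \<le> 6 * ((2 * L * \<theta>)\<^sup>2 * h) * measure M A / (\<eta> / 2)\<^sup>2 + measure M N"
  proof (rule ito_lim_lenglart[OF HY s _ A N(1)])
    show "(\<integral>\<^sup>+r. ennreal ((norm (Z \<omega> *\<^sub>R (indicator {s<..s + h} r *\<^sub>R \<sigma> (X r \<omega>)) - indicator {s<..s + h} r *\<^sub>R (Z \<omega> *\<^sub>R \<sigma> (X s \<omega>))))\<^sup>2) \<partial>lborel)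
      \<le> ennreal ((2 * L * \<theta>)\<^sup>2 * h)" if "\<omega> \<in> A - N" for \<omega>
      using h by (intro sq_integral_interval_bound[where s=s] sq that) simp
  qed (use h \<eta> in auto)
  also have "{\<omega>\<in>A. 2 * (\<eta> / 2) < norm (Z \<omega> *\<^sub>R (X (s + h) \<omega> - X s \<omega>) - (Z \<omega> *\<^sub>R \<sigma> (X s \<omega>)) *v (W (s + h) \<omega> - W s \<omega>))}
    = {\<omega>\<in>A. \<eta> * norm (X s \<omega>) < norm (X (s + h) \<omega> - X s \<omega> - \<sigma> (X s \<omega>) *v (W (s + h) \<omega> - W s \<omega>))}"
  proof (rule Collect_cong, rule conj_cong[OF refl])
    fix \<omega> assume \<omega>: "\<omega> \<in> A"
    have Xs: "0 < norm (X s \<omega>)" using \<rho>(2)[of \<omega>] \<rho>(1) \<omega> by auto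
    have "Z \<omega> *\<^sub>R (X (s + h) \<omega> - X s \<omega>) - (Z \<omega> *\<^sub>R \<sigma> (X s \<omega>)) *v (W (s + h) \<omega> - W s \<omega>)
      = (1 / norm (X s \<omega>)) *\<^sub>R (X (s + h) \<omega> - X s \<omega> - \<sigma> (X s \<omega>) *v (W (s + h) \<omega> - W s \<omega>))"
      using \<omega> by (simp add: Z_def scaleR_diff_right scaleR_matrix_vector_assoc)
    then show "2 * (\<eta> / 2) < norm (Z \<omega> *\<^sub>R (X (s + h) \<omega> - X s \<omega>) - (Z \<omega> *\<^sub>R \<sigma> (X s \<omega>)) *v (W (s + h) \<omega> - W s \<omega>))
      \<longleftrightarrow> \<eta> * norm (X s \<omega>) < norm (X (s + h) \<omega> - X s \<omega> - \<sigma> (X s \<omega>) *v (W (s + h) \<omega> - W s \<omega>))"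
      using Xs by (simp add: pos_less_divide_eq)
  qed
  also have "6 * ((2 * L * \<theta>)\<^sup>2 * h) * measure M A / (\<eta> / 2)\<^sup>2 = 96 * L\<^sup>2 * \<theta>\<^sup>2 * h / \<eta>\<^sup>2 * measure M A"
    by (simp add: power_mult_distrib power_divide)
  finally show "measure M {\<omega>\<in>A. \<eta> * norm (X s \<omega>) < norm (X (s + h) \<omega> - X s \<omega> - \<sigma> (X s \<omega>) *v (W (s + h) \<omega> - W s \<omega>))}
    \<le> (96 * L\<^sup>2 * \<theta>\<^sup>2 * h / \<eta>\<^sup>2 + 864 * L\<^sup>2 * h / \<theta>\<^sup>2) * measure M A + \<kappa>"
    using N(2) by (simp add: distrib_right)
qed

text \<open>The inner product of \<open>X s\<close> and \<open>X (s + h)\<close> is the squared norm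
  of \<open>X s\<close>, plus \<open>c * norm (X s)\<close> times the inner product with the
  Brownian increment, plus an error term; Cauchy-Schwarz converts it into a lower bound for the new
  norm. A favourable increment without a large error thus succeeds, and the two probability bounds
  are subtracted. Measurability at \<open>s + h\<close> makes the success event the past event of
  the next step.\<close>

lemma one_step:
  assumes \<eta>: "0 < \<eta>" "0 \<le> 1 + c * sqrt h - \<eta>"
  shows "{\<omega>\<in>A. \<rho> * (1 + c * sqrt h - \<eta>) \<le> norm (X (s + h) \<omega>)} \<in> sets (F (s + h))"
    and "((exp (-2) / sqrt (2 * pi)) ^ 3 - (96 * L\<^sup>2 * \<theta>\<^sup>2 * h / \<eta>\<^sup>2 + 864 * L\<^sup>2 * h / \<theta>\<^sup>2)) * measure M A
      \<le> measure M {\<omega>\<in>A. \<rho> * (1 + c * sqrt h - \<eta>) \<le> norm (X (s + h) \<omega>)}"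
proof -
  define D where "D \<omega> = W (s + h) \<omega> - W s \<omega>" for \<omega>
  define er where "er \<omega> = X (s + h) \<omega> - X s \<omega> - \<sigma> (X s \<omega>) *v D \<omega>" for \<omega>
  let ?S = "{\<omega>\<in>A. \<rho> * (1 + c * sqrt h - \<eta>) \<le> norm (X (s + h) \<omega>)}"
  define E1 where "E1 = {\<omega>\<in>A. sqrt h * norm (X s \<omega>) \<le> X s \<omega> \<bullet> D \<omega>}"
  define E2 where "E2 = {\<omega>\<in>A. \<eta> * norm (X s \<omega>) < norm (er \<omega>)}"
  show SF: "?S \<in> sets (F (s + h))"
  proof -
    have [measurable]: "X (s + h) \<in> borel_measurable (F (s + h))" using s h by (intro X_adapted) auto
    have "A \<in> sets (F (s + h))" using h by (intro subsetD[OF sets_F_mono A]) simp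
    moreover have "{\<omega>\<in>space (F (s + h)). \<rho> * (1 + c * sqrt h - \<eta>) \<le> norm (X (s + h) \<omega>)} \<in> sets (F (s + h))"
      by measurable
    ultimately have "A \<inter> {\<omega>\<in>space (F (s + h)). \<rho> * (1 + c * sqrt h - \<eta>) \<le> norm (X (s + h) \<omega>)} \<in> sets (F (s + h))"
      by (rule sets.Int)
    moreover have "A \<inter> {\<omega>\<in>space (F (s + h)). \<rho> * (1 + c * sqrt h - \<eta>) \<le> norm (X (s + h) \<omega>)} = ?S"
      using past_event_in_space by auto
    ultimately show ?thesis by simp
  qed
  have [measurable]: "X s \<in> borel_measurable M" "X (s + h) \<in> borel_measurable M" "W s \<in> borel_measurable M" "W (s + h) \<in> borel_measurable M"
    using s h by (auto intro: X_measurable W_measurable)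
  have erm[measurable]: "er \<in> borel_measurable M" unfolding er_def D_def by measurable
  have E2m: "E2 \<in> sets M"
  proof -
    have "A \<inter> {\<omega>\<in>space M. \<eta> * norm (X s \<omega>) < norm (er \<omega>)} \<in> sets M"
      by (intro sets.Int past_event_measurable) measurable
    moreover have "A \<inter> {\<omega>\<in>space M. \<eta> * norm (X s \<omega>) < norm (er \<omega>)} = E2"
      unfolding E2_def using past_event_in_space by auto
    ultimately show ?thesis by simp
  qed
  have SM: "?S \<in> sets M" using SF sets_F_M by blast
  have "E1 \<subseteq> ?S \<union> E2"
  proof
    fix \<omega> assume \<omega>: "\<omega> \<in> E1"
    then have A: "\<omega> \<in> A" and D: "sqrt h * norm (X s \<omega>) \<le> X s \<omega> \<bullet> D \<omega>" by (auto simp: E1_def)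
    show "\<omega> \<in> ?S \<union> E2"
    proof (cases "\<omega> \<in> E2")
      case False
      then have er: "norm (er \<omega>) \<le> \<eta> * norm (X s \<omega>)" using A by (simp add: E2_def)
      let ?n = "norm (X s \<omega>)"
      have n: "\<rho> \<le> ?n" "0 < ?n" using \<rho>(2)[OF A] \<rho>(1) by auto
      have "?n * (?n * (1 + c * sqrt h - \<eta>)) = ?n\<^sup>2 + c * ?n * (sqrt h * ?n) - ?n * (\<eta> * ?n)"
        by (simp add: algebra_simps power2_eq_square)
      also have "\<dots> \<le> ?n\<^sup>2 + c * ?n * (X s \<omega> \<bullet> D \<omega>) - ?n * norm (er \<omega>)"
        using D er c_pos by (intro diff_mono add_left_mono mult_left_mono) auto
      also have "\<dots> \<le> ?n\<^sup>2 + c * ?n * (X s \<omega> \<bullet> D \<omega>) + X s \<omega> \<bullet> er \<omega>"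
        using Cauchy_Schwarz_ineq2[of "X s \<omega>" "er \<omega>"] by (simp add: abs_le_iff)
      also have "\<dots> = X s \<omega> \<bullet> (X s \<omega> + \<sigma> (X s \<omega>) *v D \<omega> + er \<omega>)"
        by (simp add: inner_add_right radial power2_norm_eq_inner)
      also have "X s \<omega> + \<sigma> (X s \<omega>) *v D \<omega> + er \<omega> = X (s + h) \<omega>" by (simp add: er_def)
      also have "X s \<omega> \<bullet> X (s + h) \<omega> \<le> ?n * norm (X (s + h) \<omega>)" by (rule norm_cauchy_schwarz)
      finally have "?n * (1 + c * sqrt h - \<eta>) \<le> norm (X (s + h) \<omega>)" using n by simp
      moreover have "\<rho> * (1 + c * sqrt h - \<eta>) \<le> ?n * (1 + c * sqrt h - \<eta>)"
        using n \<eta> by (intro mult_right_mono) auto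
      ultimately show ?thesis using A by auto
    qed simp
  qed
  then have "measure M E1 \<le> measure M (?S \<union> E2)"
    by (rule finite_measure_mono[OF _ sets.Un[OF SM E2m]])
  also have "\<dots> \<le> measure M ?S + measure M E2" by (rule measure_Un_le[OF SM E2m])
  also have "measure M E2 \<le> (96 * L\<^sup>2 * \<theta>\<^sup>2 * h / \<eta>\<^sup>2 + 864 * L\<^sup>2 * h / \<theta>\<^sup>2) * measure M A"
    unfolding E2_def er_def D_def by (rule euler_error[OF \<eta>(1)])
  finally show "((exp (-2) / sqrt (2 * pi)) ^ 3 - (96 * L\<^sup>2 * \<theta>\<^sup>2 * h / \<eta>\<^sup>2 + 864 * L\<^sup>2 * h / \<theta>\<^sup>2)) * measure M A \<le> measure M ?S"
    using increment_octant[OF s h A X_adapted[OF s order_refl]] unfolding E1_def D_def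
    by (simp add: left_diff_distrib)
qed

end

text \<open>The level reached after \<open>n\<close> steps is a number, not a random variable, and
  serves as the lower bound \<rho> of the next step. The success probability of a step does not
  depend on that level, so the factors multiply.\<close>

lemma iterate_step:
  assumes h: "0 < h" and \<rho>: "0 < \<rho>" "\<rho> \<le> norm \<nu>" and \<theta>: "0 < \<theta>" "\<theta> \<le> 1" and \<eta>: "0 < \<eta>" "0 < 1 + c * sqrt h - \<eta>"
    and p: "0 \<le> p" "p \<le> (exp (-2) / sqrt (2 * pi)) ^ 3 - (96 * L\<^sup>2 * \<theta>\<^sup>2 * h / \<eta>\<^sup>2 + 864 * L\<^sup>2 * h / \<theta>\<^sup>2)"
  shows "\<exists>A\<in>sets (F (real n * h)). (\<forall>\<omega>\<in>A. \<rho> * (1 + c * sqrt h - \<eta>) ^ n \<le> norm (X (real n * h) \<omega>)) \<and> p ^ n \<le> measure M A"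
proof (induction n)
  case 0
  have [measurable]: "X 0 \<in> borel_measurable (F 0)" by (rule X_adapted) auto
  let ?A = "{\<omega>\<in>space (F 0). \<rho> \<le> norm (X 0 \<omega>)}"
  have A: "?A \<in> sets (F 0)" by measurable
  have "AE \<omega> in M. X 0 \<omega> = \<nu>" using X unfolding solves_def by blast
  then have "AE \<omega> in M. \<omega> \<in> ?A" using AE_space by eventually_elim (use \<rho> in simp)
  then have "measure M ?A = 1" using prob_eq_1[OF subsetD[OF sets_F_M A]] by simp
  then show ?case using A by (intro bexI[of _ ?A]) auto
next
  case (Suc n)
  let ?s = "real n * h" and ?\<gamma> = "1 + c * sqrt h - \<eta>"
  obtain A where A: "A \<in> sets (F ?s)" "\<And>\<omega>. \<omega> \<in> A \<Longrightarrow> \<rho> * ?\<gamma> ^ n \<le> norm (X ?s \<omega>)" "p ^ n \<le> measure M A"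
    using Suc by blast
  have s: "0 \<le> ?s" and \<rho>': "0 < \<rho> * ?\<gamma> ^ n" using h \<rho> \<eta> by auto
  note step = one_step[OF s h A(1) \<rho>' A(2) \<theta> \<eta>(1) less_imp_le[OF \<eta>(2)]]
  have "p ^ Suc n \<le> p * measure M A" using A(3) p(1) by (simp add: mult_left_mono)
  also have "\<dots> \<le> ((exp (-2) / sqrt (2 * pi)) ^ 3 - (96 * L\<^sup>2 * \<theta>\<^sup>2 * h / \<eta>\<^sup>2 + 864 * L\<^sup>2 * h / \<theta>\<^sup>2)) * measure M A"
    using p(2) by (intro mult_right_mono) auto
  also note step(2)
  finally have "p ^ Suc n \<le> measure M {\<omega> \<in> A. \<rho> * ?\<gamma> ^ n * ?\<gamma> \<le> norm (X (?s + h) \<omega>)}" .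
  moreover have "?s + h = real (Suc n) * h" by (simp add: distrib_right)
  moreover have "\<rho> * ?\<gamma> ^ n * ?\<gamma> = \<rho> * ?\<gamma> ^ Suc n" by (simp only: power_Suc2 mult.assoc)
  ultimately show ?case
    using step(1) by (metis (no_types, lifting) mem_Collect_eq)
qed

end

text \<open>The number of steps depends on \<rho>, \<open>t\<close>, \<open>R\<close> and the
  constants of the equation but not on the initial value; hence the uniformity of
  \<open>(q / 2) ^ n\<close>.\<close>

lemma escape_probability:
  assumes \<rho>: "0 < \<rho>" and t: "0 < t"
  shows "\<exists>lam>0. \<forall>\<nu> X. solves \<nu> X \<and> \<rho> \<le> norm \<nu> \<longrightarrow> lam \<le> measure M {\<omega>\<in>space M. R \<le> norm (X t \<omega>)}"
proof -
  define q :: real where "q = (exp (-2) / sqrt (2 * pi)) ^ 3"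
  have q: "0 < q" by (simp add: q_def)
  \<comment> \<open>With \<open>\<theta> = a * sqrt h\<close> and \<open>\<eta> = b * h\<close>,
    \<open>a\<close> makes the exit term \<open>864 * L\<^sup>2 / a\<^sup>2\<close> equal to
    \<open>q / 4\<close>, and then \<open>b\<close> does the same for the error term
    \<open>96 * L\<^sup>2 * a\<^sup>2 / b\<^sup>2\<close>.\<close>
  define a where "a = sqrt (3456 * L\<^sup>2 / q)"
  have a: "0 < a" "a\<^sup>2 = 3456 * L\<^sup>2 / q" using q L_pos by (simp_all add: a_def)
  define b where "b = sqrt (384 * L\<^sup>2 * a\<^sup>2 / q)"
  have b: "0 < b" "b\<^sup>2 = 384 * L\<^sup>2 * a\<^sup>2 / q" using q L_pos a by (simp_all add: b_def)
  \<comment> \<open>In this order: \<open>\<theta> \<le> 1\<close>; the loss \<open>b * h\<close> is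
    at most half of the gain \<open>c * sqrt h\<close>; \<open>n\<close> is positive; Bernoulli's
    lower bound reaches \<open>R\<close>.\<close>
  obtain n :: nat where n: "max (a\<^sup>2 * t) (max ((2 * b / c)\<^sup>2 * t) (max 1 ((2 * R / (c * \<rho>))\<^sup>2 / t))) < real n"
    using reals_Archimedean2 by blast
  then have n0: "0 < real n" by auto
  define h where "h = t / real n"
  have h: "0 < h" "real n * h = t" using t n0 by (simp_all add: h_def)
  have "a\<^sup>2 * h \<le> 1" using n n0 by (simp add: h_def divide_le_eq)
  then have \<theta>: "0 < a * sqrt h" "a * sqrt h \<le> 1"
    using a h by (auto intro!: power2_le_imp_le[of "a * sqrt h" 1] simp: power_mult_distrib)
  have bc: "(2 * b / c)\<^sup>2 * h \<le> 1" using n n0 by (simp add: h_def divide_le_eq)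
  have "2 * b / c * sqrt h \<le> 1"
  proof (rule power2_le_imp_le)
    have "(2 * b / c * sqrt h)\<^sup>2 = (2 * b / c)\<^sup>2 * h" using h(1) by (simp add: power_mult_distrib power_divide)
    then show "(2 * b / c * sqrt h)\<^sup>2 \<le> 1\<^sup>2" using bc by simp
  qed simp
  then have "b * sqrt h \<le> c / 2" using c_pos by (simp add: field_simps)
  then have "b * sqrt h * sqrt h \<le> c / 2 * sqrt h" using h by (intro mult_right_mono) auto
  then have bh: "b * h \<le> c / 2 * sqrt h" using h by (simp add: mult.assoc)
  have \<eta>: "0 < b * h" using b h by simp
  have \<gamma>1: "1 + c / 2 * sqrt h \<le> 1 + c * sqrt h - b * h" using bh by simp
  have ch: "0 < c / 2 * sqrt h" using c_pos h by simp
  have \<gamma>: "0 < 1 + c * sqrt h - b * h" using \<gamma>1 ch by linarith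
  have pq: "q / 2 \<le> q - (96 * L\<^sup>2 * (a * sqrt h)\<^sup>2 * h / (b * h)\<^sup>2 + 864 * L\<^sup>2 * h / (a * sqrt h)\<^sup>2)"
  proof -
    have "96 * L\<^sup>2 * (a * sqrt h)\<^sup>2 * h / (b * h)\<^sup>2 = 96 * L\<^sup>2 * a\<^sup>2 / b\<^sup>2"
    proof -
      have "(a * sqrt h)\<^sup>2 = a\<^sup>2 * h" using h(1) by (simp add: power_mult_distrib)
      then show ?thesis using h(1) b(1) by (simp add: power_mult_distrib power2_eq_square[of h])
    qed
    also have "\<dots> = q / 4" unfolding b(2) using q a(1) L_pos by (simp add: field_simps)
    finally have 1: "96 * L\<^sup>2 * (a * sqrt h)\<^sup>2 * h / (b * h)\<^sup>2 = q / 4" .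
    have "864 * L\<^sup>2 * h / (a * sqrt h)\<^sup>2 = 864 * L\<^sup>2 / a\<^sup>2"
      using h(1) by (simp add: power_mult_distrib)
    also have "\<dots> = q / 4" unfolding a(2) using q L_pos by (simp add: field_simps)
    finally show ?thesis using 1 by simp
  qed
  have R: "R \<le> \<rho> * (1 + c * sqrt h - b * h) ^ n"
  proof -
    have "(2 * R / (c * \<rho>))\<^sup>2 \<le> real n * t" using n t by (simp add: divide_less_eq less_imp_le)
    also have "real n * t = (real n * sqrt h)\<^sup>2"
      using h n0 by (simp add: power_mult_distrib power2_eq_square h(2)[symmetric] mult_ac)
    finally have "(2 * R / (c * \<rho>))\<^sup>2 \<le> (real n * sqrt h)\<^sup>2" .
    then have "2 * R / (c * \<rho>) \<le> real n * sqrt h"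
      by (rule power2_le_imp_le) (use h(1) in simp)
    then have "R \<le> \<rho> * (real n * (c / 2 * sqrt h))" using c_pos \<rho> by (simp add: field_simps)
    also have "\<dots> \<le> \<rho> * (1 + c / 2 * sqrt h) ^ n"
      using Bernoulli_inequality[of "c / 2 * sqrt h" n] ch \<rho> by (intro mult_left_mono) auto
    also have "\<dots> \<le> \<rho> * (1 + c * sqrt h - b * h) ^ n"
      using \<gamma>1 ch \<rho> by (intro mult_left_mono power_mono) auto
    finally show ?thesis .
  qed
  show ?thesis
  proof (intro exI[of _ "(q / 2) ^ n"] conjI allI impI)
    fix \<nu> X assume "solves \<nu> X \<and> \<rho> \<le> norm \<nu>"
    then have X: "solves \<nu> X" and \<nu>: "\<rho> \<le> norm \<nu>" by auto
    obtain A where A: "A \<in> sets (F (real n * h))" "\<And>\<omega>. \<omega> \<in> A \<Longrightarrow> \<rho> * (1 + c * sqrt h - b * h) ^ n \<le> norm (X (real n * h) \<omega>)" "(q / 2) ^ n \<le> measure M A"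
      using iterate_step[OF X h(1) \<rho> \<nu> \<theta> \<eta> \<gamma>, of "q / 2" n] q pq unfolding q_def by auto
    have [measurable]: "X t \<in> borel_measurable M" using X_measurable[OF X] t by simp
    have "measure M A \<le> measure M {\<omega>\<in>space M. R \<le> norm (X t \<omega>)}"
    proof (rule finite_measure_mono)
      show "A \<subseteq> {\<omega>\<in>space M. R \<le> norm (X t \<omega>)}"
        using A(2) R sets.sets_into_space[OF A(1)] unfolding h(2) by (auto intro: order_trans)
    qed measurable
    then show "(q / 2) ^ n \<le> measure M {\<omega>\<in>space M. R \<le> norm (X t \<omega>)}" using A(3) by linarith
  qed (use q in simp)
qed

end

section \<open>Initial values on the torus\<close>

text \<open>Periodicity concerns one positive step in one coordinate. Negative multiples follow by
  shifting back from the translated point, lattice vectors by adding up coordinates.\<close>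

lemma periodic_shift:
  assumes "periodic u"
  shows "u (x + (\<chi> i. 2 * pi * of_int (k $ i))) = u x"
proof -
  have step: "u (x + axis i (2 * pi)) = u x" for x i using assms by (simp add: periodic_def)
  have nat: "u (x + axis i (2 * pi * real n)) = u x" for x i n
  proof (induction n)
    case 0
    have "x + axis i (2 * pi * real 0) = x" by (simp add: axis_def vec_eq_iff)
    then show ?case by (rule arg_cong)
  next
    case (Suc n)
    have "x + axis i (2 * pi * real (Suc n)) = (x + axis i (2 * pi * real n)) + axis i (2 * pi)"
      by (simp add: axis_def vec_eq_iff algebra_simps)
    then show ?case by (simp only: step Suc)
  qed
  have int: "u (x + axis i (2 * pi * of_int n)) = u x" for x i n
  proof (cases "0 \<le> n")
    case True
    then show ?thesis using nat[of x i "nat n"] by simp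
  next
    case False
    have "u ((x + axis i (2 * pi * of_int n)) + axis i (2 * pi * real (nat (- n)))) = u (x + axis i (2 * pi * of_int n))"
      by (rule nat)
    moreover have "(x + axis i (2 * pi * of_int n)) + axis i (2 * pi * real (nat (- n))) = x"
      using False by (simp add: axis_def vec_eq_iff)
    ultimately show ?thesis by simp
  qed
  have "u (x + (\<Sum>i\<in>S. axis i (2 * pi * of_int (k $ i)))) = u x" if "finite S" for S
    using that
  proof (induction S rule: finite_induct)
    case (insert i S)
    have "x + (\<Sum>i\<in>insert i S. axis i (2 * pi * of_int (k $ i))) = (x + (\<Sum>i\<in>S. axis i (2 * pi * of_int (k $ i)))) + axis i (2 * pi * of_int (k $ i))"
      using insert by (simp add: ac_simps)
    then show ?case by (simp only: int insert)
  qed simp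
  from this[of UNIV] have "u (x + (\<Sum>i\<in>UNIV. axis i (2 * pi * of_int (k $ i)))) = u x" by simp
  moreover have "(\<Sum>i\<in>UNIV. axis i (2 * pi * of_int (k $ i))) = (\<chi> i. 2 * pi * of_int (k $ i))"
    by (simp add: vec_eq_iff axis_def)
  ultimately show ?thesis by simp
qed

theorem corollaryB6:
  fixes M :: "'a measure"
    and F :: "real \<Rightarrow> 'a measure"
    and W :: "real \<Rightarrow> 'a \<Rightarrow> real^3"
    and b :: "real^3 \<Rightarrow> real \<Rightarrow> 'a \<Rightarrow> real^3"
    and B0 :: "real^3 \<Rightarrow> real^3"
    and t R :: real
  assumes "filtered_prob_space M F"
    and "brownian_motion M F W"
    and "\<And>\<nu>. sde_solution M F W \<nu> (b \<nu>)"
    and "B0 \<in> space_V"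
    and "continuous_on UNIV B0"
    and "\<exists>x. B0 x \<noteq> 0"
    and "t > 0"
    and "R > 0"
  shows "\<exists>x0 r lam. r > 0 \<and> lam > 0 \<and>
           (\<forall>x\<in>torus_ball x0 r. measure (limit_measure M b B0 t x) (- ball 0 R) \<ge> lam)"
proof -
  obtain c L where cL: "0 < c" "0 < L"
    and lip: "\<forall>x y. norm (diffusion_matrix x - diffusion_matrix y) \<le> L * norm (x - y)"
    and rad: "\<forall>x v. x \<bullet> (diffusion_matrix x *v v) = c * norm x * (x \<bullet> v)"
    using diffusion_matrix_props by blast
  have zero: "diffusion_matrix 0 = 0" by (simp add: diffusion_matrix_def)
  have prob: "prob_space M" using assms(1) by (simp add: filtered_prob_space_def)
  interpret radial_sde M F W diffusion_matrix c L
    by (intro radial_sde.intro brownian.intro brownian_axioms.intro radial_sde_axioms.intro prob assms cL zero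
      lip[rule_format] rad[rule_format])
  have sol: "solves \<nu> (b \<nu>)" for \<nu>
    using assms(3)[of \<nu>] by (simp add: solves_def sde_solution_def)
  have per: "periodic B0" using assms(4) by (simp add: space_V_def)
  obtain x0 where x0: "B0 x0 \<noteq> 0" using assms(6) by blast
  \<comment> \<open>Half of the norm at \<open>x0\<close>: where \<open>B0\<close> varies by less
    than \<rho>, its norm stays at least \<rho>.\<close>
  define \<rho> where "\<rho> = norm (B0 x0) / 2"
  have \<rho>: "0 < \<rho>" using x0 by (simp add: \<rho>_def)
  obtain r where r: "r > 0" "\<And>y. dist y x0 < r \<Longrightarrow> dist (B0 y) (B0 x0) < \<rho>"
    using assms(5) \<rho> unfolding continuous_on_iff by (metis UNIV_I)
  obtain lam where lam: "lam > 0"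
    "\<And>\<nu> X. solves \<nu> X \<Longrightarrow> \<rho> \<le> norm \<nu> \<Longrightarrow> lam \<le> measure M {\<omega>\<in>space M. R \<le> norm (X t \<omega>)}"
    using escape_probability[OF \<rho> assms(7), of R] by blast
  show ?thesis
  proof (intro exI conjI ballI)
    fix x assume "x \<in> torus_ball x0 r"
    then obtain k :: "int^3" where k: "dist x (x0 + (\<chi> i. 2 * pi * of_int (k $ i))) < r"
      by (auto simp: torus_ball_def)
    \<comment> \<open>The representative of the torus point that lies near \<open>x0\<close>, where
      continuity applies; \<open>B0\<close> agrees at \<open>x\<close> and \<open>y\<close>.\<close>
    define y where "y = x - (\<chi> i. 2 * pi * of_int (k $ i))"
    have "dist y x0 < r" using k by (simp add: y_def dist_norm algebra_simps)
    then have "dist (B0 y) (B0 x0) < \<rho>" by (rule r(2))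
    then have "\<rho> \<le> norm (B0 y)"
      using norm_triangle_ineq2[of "B0 x0" "B0 y"] by (simp add: \<rho>_def dist_norm norm_minus_commute)
    moreover have "B0 x = B0 y" using periodic_shift[OF per, of y k] by (simp add: y_def)
    ultimately have "\<rho> \<le> norm (B0 x)" by simp
    then have "lam \<le> measure M {\<omega>\<in>space M. R \<le> norm (b (B0 x) t \<omega>)}"
      by (rule lam(2)[OF sol])
    also have "\<dots> = measure (limit_measure M b B0 t x) (- ball 0 R)"
    proof -
      have "b (B0 x) t \<in> borel_measurable M" using X_measurable[OF sol] assms(7) by simp
      then have "measure (limit_measure M b B0 t x) (- ball 0 R) = measure M (b (B0 x) t -` (- ball 0 R) \<inter> space M)"
        unfolding limit_measure_def by (rule measure_distr) simp
      also have "b (B0 x) t -` (- ball 0 R) \<inter> space M = {\<omega>\<in>space M. R \<le> norm (b (B0 x) t \<omega>)}"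
        by (auto simp: not_less)
      finally show ?thesis by simp
    qed
    finally show "lam \<le> measure (limit_measure M b B0 t x) (- ball 0 R)" .
  qed (use r lam in auto)
qed

end
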